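(* The assignment $\mathbf{C}\mapsto\mathrm{Stmat}(\mathbf{C})$, $F\mapsto\mathrm{Stmat}(F)$ is a functor $\mathrm{Stmat}\colon\mathbf{PCACat}\to\mathbf{CBCat}$ which is left adjoint to the forgetful functor $U\colon\mathbf{CBCat}\to\mathbf{PCACat}$.
   Context: Composition is diagrammatic. A pca is a set with $\star$ and $+_p$ ($p\in(0,1)$) satisfying $(x_1+_q x_2)+_p x_3=x_1+_{pq}(x_2+_{\tilde q}x_3)$ ($\tilde q=\frac{p(1-q)}{1-pq}$), $x_1+_px_2=x_2+_{1-p}x_1$, $x+_px=x$; $x+_1y=x$, $x+_0y=y$, $p\cdot x:=x+_p\star$; convex sums $\sum_{i=1}^np_i\cdot x_i$ ($\sum p_i\le1$) are $\star$ for $n=0$ and $x_1+_{p_1}\sum_{j=1}^nq_jx_{j+1}$ with $q_j=p_{j+1}/(1-p_1)$ (or $0$ if $p_1=1$). $\mathbf{PCACat}$ is the category of locally small PCA-enriched categories (pca hom-sets, composition preserving $+_p$ and $\star$ in each argument) and PCA-enriched functors. A convex biproduct category is a PCA-enriched category with an object $0$ both initial and terminal and, for all $X_1,X_2$, an object $X_1\oplus X_2$ with $\iota_i,\pi_i$ making it a coproduct (via $\iota_i$) and a convex product (via $\pi_i$: for all $p_1+p_2\le1$ in $[0,1]$ and $f_i\colon A\to X_i$ a unique $h$ with $h;\pi_i=p_i\cdot f_i$), with $\iota_i;\pi_j=\mathrm{id}$ if $i=j$, $\star$ otherwise; $\mathbf{CBCat}$ has these as objects and PCA-enriched finite-coproduct-preserving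 functors as morphisms. $\mathrm{Stmat}(\mathbf{C})$: objects finite words $\bigoplus_{k=1}^nU_k$ of objects of $\mathbf{C}$; arrows $\bigoplus_{i=1}^nU_i\to\bigoplus_{j=1}^mV_j$ are $m\times n$ matrices of pairs $(p_{ji},f_{ji})$ with $f_{ji}\in\mathbf{C}[U_i,V_j]$, $p_{ji}\in[0,1]$, $\sum_jp_{ji}\le1$, identified when $p_{ji}\cdot f_{ji}=p'_{ji}\cdot f'_{ji}$; composition has entries $(r_{ui},\sum_j\frac{p'_{uj}p_{ji}}{r_{ui}}(f_{ji};f'_{uj}))$, $r_{ui}=\sum_jp'_{uj}p_{ji}$; identities diagonal $(1,\mathrm{id})$, else $(0,\star)$; $\oplus$ is concatenation/block-diagonal sum. $\mathrm{Stmat}(F)$ applies $F$ to objects and to each $f_{ji}$, keeping $p_{ji}$.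
   Formalization: Matrices are identified by the congruence generated by p·f = p'·f' (else composition is ill-defined); the adjunction is a natural equivalence of hom-categories in general, and a hom-set bijection only for strict convex biproduct categories and strict functors (else false: C empty). *)

theory Defs
  imports "HOL-Library.FuncSet" "Jordan_Normal_Form.Matrix"
begin

section \<open>Pointed convex algebras\<close>

locale pca =
  fixes A :: "'a set" and star :: 'a and plus :: "real \<Rightarrow> 'a \<Rightarrow> 'a \<Rightarrow> 'a"
  assumes star_closed: "star \<in> A"
    and plus_closed: "\<lbrakk>0 < p; p < 1; x \<in> A; y \<in> A\<rbrakk> \<Longrightarrow> plus p x y \<in> A"
    and plus_assoc: "\<lbrakk>0 < p; p < 1; 0 < q; q < 1; x \<in> A; y \<in> A; z \<in> A\<rbrakk> \<Longrightarrow>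
      plus p (plus q x y) z = plus (p * q) x (plus (p * (1 - q) / (1 - p * q)) y z)"
    and plus_commute: "\<lbrakk>0 < p; p < 1; x \<in> A; y \<in> A\<rbrakk> \<Longrightarrow> plus p x y = plus (1 - p) y x"
    and plus_idem: "\<lbrakk>0 < p; p < 1; x \<in> A\<rbrakk> \<Longrightarrow> plus p x x = x"


section \<open>PCA-enriched categories\<close>

text \<open>Every arrow carries its source and its target, so hom-sets are disjoint.  \<open>Seq\<close> is composition
  in diagrammatic order.  All operations are only meaningful on their natural domain; in particular
  \<open>Plus C p\<close> is only meaningful for \<open>0 < p < 1\<close>.\<close>

record ('o, 'a) pca_cat =
  Ob :: "'o set"
  Ar :: "'a set"
  Src :: "'a \<Rightarrow> 'o"
  Tgt :: "'a \<Rightarrow> 'o"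
  Idn :: "'o \<Rightarrow> 'a"
  Seq :: "'a \<Rightarrow> 'a \<Rightarrow> 'a"
  Star :: "'o \<Rightarrow> 'o \<Rightarrow> 'a"
  Plus :: "real \<Rightarrow> 'a \<Rightarrow> 'a \<Rightarrow> 'a"

definition Hom :: "('o, 'a, 'z) pca_cat_scheme \<Rightarrow> 'o \<Rightarrow> 'o \<Rightarrow> 'a set" where
  "Hom C X Y = {f \<in> Ar C. Src C f = X \<and> Tgt C f = Y}"

locale pca_category =
  fixes C :: "('o, 'a, 'z) pca_cat_scheme"
  assumes src_closed: "f \<in> Ar C \<Longrightarrow> Src C f \<in> Ob C"
    and tgt_closed: "f \<in> Ar C \<Longrightarrow> Tgt C f \<in> Ob C"
    and idn_closed: "X \<in> Ob C \<Longrightarrow> Idn C X \<in> Hom C X X"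
    and seq_closed: "\<lbrakk>f \<in> Hom C X Y; g \<in> Hom C Y Z\<rbrakk> \<Longrightarrow> Seq C f g \<in> Hom C X Z"
    and seq_idn_left: "f \<in> Hom C X Y \<Longrightarrow> Seq C (Idn C X) f = f"
    and seq_idn_right: "f \<in> Hom C X Y \<Longrightarrow> Seq C f (Idn C Y) = f"
    and seq_assoc: "\<lbrakk>f \<in> Hom C W X; g \<in> Hom C X Y; h \<in> Hom C Y Z\<rbrakk> \<Longrightarrow>
      Seq C (Seq C f g) h = Seq C f (Seq C g h)"
    and pca_Hom: "\<lbrakk>X \<in> Ob C; Y \<in> Ob C\<rbrakk> \<Longrightarrow> pca (Hom C X Y) (Star C X Y) (Plus C)"
    and seq_plus_left: "\<lbrakk>0 < p; p < 1; f \<in> Hom C X Y; f' \<in> Hom C X Y; g \<in> Hom C Y Z\<rbrakk> \<Longrightarrow>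
      Seq C (Plus C p f f') g = Plus C p (Seq C f g) (Seq C f' g)"
    and seq_plus_right: "\<lbrakk>0 < p; p < 1; f \<in> Hom C X Y; g \<in> Hom C Y Z; g' \<in> Hom C Y Z\<rbrakk> \<Longrightarrow>
      Seq C f (Plus C p g g') = Plus C p (Seq C f g) (Seq C f g')"
    and seq_star_left: "\<lbrakk>X \<in> Ob C; g \<in> Hom C Y Z\<rbrakk> \<Longrightarrow> Seq C (Star C X Y) g = Star C X Z"
    and seq_star_right: "\<lbrakk>f \<in> Hom C X Y; Z \<in> Ob C\<rbrakk> \<Longrightarrow> Seq C f (Star C Y Z) = Star C X Z"

text \<open>The operation \<open>+\<^sub>p\<close> for all \<open>0 \<le> p \<le> 1\<close>, the scalar action \<open>p \<cdot> f\<close>, and the \<open>n\<close>-ary convex sum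
  in the hom-set from \<open>X\<close> to \<open>Y\<close> (with summands indexed from \<open>0\<close>).  If \<open>p 0 = 1\<close>, then division
  by zero gives the weights \<open>0\<close> required for the remaining summands.\<close>

definition cplus :: "('o, 'a, 'z) pca_cat_scheme \<Rightarrow> real \<Rightarrow> 'a \<Rightarrow> 'a \<Rightarrow> 'a" where
  "cplus C p f g = (if p = 1 then f else if p = 0 then g else Plus C p f g)"

definition scale :: "('o, 'a, 'z) pca_cat_scheme \<Rightarrow> real \<Rightarrow> 'a \<Rightarrow> 'a" where
  "scale C p f = cplus C p f (Star C (Src C f) (Tgt C f))"

primrec csum :: "('o, 'a, 'z) pca_cat_scheme \<Rightarrow> 'o \<Rightarrow> 'o \<Rightarrow> nat \<Rightarrow> (nat \<Rightarrow> real) \<Rightarrow> (nat \<Rightarrow> 'a) \<Rightarrow> 'a" where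
  "csum C X Y 0 p f = Star C X Y"
| "csum C X Y (Suc n) p f =
     cplus C (p 0) (f 0) (csum C X Y n (\<lambda>j. p (Suc j) / (1 - p 0)) (\<lambda>j. f (Suc j)))"


section \<open>PCA-enriched functors and natural transformations\<close>

record ('o, 'a, 'p, 'b) funct =
  FO :: "'o \<Rightarrow> 'p"
  FA :: "'a \<Rightarrow> 'b"

text \<open>Functors are required to be \<open>undefined\<close> outside the source category, so that two functors
  are equal iff they agree on all objects and all arrows.\<close>

definition pca_hom :: "('o, 'a, 'y) pca_cat_scheme \<Rightarrow> ('p, 'b, 'z) pca_cat_scheme \<Rightarrow> ('o, 'a, 'p, 'b) funct set"
where
  "pca_hom C D = {F.
     FO F \<in> Ob C \<rightarrow>\<^sub>E Ob D \<and>
     FA F \<in> extensional (Ar C) \<and>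
     (\<forall>X\<in>Ob C. \<forall>Y\<in>Ob C. \<forall>f\<in>Hom C X Y. FA F f \<in> Hom D (FO F X) (FO F Y)) \<and>
     (\<forall>X\<in>Ob C. FA F (Idn C X) = Idn D (FO F X)) \<and>
     (\<forall>X\<in>Ob C. \<forall>Y\<in>Ob C. \<forall>Z\<in>Ob C. \<forall>f\<in>Hom C X Y. \<forall>g\<in>Hom C Y Z.
        FA F (Seq C f g) = Seq D (FA F f) (FA F g)) \<and>
     (\<forall>X\<in>Ob C. \<forall>Y\<in>Ob C. FA F (Star C X Y) = Star D (FO F X) (FO F Y)) \<and>
     (\<forall>X\<in>Ob C. \<forall>Y\<in>Ob C. \<forall>f\<in>Hom C X Y. \<forall>g\<in>Hom C X Y. \<forall>p. 0 < p \<and> p < 1 \<longrightarrow>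
        FA F (Plus C p f g) = Plus D p (FA F f) (FA F g))}"

definition funct_id :: "('o, 'a, 'z) pca_cat_scheme \<Rightarrow> ('o, 'a, 'o, 'a) funct" where
  "funct_id C = \<lparr>FO = restrict id (Ob C), FA = restrict id (Ar C)\<rparr>"

text \<open>The composite (first \<open>F\<close>, then \<open>G\<close>) of functors, where \<open>C\<close> is the source of \<open>F\<close>.\<close>

definition funct_comp :: "('o, 'a, 'z) pca_cat_scheme \<Rightarrow> ('o, 'a, 'p, 'b) funct \<Rightarrow> ('p, 'b, 'q, 'c) funct
    \<Rightarrow> ('o, 'a, 'q, 'c) funct" where
  "funct_comp C F G = \<lparr>FO = compose (Ob C) (FO G) (FO F), FA = compose (Ar C) (FA G) (FA F)\<rparr>"

text \<open>Since hom-objects are sets with structure, natural transformations of PCA-enriched functors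
  are just natural transformations of the underlying functors.\<close>

definition nat_trans :: "('o, 'a, 'y) pca_cat_scheme \<Rightarrow> ('p, 'b, 'z) pca_cat_scheme \<Rightarrow>
    ('o, 'a, 'p, 'b) funct \<Rightarrow> ('o, 'a, 'p, 'b) funct \<Rightarrow> ('o \<Rightarrow> 'b) set" where
  "nat_trans C D F G = {t.
     t \<in> extensional (Ob C) \<and>
     (\<forall>X\<in>Ob C. t X \<in> Hom D (FO F X) (FO G X)) \<and>
     (\<forall>X\<in>Ob C. \<forall>Y\<in>Ob C. \<forall>f\<in>Hom C X Y. Seq D (FA F f) (t Y) = Seq D (t X) (FA G f))}"


section \<open>Convex biproduct categories\<close>

definition is_initial :: "('o, 'a, 'z) pca_cat_scheme \<Rightarrow> 'o \<Rightarrow> bool" where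
  "is_initial C Z \<longleftrightarrow> Z \<in> Ob C \<and> (\<forall>X\<in>Ob C. \<exists>!f. f \<in> Hom C Z X)"

definition is_terminal :: "('o, 'a, 'z) pca_cat_scheme \<Rightarrow> 'o \<Rightarrow> bool" where
  "is_terminal C Z \<longleftrightarrow> Z \<in> Ob C \<and> (\<forall>X\<in>Ob C. \<exists>!f. f \<in> Hom C X Z)"

definition is_coproduct :: "('o, 'a, 'z) pca_cat_scheme \<Rightarrow> 'o \<Rightarrow> 'o \<Rightarrow> 'o \<Rightarrow> 'a \<Rightarrow> 'a \<Rightarrow> bool" where
  "is_coproduct C X1 X2 P i1 i2 \<longleftrightarrow>
     X1 \<in> Ob C \<and> X2 \<in> Ob C \<and> P \<in> Ob C \<and> i1 \<in> Hom C X1 P \<and> i2 \<in> Hom C X2 P \<and>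
     (\<forall>A\<in>Ob C. \<forall>f1\<in>Hom C X1 A. \<forall>f2\<in>Hom C X2 A.
        \<exists>!h. h \<in> Hom C P A \<and> Seq C i1 h = f1 \<and> Seq C i2 h = f2)"

definition is_convex_product :: "('o, 'a, 'z) pca_cat_scheme \<Rightarrow> 'o \<Rightarrow> 'o \<Rightarrow> 'o \<Rightarrow> 'a \<Rightarrow> 'a \<Rightarrow> bool" where
  "is_convex_product C X1 X2 P q1 q2 \<longleftrightarrow>
     X1 \<in> Ob C \<and> X2 \<in> Ob C \<and> P \<in> Ob C \<and> q1 \<in> Hom C P X1 \<and> q2 \<in> Hom C P X2 \<and>
     (\<forall>p1 p2. 0 \<le> p1 \<and> 0 \<le> p2 \<and> p1 + p2 \<le> 1 \<longrightarrow>
       (\<forall>A\<in>Ob C. \<forall>f1\<in>Hom C A X1. \<forall>f2\<in>Hom C A X2.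
          \<exists>!h. h \<in> Hom C A P \<and> Seq C h q1 = scale C p1 f1 \<and> Seq C h q2 = scale C p2 f2))"

record ('o, 'a) cb_cat = "('o, 'a) pca_cat" +
  Zero :: 'o
  Oplus :: "'o \<Rightarrow> 'o \<Rightarrow> 'o"
  Inj1 :: "'o \<Rightarrow> 'o \<Rightarrow> 'a"
  Inj2 :: "'o \<Rightarrow> 'o \<Rightarrow> 'a"
  Proj1 :: "'o \<Rightarrow> 'o \<Rightarrow> 'a"
  Proj2 :: "'o \<Rightarrow> 'o \<Rightarrow> 'a"

locale convex_biproduct_category = pca_category D for D :: "('o, 'a, 'z) cb_cat_scheme" +
  assumes zero_initial: "is_initial D (Zero D)"
    and zero_terminal: "is_terminal D (Zero D)"
    and oplus_coproduct: "\<lbrakk>X \<in> Ob D; Y \<in> Ob D\<rbrakk> \<Longrightarrow>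
      is_coproduct D X Y (Oplus D X Y) (Inj1 D X Y) (Inj2 D X Y)"
    and oplus_convex_product: "\<lbrakk>X \<in> Ob D; Y \<in> Ob D\<rbrakk> \<Longrightarrow>
      is_convex_product D X Y (Oplus D X Y) (Proj1 D X Y) (Proj2 D X Y)"
    and inj1_proj1: "\<lbrakk>X \<in> Ob D; Y \<in> Ob D\<rbrakk> \<Longrightarrow> Seq D (Inj1 D X Y) (Proj1 D X Y) = Idn D X"
    and inj1_proj2: "\<lbrakk>X \<in> Ob D; Y \<in> Ob D\<rbrakk> \<Longrightarrow> Seq D (Inj1 D X Y) (Proj2 D X Y) = Star D X Y"
    and inj2_proj1: "\<lbrakk>X \<in> Ob D; Y \<in> Ob D\<rbrakk> \<Longrightarrow> Seq D (Inj2 D X Y) (Proj1 D X Y) = Star D Y X"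
    and inj2_proj2: "\<lbrakk>X \<in> Ob D; Y \<in> Ob D\<rbrakk> \<Longrightarrow> Seq D (Inj2 D X Y) (Proj2 D X Y) = Idn D Y"

text \<open>The forgetful functor on objects; on functors it is the identity.\<close>

definition forget :: "('o, 'a, 'z) cb_cat_scheme \<Rightarrow> ('o, 'a) pca_cat" where
  "forget D = pca_cat.truncate D"

definition preserves_finite_coproducts ::
  "('o, 'a, 'y) pca_cat_scheme \<Rightarrow> ('p, 'b, 'z) pca_cat_scheme \<Rightarrow> ('o, 'a, 'p, 'b) funct \<Rightarrow> bool" where
  "preserves_finite_coproducts C D F \<longleftrightarrow>
     (\<forall>Z. is_initial C Z \<longrightarrow> is_initial D (FO F Z)) \<and>
     (\<forall>X1 X2 P i1 i2. is_coproduct C X1 X2 P i1 i2 \<longrightarrow>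
        is_coproduct D (FO F X1) (FO F X2) (FO F P) (FA F i1) (FA F i2))"

definition cb_hom :: "('o, 'a, 'y) cb_cat_scheme \<Rightarrow> ('p, 'b, 'z) cb_cat_scheme \<Rightarrow> ('o, 'a, 'p, 'b) funct set"
where
  "cb_hom C D = {F \<in> pca_hom (forget C) (forget D). preserves_finite_coproducts C D F}"

text \<open>Strict convex biproduct categories: the chosen finite coproducts are strictly associative and
  unital, i.e. the canonical comparison isomorphisms are identities (whence also the corresponding
  equations for the projections).  Strict functors preserve the chosen structure.\<close>

locale strict_convex_biproduct_category = convex_biproduct_category D
  for D :: "('o, 'a, 'z) cb_cat_scheme" +
  assumes zero_oplus: "X \<in> Ob D \<Longrightarrow> Oplus D (Zero D) X = X"
    and oplus_zero: "X \<in> Ob D \<Longrightarrow> Oplus D X (Zero D) = X"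
    and oplus_assoc: "\<lbrakk>X \<in> Ob D; Y \<in> Ob D; Z \<in> Ob D\<rbrakk> \<Longrightarrow>
      Oplus D (Oplus D X Y) Z = Oplus D X (Oplus D Y Z)"
    and inj2_zero: "X \<in> Ob D \<Longrightarrow> Inj2 D (Zero D) X = Idn D X"
    and inj1_zero: "X \<in> Ob D \<Longrightarrow> Inj1 D X (Zero D) = Idn D X"
    and inj1_inj1: "\<lbrakk>X \<in> Ob D; Y \<in> Ob D; Z \<in> Ob D\<rbrakk> \<Longrightarrow>
      Seq D (Inj1 D X Y) (Inj1 D (Oplus D X Y) Z) = Inj1 D X (Oplus D Y Z)"
    and inj2_inj1: "\<lbrakk>X \<in> Ob D; Y \<in> Ob D; Z \<in> Ob D\<rbrakk> \<Longrightarrow>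
      Seq D (Inj2 D X Y) (Inj1 D (Oplus D X Y) Z) = Seq D (Inj1 D Y Z) (Inj2 D X (Oplus D Y Z))"
    and inj2_inj2: "\<lbrakk>X \<in> Ob D; Y \<in> Ob D; Z \<in> Ob D\<rbrakk> \<Longrightarrow>
      Inj2 D (Oplus D X Y) Z = Seq D (Inj2 D Y Z) (Inj2 D X (Oplus D Y Z))"

definition strict_cb_hom ::
  "('o, 'a, 'y) cb_cat_scheme \<Rightarrow> ('p, 'b, 'z) cb_cat_scheme \<Rightarrow> ('o, 'a, 'p, 'b) funct set" where
  "strict_cb_hom C D = {F \<in> cb_hom C D.
     FO F (Zero C) = Zero D \<and>
     (\<forall>X\<in>Ob C. \<forall>Y\<in>Ob C.
        FO F (Oplus C X Y) = Oplus D (FO F X) (FO F Y) \<and>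
        FA F (Inj1 C X Y) = Inj1 D (FO F X) (FO F Y) \<and>
        FA F (Inj2 C X Y) = Inj2 D (FO F X) (FO F Y) \<and>
        FA F (Proj1 C X Y) = Proj1 D (FO F X) (FO F Y) \<and>
        FA F (Proj2 C X Y) = Proj2 D (FO F X) (FO F Y))}"


section \<open>Stochastic matrices of arrows\<close>

text \<open>A matrix from the word \<open>U\<^sub>0 \<dots> U\<^bsub>n-1\<^esub>\<close> to the word \<open>V\<^sub>0 \<dots> V\<^bsub>m-1\<^esub>\<close> has \<open>m\<close> rows and \<open>n\<close> columns;
  the entry in row \<open>j\<close> and column \<open>i\<close> is a weighted arrow from \<open>U\<^sub>i\<close> to \<open>V\<^sub>j\<close>.\<close>

record ('o, 'a) smat =
  sdom :: "'o list"
  scod :: "'o list"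
  sent :: "(real \<times> 'a) mat"

abbreviation wgt :: "('o, 'a) smat \<Rightarrow> nat \<Rightarrow> nat \<Rightarrow> real" where
  "wgt M j i \<equiv> fst (sent M $$ (j, i))"

abbreviation arw :: "('o, 'a) smat \<Rightarrow> nat \<Rightarrow> nat \<Rightarrow> 'a" where
  "arw M j i \<equiv> snd (sent M $$ (j, i))"

definition mk_smat :: "'o list \<Rightarrow> 'o list \<Rightarrow> (nat \<Rightarrow> nat \<Rightarrow> real \<times> 'a) \<Rightarrow> ('o, 'a) smat" where
  "mk_smat Us Vs e = \<lparr>sdom = Us, scod = Vs, sent = mat (length Vs) (length Us) (\<lambda>(j, i). e j i)\<rparr>"

definition smats :: "('o, 'a, 'z) pca_cat_scheme \<Rightarrow> ('o, 'a) smat set" where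
  "smats C = {M.
     set (sdom M) \<subseteq> Ob C \<and> set (scod M) \<subseteq> Ob C \<and>
     sent M \<in> carrier_mat (length (scod M)) (length (sdom M)) \<and>
     (\<forall>i<length (sdom M). \<forall>j<length (scod M).
        0 \<le> wgt M j i \<and> wgt M j i \<le> 1 \<and> arw M j i \<in> Hom C (sdom M ! i) (scod M ! j)) \<and>
     (\<forall>i<length (sdom M). (\<Sum>j<length (scod M). wgt M j i) \<le> 1)}"

definition smat_seq :: "('o, 'a, 'z) pca_cat_scheme \<Rightarrow> ('o, 'a) smat \<Rightarrow> ('o, 'a) smat \<Rightarrow> ('o, 'a) smat" where
  "smat_seq C M N = mk_smat (sdom M) (scod N) (\<lambda>u i.
     let m = length (scod M); r = (\<Sum>j<m. wgt N u j * wgt M j i)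
     in (r, csum C (sdom M ! i) (scod N ! u) m
              (\<lambda>j. wgt N u j * wgt M j i / r) (\<lambda>j. Seq C (arw M j i) (arw N u j))))"

text \<open>The convex combination of two matrices has the entries \<open>(r, (q p / r) f + ((1 - q) p' / r) f')\<close>
  with \<open>r = q p + (1 - q) p'\<close>; the two coefficients add up to \<open>1\<close> unless \<open>r = 0\<close>, in which case the
  arrow is irrelevant.\<close>

definition smat_plus :: "('o, 'a, 'z) pca_cat_scheme \<Rightarrow> real \<Rightarrow> ('o, 'a) smat \<Rightarrow> ('o, 'a) smat \<Rightarrow> ('o, 'a) smat"
where
  "smat_plus C q M N = mk_smat (sdom M) (scod M) (\<lambda>j i.
     let r = q * wgt M j i + (1 - q) * wgt N j i
     in (r, cplus C (q * wgt M j i / r) (arw M j i) (arw N j i)))"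

text \<open>Matrices all of whose entries are \<open>(1, id)\<close> or \<open>(0, \<star>)\<close>; the entries \<open>(1, id)\<close> are those for
  which \<open>P row column\<close> holds.\<close>

definition smat_unit :: "('o, 'a, 'z) pca_cat_scheme \<Rightarrow> 'o list \<Rightarrow> 'o list \<Rightarrow> (nat \<Rightarrow> nat \<Rightarrow> bool) \<Rightarrow> ('o, 'a) smat"
where
  "smat_unit C Us Vs P = mk_smat Us Vs (\<lambda>j i.
     if P j i then (1, Idn C (Us ! i)) else (0, Star C (Us ! i) (Vs ! j)))"

definition smat_map :: "('o, 'a, 'p, 'b) funct \<Rightarrow> ('o, 'a) smat \<Rightarrow> ('p, 'b) smat" where
  "smat_map F M = mk_smat (map (FO F) (sdom M)) (map (FO F) (scod M))
     (\<lambda>j i. (wgt M j i, FA F (arw M j i)))"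

definition smat_ident :: "('o, 'a, 'z) pca_cat_scheme \<Rightarrow> ('o, 'a) smat \<Rightarrow> ('o, 'a) smat \<Rightarrow> bool" where
  "smat_ident C M N \<longleftrightarrow>
     M \<in> smats C \<and> N \<in> smats C \<and> sdom M = sdom N \<and> scod M = scod N \<and>
     (\<forall>i<length (sdom M). \<forall>j<length (scod M).
        scale C (wgt M j i) (arw M j i) = scale C (wgt N j i) (arw N j i))"

text \<open>Unless scaling by \<open>p > 0\<close> is injective on the hom-sets of \<open>C\<close>, the relation \<^const>\<open>smat_ident\<close> need
  not be compatible with composition: if \<open>C\<close> has a single object and the two arrows \<open>id\<close> and \<open>\<star>\<close>,
  with \<open>Plus C p id \<star> = \<star>\<close>, then the column with entries \<open>(1/2, id)\<close>, \<open>(1/2, id)\<close> is identified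
  with the column with entries \<open>(0, \<star>)\<close>, \<open>(0, \<star>)\<close>, but their composites with the row with entries
  \<open>(1, id)\<close>, \<open>(1, id)\<close> are \<open>(1, id)\<close> and \<open>(0, \<star>)\<close>.  Arrows are therefore identified
  along the congruence generated by \<^const>\<open>smat_ident\<close>, which is \<^const>\<open>smat_ident\<close> itself whenever
  that relation is compatible with composition.\<close>

inductive smat_cong :: "('o, 'a, 'z) pca_cat_scheme \<Rightarrow> ('o, 'a) smat \<Rightarrow> ('o, 'a) smat \<Rightarrow> bool"
  for C :: "('o, 'a, 'z) pca_cat_scheme" where
  ident: "smat_ident C M N \<Longrightarrow> smat_cong C M N"
| sym: "smat_cong C M N \<Longrightarrow> smat_cong C N M"
| trans: "\<lbrakk>smat_cong C L M; smat_cong C M N\<rbrakk> \<Longrightarrow> smat_cong C L N"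
| seq: "\<lbrakk>smat_cong C M M'; smat_cong C N N'; scod M = sdom N\<rbrakk> \<Longrightarrow>
    smat_cong C (smat_seq C M N) (smat_seq C M' N')"

lemma smat_cong_eq_smat_ident:
  assumes "\<And>M M' N N'. \<lbrakk>smat_ident C M M'; smat_ident C N N'; scod M = sdom N\<rbrakk> \<Longrightarrow>
    smat_ident C (smat_seq C M N) (smat_seq C M' N')"
  shows "smat_cong C = smat_ident C"
proof (intro ext iffI)
  fix M N
  show "smat_ident C M N" if "smat_cong C M N"
    using that by induction (auto simp: assms, auto simp: smat_ident_def)
qed (rule smat_cong.ident)

definition smat_class :: "('o, 'a, 'z) pca_cat_scheme \<Rightarrow> ('o, 'a) smat \<Rightarrow> ('o, 'a) smat set" where
  "smat_class C M = {N. smat_cong C M N}"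


section \<open>The functor Stmat\<close>

text \<open>Operations on classes are defined as the union of the classes of the results over all
  representatives; this is again a class exactly if the operation is well defined.\<close>

definition Stmat :: "('o, 'a, 'z) pca_cat_scheme \<Rightarrow> ('o list, ('o, 'a) smat set) cb_cat" where
  "Stmat C = \<lparr>
     Ob = lists (Ob C),
     Ar = smat_class C ` smats C,
     Src = (\<lambda>A. the_elem (sdom ` A)),
     Tgt = (\<lambda>A. the_elem (scod ` A)),
     Idn = (\<lambda>Us. smat_class C (smat_unit C Us Us (\<lambda>j i. j = i))),
     Seq = (\<lambda>A B. \<Union>M\<in>A. \<Union>N\<in>B. smat_class C (smat_seq C M N)),
     Star = (\<lambda>Us Vs. smat_class C (smat_unit C Us Vs (\<lambda>j i. False))),
     Plus = (\<lambda>p A B. \<Union>M\<in>A. \<Union>N\<in>B. smat_class C (smat_plus C p M N)),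
     Zero = [],
     Oplus = (@),
     Inj1 = (\<lambda>Us Vs. smat_class C (smat_unit C Us (Us @ Vs) (\<lambda>j i. j = i))),
     Inj2 = (\<lambda>Us Vs. smat_class C (smat_unit C Vs (Us @ Vs) (\<lambda>j i. j = length Us + i))),
     Proj1 = (\<lambda>Us Vs. smat_class C (smat_unit C (Us @ Vs) Us (\<lambda>j i. i = j))),
     Proj2 = (\<lambda>Us Vs. smat_class C (smat_unit C (Us @ Vs) Vs (\<lambda>j i. i = length Us + j)))\<rparr>"

definition Stmat_fun :: "('o, 'a, 'y) pca_cat_scheme \<Rightarrow> ('p, 'b, 'z) pca_cat_scheme \<Rightarrow> ('o, 'a, 'p, 'b) funct \<Rightarrow>
    ('o list, ('o, 'a) smat set, 'p list, ('p, 'b) smat set) funct" where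
  "Stmat_fun C D F = \<lparr>
     FO = restrict (map (FO F)) (Ob (Stmat C)),
     FA = restrict (\<lambda>A. \<Union>M\<in>A. smat_class D (smat_map F M)) (Ar (Stmat C))\<rparr>"


section \<open>The unit and the transposition\<close>

definition eta :: "('o, 'a, 'z) pca_cat_scheme \<Rightarrow> ('o, 'a, 'o list, ('o, 'a) smat set) funct" where
  "eta C = \<lparr>
     FO = restrict (\<lambda>X. [X]) (Ob C),
     FA = restrict (\<lambda>f. smat_class C (mk_smat [Src C f] [Tgt C f] (\<lambda>j i. (1, f)))) (Ar C)\<rparr>"

text \<open>Transposition sends functors from \<^term>\<open>Stmat C\<close> to \<open>D\<close> to functors from \<open>C\<close> to \<^term>\<open>forget D\<close>, and
  natural transformations between the former to natural transformations between the latter.\<close>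

definition transpose_fun :: "('o, 'a, 'z) pca_cat_scheme \<Rightarrow> ('o list, ('o, 'a) smat set, 'p, 'b) funct \<Rightarrow>
    ('o, 'a, 'p, 'b) funct" where
  "transpose_fun C H = funct_comp C (eta C) H"

definition transpose_nat :: "('o, 'a, 'z) pca_cat_scheme \<Rightarrow> ('o list \<Rightarrow> 'b) \<Rightarrow> 'o \<Rightarrow> 'b" where
  "transpose_nat C t = compose (Ob C) t (FO (eta C))"

end

theory Submission
  imports Defs
begin

text \<open>Identify two weighted arrows \<open>(p, f)\<close> and \<open>(q, g)\<close>, with arbitrary weights \<open>\<ge> 0\<close>, if
  \<open>s p \<cdot> f = s q \<cdot> g\<close> for some \<open>s > 0\<close>.  The classes of the weighted arrows of a hom-set form a cone,
  that is, a semimodule over the nonnegative reals, and composition is bilinear on cones.  The congruence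
  of arrows of \<open>Stmat(C)\<close> is entrywise equality in the cones, so \<open>Stmat(C)\<close> is a category of
  matrices over the cones and its laws are matrix calculations.

  In a convex biproduct category \<open>D\<close>, an arrow \<open>f\<close> is determined by \<open>1/2 \<cdot> f\<close>, hence by its class
  in the cone, and direct sums are biproducts with respect to cones.  A matrix over \<open>D\<close> is therefore
  realized by a unique arrow between the direct sums of its source and target words.  This is the
  counit \<open>Stmat(D) \<rightarrow> D\<close>; composed with \<open>Stmat(F)\<close> it extends \<open>F : C \<rightarrow> D\<close> to \<open>Stmat(C)\<close>.  Uniqueness of
  the extension, and of the extension of natural transformations, is an induction on words.\<close>


section \<open>Convex combinations of arrows\<close>

text \<open>Two obstacles shape the proof. First, scaling by a weight in (0,1) need not be injective
  on the hom-sets of \<open>C\<close>. The free factor s > 0 makes all positive scalars invertible,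
  and with weights unbounded the normalizing quotients in composites disappear. That the generated
  congruence reaches all of cone equality is shown by splitting each row into two half-weighted
  copies and merging them again by the codiagonal: one such round absorbs a factor 1/2, so finitely
  many rounds reach any s. Second, a convex product pairs arrows only with weights of sum at most 1.
  Finally, a functor that preserves coproducts may send a word to any coproduct of the images of its
  letters. An extension is therefore unique on the nose only under strictness; otherwise uniqueness
  is expressed by natural transformations.\<close>

lemma HomI: "f \<in> Ar C \<Longrightarrow> f \<in> Hom C (Src C f) (Tgt C f)"
  by (simp add: Hom_def)

lemma Hom_Src: "f \<in> Hom C X Y \<Longrightarrow> Src C f = X"
  and Hom_Tgt: "f \<in> Hom C X Y \<Longrightarrow> Tgt C f = Y"
  and Hom_Ar: "f \<in> Hom C X Y \<Longrightarrow> f \<in> Ar C"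
  by (simp_all add: Hom_def)

lemma scale_Hom: "f \<in> Hom C X Y \<Longrightarrow> scale C p f = cplus C p f (Star C X Y)"
  by (simp add: scale_def Hom_def)

text \<open>The weights on the right of the associativity law stay strictly between 0 and 1, so
  every \<open>Plus\<close> that it produces is meaningful. The last bound is p < 1 in disguise: 1 -
  p * q exceeds p * (1 - q) by 1 - p.\<close>

lemma assoc_weights:
  fixes p q :: real
  assumes "0 < p" "p < 1" "0 < q" "q < 1"
  shows "0 < p * q" "p * q < 1" "0 < p * (1 - q) / (1 - p * q)" "p * (1 - q) / (1 - p * q) < 1"
proof -
  show pq: "p * q < 1" using mult_strict_mono[of p 1 q 1] assms by simp
  have "p * (1 - q) < 1 - p * q" "0 < p * (1 - q)" using assms by (auto simp: algebra_simps)
  then show "0 < p * (1 - q) / (1 - p * q)" "p * (1 - q) / (1 - p * q) < 1"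
    using pq by (auto simp: field_simps)
qed (use assms in simp)

context pca_category
begin

lemma Hom_Ob: "f \<in> Hom C X Y \<Longrightarrow> X \<in> Ob C \<and> Y \<in> Ob C"
  using src_closed tgt_closed by (auto simp: Hom_def)

lemma pca_Hom': "f \<in> Hom C X Y \<Longrightarrow> pca (Hom C X Y) (Star C X Y) (Plus C)"
  using Hom_Ob pca_Hom by blast

lemma Star_closed: "\<lbrakk>X \<in> Ob C; Y \<in> Ob C\<rbrakk> \<Longrightarrow> Star C X Y \<in> Hom C X Y"
  by (rule pca.star_closed[OF pca_Hom])

lemma cplus_closed:
  assumes "f \<in> Hom C X Y" "g \<in> Hom C X Y" "0 \<le> p" "p \<le> 1"
  shows "cplus C p f g \<in> Hom C X Y"
  using assms by (auto simp: cplus_def intro!: pca.plus_closed[OF pca_Hom'[OF assms(1)]])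

lemma cplus_commute:
  assumes "f \<in> Hom C X Y" "g \<in> Hom C X Y" "0 \<le> p" "p \<le> 1"
  shows "cplus C p f g = cplus C (1 - p) g f"
  using assms by (auto simp: cplus_def intro!: pca.plus_commute[OF pca_Hom'[OF assms(1)]])

lemma cplus_idem:
  assumes "f \<in> Hom C X Y" "0 \<le> p" "p \<le> 1"
  shows "cplus C p f f = f"
  using assms by (auto simp: cplus_def intro!: pca.plus_idem[OF pca_Hom'[OF assms(1)]])

text \<open>Associativity survives at the boundary because a weight 0 or 1 discards a summand. For p
  = q = 1 the inner weight is the quotient 0 / 0, but the outer weight 1 discards the whole inner
  sum.\<close>

lemma cplus_assoc:
  assumes f: "f \<in> Hom C X Y" "g \<in> Hom C X Y" "h \<in> Hom C X Y"
    and pq: "0 \<le> p" "p \<le> 1" "0 \<le> q" "q \<le> 1"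
  shows "cplus C p (cplus C q f g) h = cplus C (p * q) f (cplus C (p * (1 - q) / (1 - p * q)) g h)"
proof -
  have XY: "X \<in> Ob C" "Y \<in> Ob C" using Hom_Ob[OF f(1)] by auto
  consider "p = 0" | "q = 0" | "p = 1" "q = 1" | "p = 1" "0 < q" "q < 1" | "0 < p" "p < 1" "q = 1" | "0 < p" "p < 1" "0 < q" "q < 1"
    using pq by linarith
  then show ?thesis
  proof cases
    case 6
    then show ?thesis
      using assoc_weights[of p q] pca.plus_assoc[OF pca_Hom[OF XY] 6 f] by (simp add: cplus_def)
  qed (auto simp: cplus_def)
qed

lemma scale_closed: "\<lbrakk>f \<in> Hom C X Y; 0 \<le> p; p \<le> 1\<rbrakk> \<Longrightarrow> scale C p f \<in> Hom C X Y"
  using Hom_Ob by (auto simp: scale_Hom intro!: cplus_closed Star_closed)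

lemma scale_0: "f \<in> Hom C X Y \<Longrightarrow> scale C 0 f = Star C X Y"
  by (simp add: scale_Hom cplus_def)

lemma scale_1: "scale C 1 f = f"
  by (simp add: scale_def cplus_def)

text \<open>Associativity with both remaining summands equal to the star: they merge by idempotence,
  whatever their relative weight is.\<close>

lemma scale_scale:
  assumes "f \<in> Hom C X Y" "0 \<le> p" "p \<le> 1" "0 \<le> q" "q \<le> 1"
  shows "scale C p (scale C q f) = scale C (p * q) f"
proof -
  have S: "Star C X Y \<in> Hom C X Y" using assms(1) Hom_Ob Star_closed by blast
  have "p * q \<le> 1" using assms by (simp add: mult_le_one)
  have r: "0 \<le> p * (1 - q) / (1 - p * q)" using assms \<open>p * q \<le> 1\<close> by simp
  have "p * (1 - q) / (1 - p * q) \<le> 1"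
    using assms \<open>p * q \<le> 1\<close> by (cases "p * q = 1") (simp_all add: divide_simps algebra_simps)
  then show ?thesis
    using cplus_assoc[OF assms(1) S S assms(2-5)] cplus_idem[OF S r]
    by (simp add: scale_Hom[OF cplus_closed[OF assms(1) S assms(4,5)]] scale_Hom[OF assms(1)])
qed

text \<open>The sum of the weighted arrows (a, f) and (b, g) may have weight a + b > 1, so it exists
  in the hom-set only after halving. This identity makes addition in the cones well defined. Both
  sides are brought to the form f with weight a / 2 plus a remainder built from g and the
  star.\<close>

lemma cplus_half_scale:
  assumes f: "f \<in> Hom C X Y" and g: "g \<in> Hom C X Y" and ab: "0 \<le> a" "a \<le> 1" "0 \<le> b" "b \<le> 1"
  shows "cplus C (1/2) (scale C a f) (scale C b g) = scale C ((a + b) / 2) (cplus C (a / (a + b)) f g)"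
proof -
  let ?S = "Star C X Y"
  \<comment> \<open>The weight of the second summand relative to the mass 1 - a / 2 that remains
    once f has been split off.\<close>
  let ?c = "(1/2) / (1 - a/2)"
  have S: "?S \<in> Hom C X Y" using f Hom_Ob Star_closed by blast
  have gb: "scale C b g \<in> Hom C X Y" using g ab by (rule_tac scale_closed)
  have c: "0 \<le> ?c" "?c \<le> 1" using ab by (auto simp: field_simps)
  have e: "0 \<le> a / (a + b)" "a / (a + b) \<le> 1" using ab by (auto simp: divide_simps)
  have "cplus C (1/2) (scale C a f) (scale C b g)
     = cplus C (a / 2) f (cplus C (1 - ?c) ?S (scale C b g))"
    unfolding scale_Hom[OF f]
    using ab by (subst cplus_assoc[OF f S gb]) (auto simp: field_simps intro!: arg_cong2[where f="cplus C (a / 2)"] arg_cong[where f="\<lambda>c. cplus C c _ _"])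
  also have "cplus C (1 - ?c) ?S (scale C b g) = scale C ?c (scale C b g)"
    using cplus_commute[OF gb S c] scale_Hom[OF gb] by simp
  also have "\<dots> = cplus C (?c * b) g ?S"
    using scale_scale[OF g c ab(3,4)] scale_Hom[OF g] by simp
  finally have 1: "cplus C (1/2) (scale C a f) (scale C b g) = cplus C (a / 2) f (cplus C (?c * b) g ?S)" .
  have s: "(a + b) / 2 * (a / (a + b)) = a / 2"
  proof (cases "a + b = 0")
    case False
    then have "(a + b) * (a / (a + b)) = a" by simp
    then show ?thesis by (simp only: times_divide_eq_left)
  qed (use ab in \<open>simp add: add_nonneg_eq_0_iff\<close>)
  have t: "(a + b) / 2 * (1 - a / (a + b)) / (1 - (a + b) / 2 * (a / (a + b))) = ?c * b"
  proof -
    have "(a + b) / 2 * (1 - a / (a + b)) = b / 2"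
      using ab by (cases "a + b = 0") (auto simp: field_simps)
    then show ?thesis unfolding s by simp
  qed
  have "scale C ((a + b) / 2) (cplus C (a / (a + b)) f g)
     = cplus C (a / 2) f (cplus C (?c * b) g ?S)"
    using cplus_assoc[OF f g S _ _ e, of "(a + b) / 2"] ab
    unfolding scale_Hom[OF cplus_closed[OF f g e]] unfolding t unfolding s by simp
  then show ?thesis using 1 by simp
qed


lemma seq_cplus_left: "\<lbrakk>0 \<le> p; p \<le> 1; f \<in> Hom C X Y; f' \<in> Hom C X Y; g \<in> Hom C Y Z\<rbrakk> \<Longrightarrow>
    Seq C (cplus C p f f') g = cplus C p (Seq C f g) (Seq C f' g)"
  and seq_cplus_right: "\<lbrakk>0 \<le> p; p \<le> 1; f \<in> Hom C X Y; g \<in> Hom C Y Z; g' \<in> Hom C Y Z\<rbrakk> \<Longrightarrow>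
    Seq C f (cplus C p g g') = cplus C p (Seq C f g) (Seq C f g')"
  by (auto simp: cplus_def intro: seq_plus_left seq_plus_right)

lemma seq_scale:
  assumes f: "f \<in> Hom C X Y" and g: "g \<in> Hom C Y Z" and p: "0 \<le> p" "p \<le> 1"
  shows "Seq C (scale C p f) g = scale C p (Seq C f g)"
    and "Seq C f (scale C p g) = scale C p (Seq C f g)"
  using Hom_Ob[OF f] Hom_Ob[OF g] seq_closed[OF f g] Star_closed seq_cplus_left[OF p f _ g]
    seq_cplus_right[OF p f g] seq_star_left[of X g Y Z] seq_star_right[OF f, of Z]
  by (auto simp: scale_Hom[OF f] scale_Hom[OF g] scale_Hom[OF seq_closed[OF f g]] g f)

end


section \<open>The cone of weighted arrows\<close>

definition cone_eq :: "('o, 'a, 'z) pca_cat_scheme \<Rightarrow> real \<Rightarrow> 'a \<Rightarrow> real \<Rightarrow> 'a \<Rightarrow> bool" where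
  "cone_eq C p f q g \<longleftrightarrow> (\<exists>s>0. s * p \<le> 1 \<and> s * q \<le> 1 \<and> scale C (s * p) f = scale C (s * q) g)"

definition cone :: "('o, 'a, 'z) pca_cat_scheme \<Rightarrow> real \<Rightarrow> 'a \<Rightarrow> (real \<times> 'a) set" where
  "cone C p f = {(q, g). 0 \<le> q \<and> g \<in> Hom C (Src C f) (Tgt C f) \<and> cone_eq C p f q g}"

definition Cone :: "('o, 'a, 'z) pca_cat_scheme \<Rightarrow> 'o \<Rightarrow> 'o \<Rightarrow> (real \<times> 'a) set set" where
  "Cone C X Y = {cone C p f |p f. 0 \<le> p \<and> f \<in> Hom C X Y}"

text \<open>On representatives, the operations are those on weighted arrows: see \<open>cone_add_cone\<close>,
  \<open>cone_mul_cone\<close> and \<open>cone_scale_cone\<close>.  If \<open>p + q = 0\<close>, then \<open>p / (p + q)\<close> is \<open>0\<close>, but all arrows of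
  weight \<open>0\<close> are identified.\<close>

definition cone_rep :: "(real \<times> 'a) set \<Rightarrow> real \<times> 'a" where
  "cone_rep a = (SOME x. x \<in> a)"

definition cone_add :: "('o, 'a, 'z) pca_cat_scheme \<Rightarrow> (real \<times> 'a) set \<Rightarrow> (real \<times> 'a) set \<Rightarrow> (real \<times> 'a) set" where
  "cone_add C a b = (case cone_rep a of (p, f) \<Rightarrow> case cone_rep b of (q, g) \<Rightarrow>
     cone C (p + q) (cplus C (p / (p + q)) f g))"

definition cone_mul :: "('o, 'a, 'z) pca_cat_scheme \<Rightarrow> (real \<times> 'a) set \<Rightarrow> (real \<times> 'a) set \<Rightarrow> (real \<times> 'a) set" where
  "cone_mul C a b = (case cone_rep a of (p, f) \<Rightarrow> case cone_rep b of (q, g) \<Rightarrow>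
     cone C (p * q) (Seq C f g))"

definition cone_scale :: "('o, 'a, 'z) pca_cat_scheme \<Rightarrow> real \<Rightarrow> (real \<times> 'a) set \<Rightarrow> (real \<times> 'a) set" where
  "cone_scale C r a = (case cone_rep a of (p, f) \<Rightarrow> cone C (r * p) f)"

definition cone_zero :: "('o, 'a, 'z) pca_cat_scheme \<Rightarrow> 'o \<Rightarrow> 'o \<Rightarrow> (real \<times> 'a) set" where
  "cone_zero C X Y = cone C 0 (Star C X Y)"

primrec cone_sum :: "('o, 'a, 'z) pca_cat_scheme \<Rightarrow> 'o \<Rightarrow> 'o \<Rightarrow> nat \<Rightarrow> (nat \<Rightarrow> (real \<times> 'a) set) \<Rightarrow> (real \<times> 'a) set" where
  "cone_sum C X Y 0 a = cone_zero C X Y"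
| "cone_sum C X Y (Suc n) a = cone_add C (a 0) (cone_sum C X Y n (\<lambda>j. a (Suc j)))"

lemma frac_bounds:
  assumes "0 \<le> (p::real)" "0 \<le> q"
  shows "0 \<le> p / (p + q)" "p / (p + q) \<le> 1"
  using assms by (auto simp: divide_simps)

context pca_category
begin

text \<open>Scaling the witnessing equation by t / s, which is at most 1, gives the equation for t.
  So witnesses can be shrunk: two of them to a common one, or one of them to a power of 1/2.\<close>

lemma cone_eq_smaller:
  assumes f: "f \<in> Hom C X Y" "g \<in> Hom C X Y" and pq: "0 \<le> p" "0 \<le> q"
    and s: "0 < s" "s * p \<le> 1" "s * q \<le> 1" "scale C (s * p) f = scale C (s * q) g"
    and t: "0 < t" "t \<le> s"
  shows "t * p \<le> 1 \<and> t * q \<le> 1 \<and> scale C (t * p) f = scale C (t * q) g"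
proof -
  have "t * p \<le> s * p" "t * q \<le> s * q" using t pq by (auto intro: mult_right_mono)
  moreover have "scale C (t * p) f = scale C (t / s) (scale C (s * p) f)"
    using scale_scale[OF f(1), of "t / s" "s * p"] s t pq by simp
  moreover have "scale C (t * q) g = scale C (t / s) (scale C (s * q) g)"
    using scale_scale[OF f(2), of "t / s" "s * q"] s t pq by simp
  ultimately show ?thesis using s by auto
qed

lemma cone_eq_refl:
  assumes "0 \<le> p"
  shows "cone_eq C p f p f"
  \<comment> \<open>This factor turns p into p / (1 + p), which is below 1 for every p.\<close>
  unfolding cone_eq_def using assms by (intro exI[of _ "1 / (1 + p)"]) simp

lemma cone_eq_sym: "cone_eq C p f q g \<Longrightarrow> cone_eq C q g p f"
  unfolding cone_eq_def by metis

lemma cone_eq_trans: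
  assumes f: "f \<in> Hom C X Y" "g \<in> Hom C X Y" "h \<in> Hom C X Y" and pq: "0 \<le> p" "0 \<le> q" "0 \<le> r"
    and "cone_eq C p f q g" "cone_eq C q g r h"
  shows "cone_eq C p f r h"
proof -
  obtain s t where s: "0 < s" "s * p \<le> 1" "s * q \<le> 1" "scale C (s * p) f = scale C (s * q) g"
    and t: "0 < t" "t * q \<le> 1" "t * r \<le> 1" "scale C (t * q) g = scale C (t * r) h"
    using assms by (auto simp: cone_eq_def)
  show ?thesis unfolding cone_eq_def
    using cone_eq_smaller[OF f(1,2) pq(1,2) s, of "min s t"] cone_eq_smaller[OF f(2,3) pq(2,3) t, of "min s t"] s t
    by (intro exI[of _ "min s t"]) auto
qed

lemma cone_eq_iff:
  assumes f: "f \<in> Hom C X Y" "g \<in> Hom C X Y" and pq: "0 \<le> p" "0 \<le> q"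
  shows "cone C p f = cone C q g \<longleftrightarrow> cone_eq C p f q g"
proof
  assume "cone C p f = cone C q g"
  moreover have "(p, f) \<in> cone C p f"
    using f pq cone_eq_refl by (simp add: cone_def Hom_def)
  ultimately have "(p, f) \<in> cone C q g" by simp
  then show "cone_eq C p f q g" by (simp add: cone_def cone_eq_sym)
next
  assume *: "cone_eq C p f q g"
  have "cone_eq C p f r h \<longleftrightarrow> cone_eq C q g r h" if "h \<in> Hom C X Y" "0 \<le> r" for r h
    using cone_eq_trans[OF f(2,1) that(1) pq(2,1) that(2)] cone_eq_trans[OF f(1,2) that(1) pq that(2)]
      * cone_eq_sym[OF *] by blast
  then show "cone C p f = cone C q g"
    using f by (auto simp: cone_def Hom_Src Hom_Tgt)
qed

lemma cone_rep_cone: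
  assumes f: "f \<in> Hom C X Y" and p: "0 \<le> p"
  obtains q g where "cone_rep (cone C p f) = (q, g)" "0 \<le> q" "g \<in> Hom C X Y" "cone_eq C p f q g"
    "cone C q g = cone C p f"
proof -
  have "(p, f) \<in> cone C p f"
    using f p cone_eq_refl by (simp add: cone_def Hom_def)
  then have *: "cone_rep (cone C p f) \<in> cone C p f"
    unfolding cone_rep_def by (rule someI)
  obtain q g where qg: "cone_rep (cone C p f) = (q, g)" by (cases "cone_rep (cone C p f)")
  then have "0 \<le> q" "g \<in> Hom C X Y" "cone_eq C p f q g"
    using * f by (auto simp: cone_def Hom_Src Hom_Tgt)
  then show thesis using that qg cone_eq_iff[OF f, of g p q] p by blast
qed

section \<open>Operations of the cones on representatives\<close>

lemma cone_closed: "\<lbrakk>f \<in> Hom C X Y; 0 \<le> p\<rbrakk> \<Longrightarrow> cone C p f \<in> Cone C X Y"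
  by (auto simp: Cone_def)

lemma ConeE:
  assumes "a \<in> Cone C X Y"
  obtains p f where "a = cone C p f" "0 \<le> p" "f \<in> Hom C X Y"
  using assms by (auto simp: Cone_def)

lemma Cone_Ob: "a \<in> Cone C X Y \<Longrightarrow> X \<in> Ob C \<and> Y \<in> Ob C"
  using Hom_Ob by (auto simp: Cone_def)

text \<open>With a common witness u, the midpoint of the scaled summands is the sum scaled by u / 2
  (\<open>cplus_half_scale\<close>), so u / 2 is a witness for the sums.\<close>

lemma cone_add_cong:
  assumes f: "f \<in> Hom C X Y" "g \<in> Hom C X Y" "f' \<in> Hom C X Y" "g' \<in> Hom C X Y"
    and pq: "0 \<le> p" "0 \<le> q" "0 \<le> p'" "0 \<le> q'"
    and "cone_eq C p f p' f'" "cone_eq C q g q' g'"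
  shows "cone_eq C (p + q) (cplus C (p / (p + q)) f g) (p' + q') (cplus C (p' / (p' + q')) f' g')"
proof -
  obtain s t where s: "0 < s" "s * p \<le> 1" "s * p' \<le> 1" "scale C (s * p) f = scale C (s * p') f'"
    and t: "0 < t" "t * q \<le> 1" "t * q' \<le> 1" "scale C (t * q) g = scale C (t * q') g'"
    using assms by (auto simp: cone_eq_def)
  define u where "u = min s t"
  have u: "0 < u" using s t by (simp add: u_def)
  have us: "u * p \<le> 1" "u * p' \<le> 1" "scale C (u * p) f = scale C (u * p') f'"
    using cone_eq_smaller[OF f(1,3) pq(1,3) s u] by (auto simp: u_def)
  have ut: "u * q \<le> 1" "u * q' \<le> 1" "scale C (u * q) g = scale C (u * q') g'"
    using cone_eq_smaller[OF f(2,4) pq(2,4) t u] by (auto simp: u_def)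
  have e: "u * p / (u * p + u * q) = p / (p + q)" for p q
    using u by (simp add: distrib_left[symmetric])
  have "scale C (u / 2 * (p + q)) (cplus C (p / (p + q)) f g) = cplus C (1/2) (scale C (u * p) f) (scale C (u * q) g)"
    using cplus_half_scale[OF f(1,2), of "u * p" "u * q"] u pq us ut e by (simp add: distrib_left add_divide_distrib)
  moreover have "scale C (u / 2 * (p' + q')) (cplus C (p' / (p' + q')) f' g') = cplus C (1/2) (scale C (u * p') f') (scale C (u * q') g')"
    using cplus_half_scale[OF f(3,4), of "u * p'" "u * q'"] u pq us ut e by (simp add: distrib_left add_divide_distrib)
  ultimately show ?thesis unfolding cone_eq_def
    using us ut u by (intro exI[of _ "u / 2"]) (auto simp: distrib_left)
qed

lemma cone_add_cone:
  assumes f: "f \<in> Hom C X Y" "g \<in> Hom C X Y" and pq: "0 \<le> p" "0 \<le> q"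
  shows "cone_add C (cone C p f) (cone C q g) = cone C (p + q) (cplus C (p / (p + q)) f g)"
proof -
  obtain p' f' where f': "cone_rep (cone C p f) = (p', f')" "0 \<le> p'" "f' \<in> Hom C X Y" "cone_eq C p f p' f'"
    using cone_rep_cone[OF f(1) pq(1)] by metis
  obtain q' g' where g': "cone_rep (cone C q g) = (q', g')" "0 \<le> q'" "g' \<in> Hom C X Y" "cone_eq C q g q' g'"
    using cone_rep_cone[OF f(2) pq(2)] by metis
  have "cone_eq C (p + q) (cplus C (p / (p + q)) f g) (p' + q') (cplus C (p' / (p' + q')) f' g')"
    by (rule cone_add_cong) (use f f' g' pq in auto)
  then have "cone C (p + q) (cplus C (p / (p + q)) f g) = cone C (p' + q') (cplus C (p' / (p' + q')) f' g')"
    by (subst cone_eq_iff) (use f f' g' pq frac_bounds in \<open>auto intro: cplus_closed\<close>)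
  then show ?thesis by (simp add: cone_add_def f' g')
qed

text \<open>Scalars move through composition, so the product of the two witnesses is a witness for
  the composites.\<close>

lemma cone_mul_cong:
  assumes f: "f \<in> Hom C X Y" "f' \<in> Hom C X Y" "g \<in> Hom C Y Z" "g' \<in> Hom C Y Z"
    and pq: "0 \<le> p" "0 \<le> q" "0 \<le> p'" "0 \<le> q'"
    and "cone_eq C p f p' f'" "cone_eq C q g q' g'"
  shows "cone_eq C (p * q) (Seq C f g) (p' * q') (Seq C f' g')"
proof -
  obtain s t where s: "0 < s" "s * p \<le> 1" "s * p' \<le> 1" "scale C (s * p) f = scale C (s * p') f'"
    and t: "0 < t" "t * q \<le> 1" "t * q' \<le> 1" "scale C (t * q) g = scale C (t * q') g'"
    using assms by (auto simp: cone_eq_def)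
  have *: "scale C (s * p * (t * q)) (Seq C f g) = Seq C (scale C (s * p) f) (scale C (t * q) g)"
    if "f \<in> Hom C X Y" "g \<in> Hom C Y Z" "0 \<le> p" "0 \<le> q" "s * p \<le> 1" "t * q \<le> 1" for p q f g
    using that s t seq_scale(1)[OF that(1) scale_closed[OF that(2)], of "t * q" "s * p"]
      seq_scale(2)[OF that(1,2), of "t * q"] scale_scale[OF seq_closed[OF that(1,2)], of "s * p" "t * q"] by simp
  have "s * p * (t * q) \<le> 1" "s * p' * (t * q') \<le> 1" using s t pq by (auto intro: mult_le_one)
  moreover have "scale C (s * p * (t * q)) (Seq C f g) = scale C (s * p' * (t * q')) (Seq C f' g')"
    using * f pq s t by simp
  ultimately show ?thesis unfolding cone_eq_def using s t
    by (intro exI[of _ "s * t"]) (simp add: mult_ac)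
qed

lemma cone_mul_cone:
  assumes f: "f \<in> Hom C X Y" "g \<in> Hom C Y Z" and pq: "0 \<le> p" "0 \<le> q"
  shows "cone_mul C (cone C p f) (cone C q g) = cone C (p * q) (Seq C f g)"
proof -
  obtain p' f' where f': "cone_rep (cone C p f) = (p', f')" "0 \<le> p'" "f' \<in> Hom C X Y" "cone_eq C p f p' f'"
    using cone_rep_cone[OF f(1) pq(1)] by metis
  obtain q' g' where g': "cone_rep (cone C q g) = (q', g')" "0 \<le> q'" "g' \<in> Hom C Y Z" "cone_eq C q g q' g'"
    using cone_rep_cone[OF f(2) pq(2)] by metis
  have "cone_eq C (p * q) (Seq C f g) (p' * q') (Seq C f' g')"
    by (rule cone_mul_cong) (use f f' g' pq in auto)
  then have "cone C (p * q) (Seq C f g) = cone C (p' * q') (Seq C f' g')"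
    by (subst cone_eq_iff) (use f f' g' pq in \<open>auto intro: seq_closed\<close>)
  then show ?thesis by (simp add: cone_mul_def f' g')
qed

lemma cone_scale_cone:
  assumes f: "f \<in> Hom C X Y" and p: "0 \<le> p" "0 \<le> r"
  shows "cone_scale C r (cone C p f) = cone C (r * p) f"
proof -
  obtain p' f' where f': "cone_rep (cone C p f) = (p', f')" "0 \<le> p'" "f' \<in> Hom C X Y" "cone_eq C p f p' f'"
    using cone_rep_cone[OF f(1) p(1)] by metis
  have "cone_eq C (r * p) f (r * p') f'"
  proof (cases "r = 0")
    case False
    obtain s where "0 < s" "s * p \<le> 1" "s * p' \<le> 1" "scale C (s * p) f = scale C (s * p') f'"
      using f' by (auto simp: cone_eq_def)
    then show ?thesis unfolding cone_eq_def using False p by (intro exI[of _ "s / r"]) simp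
  next
    case True
    then show ?thesis unfolding cone_eq_def using f f' by (intro exI[of _ 1]) (simp add: scale_0)
  qed
  then have "cone C (r * p) f = cone C (r * p') f'"
    by (subst cone_eq_iff) (use f f' p in auto)
  then show ?thesis by (simp add: cone_scale_def f')
qed

lemma cone_0: "f \<in> Hom C X Y \<Longrightarrow> cone C 0 f = cone_zero C X Y"
  unfolding cone_zero_def using Hom_Ob
  by (subst cone_eq_iff) (auto simp: cone_eq_def scale_0 scale_0[OF Star_closed] Star_closed intro!: exI[of _ 1])

text \<open>A scalar in [0, 1] may be moved from the arrow to the weight; this links the scalar
  action of the hom-sets with the weights of the cones. The witness is the one from reflexivity,
  since p * q is at most p.\<close>

lemma cone_cone_scale:
  assumes "f \<in> Hom C X Y" "0 \<le> p" "0 \<le> q" "q \<le> 1"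
  shows "cone C p (scale C q f) = cone C (p * q) f"
proof -
  have "p * q \<le> p" using assms by (simp add: mult_left_le)
  moreover have "p * q / (1 + p) = p / (1 + p) * q" by simp
  ultimately have "cone_eq C p (scale C q f) (p * q) f"
    unfolding cone_eq_def using assms
    by (intro exI[of _ "1 / (1 + p)"]) (auto simp: scale_scale)
  then show ?thesis
    by (subst cone_eq_iff) (use assms in \<open>auto intro: scale_closed\<close>)
qed

lemma cone_Star:
  assumes "X \<in> Ob C" "Y \<in> Ob C" "0 \<le> p"
  shows "cone C p (Star C X Y) = cone_zero C X Y"
  using cone_cone_scale[OF Star_closed[OF assms(1,2)] assms(3), of 0] assms
  by (simp add: scale_0[OF Star_closed] cone_zero_def)

text \<open>The two weights add up to 1, so the normalization inside the cone sum is trivial.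
  Passing from an arrow to its cone element of weight 1 thus turns convex combinations into weighted
  sums.\<close>

lemma cone_cplus:
  assumes "f \<in> Hom C X Y" "g \<in> Hom C X Y" "0 \<le> p" "p \<le> 1"
  shows "cone C 1 (cplus C p f g) = cone_add C (cone C p f) (cone C (1 - p) g)"
  using assms by (simp add: cone_add_cone)

section \<open>Semimodule laws of the cones and bilinearity of composition\<close>

lemma cone_zero_closed: "\<lbrakk>X \<in> Ob C; Y \<in> Ob C\<rbrakk> \<Longrightarrow> cone_zero C X Y \<in> Cone C X Y"
  unfolding cone_zero_def by (intro cone_closed Star_closed) auto

lemma cone_add_closed: "\<lbrakk>a \<in> Cone C X Y; b \<in> Cone C X Y\<rbrakk> \<Longrightarrow> cone_add C a b \<in> Cone C X Y"
  by (elim ConeE) (simp add: cone_add_cone cone_closed cplus_closed frac_bounds)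

lemma cone_mul_closed: "\<lbrakk>a \<in> Cone C X Y; b \<in> Cone C Y Z\<rbrakk> \<Longrightarrow> cone_mul C a b \<in> Cone C X Z"
  by (elim ConeE) (simp add: cone_mul_cone cone_closed[OF seq_closed])

lemma cone_scale_closed: "\<lbrakk>a \<in> Cone C X Y; 0 \<le> r\<rbrakk> \<Longrightarrow> cone_scale C r a \<in> Cone C X Y"
  by (elim ConeE) (simp add: cone_scale_cone cone_closed)

lemma cone_add_commute:
  assumes "a \<in> Cone C X Y" "b \<in> Cone C X Y"
  shows "cone_add C a b = cone_add C b a"
proof -
  obtain p f q g where a: "a = cone C p f" "0 \<le> p" "f \<in> Hom C X Y" and b: "b = cone C q g" "0 \<le> q" "g \<in> Hom C X Y"
    using assms by (elim ConeE)
  show ?thesis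
  proof (cases "p + q = 0")
    case True
    then have "p = 0" "q = 0" using a b by auto
    then show ?thesis using a b by (simp add: cone_add_cone cone_0 cplus_closed)
  next
    case False
    then have "1 - p / (p + q) = q / (q + p)" by (simp add: field_simps)
    then show ?thesis
      using a b frac_bounds[of p q] cplus_commute[of f X Y g "p / (p + q)"] by (simp add: cone_add_cone add.commute)
  qed
qed

lemma cone_add_assoc:
  assumes "a \<in> Cone C X Y" "b \<in> Cone C X Y" "c \<in> Cone C X Y"
  shows "cone_add C (cone_add C a b) c = cone_add C a (cone_add C b c)"
proof -
  obtain p f q g r h where a: "a = cone C p f" "0 \<le> p" "f \<in> Hom C X Y" and b: "b = cone C q g" "0 \<le> q" "g \<in> Hom C X Y"
     and c: "c = cone C r h" "0 \<le> r" "h \<in> Hom C X Y"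
    using assms by (elim ConeE)
  \<comment> \<open>The relative weights of the two nested sums. The pca law turns them into p / (p
    + q + r) and q / (q + r); the case q + r = 0, where division by zero intervenes, is treated
    separately.\<close>
  let ?s = "(p + q) / (p + q + r)" let ?t = "p / (p + q)"
  have st: "?s * ?t = p / (p + (q + r))"
    using a b by (cases "p + q = 0") (auto simp: add.assoc)
  have *: "cplus C ?s (cplus C ?t f g) h = cplus C (p / (p + (q + r))) f (cplus C (q / (q + r)) g h)"
  proof (cases "q + r = 0")
    case True
    then have "q = 0" "r = 0" using b c by auto
    then show ?thesis by (auto simp: cplus_def)
  next
    case False
    have "?s * (1 - ?t) / (1 - ?s * ?t) = q / (q + r)"
    proof -
      have "?s * (1 - ?t) = q / (p + (q + r))"
      proof (cases "p + q = 0")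
        case True
        then have "p = 0" "q = 0" using a b by auto
        then show ?thesis by simp
      next
        case False
        then have "1 - ?t = q / (p + q)" by (simp add: field_simps)
        then show ?thesis using False by (simp add: add.assoc)
      qed
      moreover have "1 - ?s * ?t = (q + r) / (p + (q + r))"
        using False a b c unfolding st by (auto simp: divide_simps)
      ultimately show ?thesis using False a b c by (auto simp: divide_simps)
    qed
    then show ?thesis
      using cplus_assoc[OF a(3) b(3) c(3), of ?s ?t] st frac_bounds[of "p + q" r] frac_bounds[of p q] a b c by simp
  qed
  have H: "cplus C ?t f g \<in> Hom C X Y" "cplus C (q / (q + r)) g h \<in> Hom C X Y"
    using a b c by (auto intro!: cplus_closed frac_bounds)
  show ?thesis
    using a b c * cone_add_cone[OF H(1) c(3), of "p + q" r] cone_add_cone[OF a(3) H(2), of p "q + r"]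
    by (simp add: cone_add_cone add.assoc)
qed

lemma cone_add_zero:
  assumes "a \<in> Cone C X Y"
  shows "cone_add C (cone_zero C X Y) a = a" "cone_add C a (cone_zero C X Y) = a"
proof -
  obtain p f where a: "a = cone C p f" "0 \<le> p" "f \<in> Hom C X Y"
    using assms by (elim ConeE)
  have S: "Star C X Y \<in> Hom C X Y" using a Hom_Ob Star_closed by blast
  show 1: "cone_add C (cone_zero C X Y) a = a"
    using a S by (simp add: cone_zero_def cone_add_cone) (simp add: cplus_def)
  show "cone_add C a (cone_zero C X Y) = a"
    using 1 cone_add_commute[OF assms, of "cone_zero C X Y"] cone_zero_closed Cone_Ob[OF assms] by auto
qed

lemma cone_add_left_commute:
  assumes "a \<in> Cone C X Y" "b \<in> Cone C X Y" "c \<in> Cone C X Y"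
  shows "cone_add C a (cone_add C b c) = cone_add C b (cone_add C a c)"
  using cone_add_assoc[OF assms] cone_add_assoc[OF assms(2,1,3)] cone_add_commute[OF assms(1,2)] by simp

lemma cone_mul_assoc:
  assumes "a \<in> Cone C W X" "b \<in> Cone C X Y" "c \<in> Cone C Y Z"
  shows "cone_mul C (cone_mul C a b) c = cone_mul C a (cone_mul C b c)"
  using assms by (elim ConeE) (simp add: cone_mul_cone[OF _ seq_closed] cone_mul_cone cone_mul_cone[OF seq_closed] seq_closed seq_assoc mult.assoc)

lemma cone_mul_idn:
  assumes "a \<in> Cone C X Y"
  shows "cone_mul C (cone C 1 (Idn C X)) a = a" "cone_mul C a (cone C 1 (Idn C Y)) = a"
proof -
  obtain p f where a: "a = cone C p f" "0 \<le> p" "f \<in> Hom C X Y"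
    using assms by (elim ConeE)
  have "Idn C X \<in> Hom C X X" "Idn C Y \<in> Hom C Y Y" using Cone_Ob[OF assms] idn_closed by auto
  then show "cone_mul C (cone C 1 (Idn C X)) a = a" "cone_mul C a (cone C 1 (Idn C Y)) = a"
    using a cone_mul_cone[of "Idn C X" X X f Y 1 p] cone_mul_cone[of f X Y "Idn C Y" Y p 1]
    by (simp_all add: seq_idn_left seq_idn_right)
qed

lemma cone_mul_zero_left:
  assumes "a \<in> Cone C Y Z" "X \<in> Ob C"
  shows "cone_mul C (cone_zero C X Y) a = cone_zero C X Z"
  using assms Cone_Ob[OF assms(1)]
  by (auto elim!: ConeE simp: cone_zero_def cone_mul_cone[OF Star_closed] seq_star_left)

lemma cone_mul_zero_right:
  assumes "a \<in> Cone C X Y" "Z \<in> Ob C"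
  shows "cone_mul C a (cone_zero C Y Z) = cone_zero C X Z"
  using assms Cone_Ob[OF assms(1)]
  by (auto elim!: ConeE simp: cone_zero_def cone_mul_cone[OF _ Star_closed] seq_star_right)

lemma cone_scale_mul:
  assumes "a \<in> Cone C X Y" "b \<in> Cone C Y Z" "0 \<le> r"
  shows "cone_mul C (cone_scale C r a) b = cone_scale C r (cone_mul C a b)"
    "cone_mul C a (cone_scale C r b) = cone_scale C r (cone_mul C a b)"
  using assms by (auto elim!: ConeE simp: cone_mul_cone cone_scale_cone cone_scale_cone[OF seq_closed] mult_ac)

lemma cone_scale_0: "a \<in> Cone C X Y \<Longrightarrow> cone_scale C 0 a = cone_zero C X Y"
  by (auto elim!: ConeE simp: cone_scale_cone cone_0)

lemma cone_scale_1: "a \<in> Cone C X Y \<Longrightarrow> cone_scale C 1 a = a"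
  by (auto elim!: ConeE simp: cone_scale_cone)

lemma cone_scale_scale: "\<lbrakk>a \<in> Cone C X Y; 0 \<le> r; 0 \<le> s\<rbrakk> \<Longrightarrow> cone_scale C r (cone_scale C s a) = cone_scale C (r * s) a"
  by (auto elim!: ConeE simp: cone_scale_cone mult.assoc)

lemma cone_scale_zero: "\<lbrakk>X \<in> Ob C; Y \<in> Ob C; 0 \<le> r\<rbrakk> \<Longrightarrow> cone_scale C r (cone_zero C X Y) = cone_zero C X Y"
  by (simp add: cone_zero_def cone_scale_cone[OF Star_closed])

lemma cone_as_scale: "\<lbrakk>f \<in> Hom C X Y; 0 \<le> p\<rbrakk> \<Longrightarrow> cone C p f = cone_scale C p (cone C 1 f)"
  by (simp add: cone_scale_cone)

text \<open>Scaling by r > 0 has scaling by 1 / r as its inverse. This is the property that the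
  hom-sets may lack and for which the cones are introduced.\<close>

lemma cone_scale_cancel:
  assumes "cone_scale C r a = cone_scale C r b" "a \<in> Cone C X Y" "b \<in> Cone C X Y" "0 < r"
  shows "a = b"
proof -
  have *: "cone_scale C (1 / r) (cone_scale C r c) = c" if "c \<in> Cone C X Y" for c
    using cone_scale_scale[OF that, of "1 / r" r] cone_scale_1[OF that] assms(4) by simp
  have "a = cone_scale C (1 / r) (cone_scale C r a)" by (rule *[OF assms(2), symmetric])
  also have "\<dots> = cone_scale C (1 / r) (cone_scale C r b)" using assms(1) by (rule arg_cong)
  also have "\<dots> = b" using *[OF assms(3)] .
  finally show ?thesis .
qed

lemma cone_scale_add:
  assumes "a \<in> Cone C X Y" "b \<in> Cone C X Y" "0 \<le> r"
  shows "cone_scale C r (cone_add C a b) = cone_add C (cone_scale C r a) (cone_scale C r b)"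
proof (cases "r = 0")
  case True
  then show ?thesis
    using assms cone_add_closed cone_zero_closed cone_add_zero Cone_Ob[OF assms(1)] by (simp add: cone_scale_0)
next
  case False
  then have "r * p / (r * p + r * q) = p / (p + q)" for p q
    by (simp add: distrib_left[symmetric])
  then show ?thesis using assms
    by (auto elim!: ConeE simp: cone_scale_cone cone_add_cone cone_scale_cone[OF cplus_closed] frac_bounds distrib_left)
qed

lemma cone_scale_plus:
  assumes "a \<in> Cone C X Y" "0 \<le> r" "0 \<le> s"
  shows "cone_scale C (r + s) a = cone_add C (cone_scale C r a) (cone_scale C s a)"
  using assms by (auto elim!: ConeE simp: cone_scale_cone cone_add_cone cplus_idem frac_bounds distrib_right)

lemma cone_mul_add_left:
  assumes "a \<in> Cone C X Y" "b \<in> Cone C X Y" "c \<in> Cone C Y Z"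
  shows "cone_mul C (cone_add C a b) c = cone_add C (cone_mul C a c) (cone_mul C b c)"
proof -
  obtain p f q g r h where a: "a = cone C p f" "0 \<le> p" "f \<in> Hom C X Y" and b: "b = cone C q g" "0 \<le> q" "g \<in> Hom C X Y"
     and c: "c = cone C r h" "0 \<le> r" "h \<in> Hom C Y Z"
    using assms by (elim ConeE)
  have H: "Seq C f h \<in> Hom C X Z" "Seq C g h \<in> Hom C X Z" using a b c seq_closed by auto
  show ?thesis
  \<comment> \<open>For r = 0 the common factor cannot be cancelled from the relative weight p * r /
    (p * r + q * r); both sides are zero then.\<close>
  proof (cases "r = 0")
    case True
    then have c0: "c = cone_zero C Y Z" using c by (simp add: cone_0)
    have Ob: "X \<in> Ob C" "Z \<in> Ob C" using Cone_Ob assms by auto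
    show ?thesis
      unfolding c0 cone_mul_zero_right[OF cone_add_closed[OF assms(1,2)] Ob(2)]
        cone_mul_zero_right[OF assms(1) Ob(2)] cone_mul_zero_right[OF assms(2) Ob(2)]
        cone_add_zero(1)[OF cone_zero_closed[OF Ob]] ..
  next
    case False
    then have "p * r / (p * r + q * r) = p / (p + q)"
      by (simp add: distrib_right[symmetric])
    then show ?thesis using a b c H
      by (simp add: cone_add_cone cone_mul_cone[OF cplus_closed] cone_mul_cone frac_bounds seq_cplus_left[OF _ _ a(3) b(3) c(3)] distrib_right)
  qed
qed

lemma cone_mul_add_right:
  assumes "c \<in> Cone C X Y" "a \<in> Cone C Y Z" "b \<in> Cone C Y Z"
  shows "cone_mul C c (cone_add C a b) = cone_add C (cone_mul C c a) (cone_mul C c b)"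
proof -
  obtain p f q g r h where a: "a = cone C p f" "0 \<le> p" "f \<in> Hom C Y Z" and b: "b = cone C q g" "0 \<le> q" "g \<in> Hom C Y Z"
     and c: "c = cone C r h" "0 \<le> r" "h \<in> Hom C X Y"
    using assms by (elim ConeE)
  have H: "Seq C h f \<in> Hom C X Z" "Seq C h g \<in> Hom C X Z" using a b c seq_closed by auto
  show ?thesis
  proof (cases "r = 0")
    case True
    then have c0: "c = cone_zero C X Y" using c by (simp add: cone_0)
    have Ob: "X \<in> Ob C" "Z \<in> Ob C" using Cone_Ob assms by auto
    show ?thesis
      unfolding c0 cone_mul_zero_left[OF cone_add_closed[OF assms(2,3)] Ob(1)]
        cone_mul_zero_left[OF assms(2) Ob(1)] cone_mul_zero_left[OF assms(3) Ob(1)]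
        cone_add_zero(1)[OF cone_zero_closed[OF Ob]] ..
  next
    case False
    then have "r * p / (r * p + r * q) = p / (p + q)"
      by (simp add: distrib_left[symmetric])
    then show ?thesis using a b c H
      by (simp add: cone_add_cone cone_mul_cone[OF _ cplus_closed] cone_mul_cone frac_bounds seq_cplus_right[OF _ _ c(3) a(3) b(3)] distrib_left)
  qed
qed

section \<open>Finite sums in a cone\<close>

lemma cone_sum_closed:
  "\<lbrakk>\<And>j. j < n \<Longrightarrow> a j \<in> Cone C X Y; X \<in> Ob C; Y \<in> Ob C\<rbrakk> \<Longrightarrow> cone_sum C X Y n a \<in> Cone C X Y"
  by (induction n arbitrary: a) (auto simp: cone_zero_closed cone_add_closed)

lemma cone_sum_cong: "(\<And>j. j < n \<Longrightarrow> a j = b j) \<Longrightarrow> cone_sum C X Y n a = cone_sum C X Y n b"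
proof (induction n arbitrary: a b)
  case (Suc n)
  from Suc.IH[of "\<lambda>j. a (Suc j)" "\<lambda>j. b (Suc j)"] Suc.prems show ?case by simp
qed simp

lemma cone_sum_zero:
  "\<lbrakk>X \<in> Ob C; Y \<in> Ob C; \<And>j. j < n \<Longrightarrow> a j = cone_zero C X Y\<rbrakk> \<Longrightarrow> cone_sum C X Y n a = cone_zero C X Y"
  by (induction n arbitrary: a) (auto simp: cone_add_zero cone_zero_closed)

lemma cone_sum_single:
  "\<lbrakk>k < n; a k \<in> Cone C X Y; \<And>j. j < n \<Longrightarrow> j \<noteq> k \<Longrightarrow> a j = cone_zero C X Y\<rbrakk> \<Longrightarrow> cone_sum C X Y n a = a k"
proof (induction n arbitrary: a k)
  case (Suc n)
  have XY: "X \<in> Ob C" "Y \<in> Ob C" using Cone_Ob[OF Suc.prems(2)] by auto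
  show ?case
  proof (cases k)
    case 0
    then show ?thesis using Suc.prems XY by (simp add: cone_sum_zero cone_add_zero)
  next
    case (Suc k')
    then show ?thesis using Suc.prems Suc.IH[of k' "\<lambda>j. a (Suc j)"] by (simp add: cone_add_zero)
  qed
qed simp

lemma cone_sum_add:
  "\<lbrakk>X \<in> Ob C; Y \<in> Ob C; \<And>j. j < n \<Longrightarrow> a j \<in> Cone C X Y; \<And>j. j < n \<Longrightarrow> b j \<in> Cone C X Y\<rbrakk> \<Longrightarrow>
   cone_sum C X Y n (\<lambda>j. cone_add C (a j) (b j)) = cone_add C (cone_sum C X Y n a) (cone_sum C X Y n b)"
proof (induction n arbitrary: a b)
  case (Suc n)
  let ?A = "cone_sum C X Y n (\<lambda>j. a (Suc j))" let ?B = "cone_sum C X Y n (\<lambda>j. b (Suc j))"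
  have cl: "?A \<in> Cone C X Y" "?B \<in> Cone C X Y" "a 0 \<in> Cone C X Y" "b 0 \<in> Cone C X Y"
    using Suc.prems by (auto intro: cone_sum_closed)
  have "cone_add C (cone_add C (a 0) (b 0)) (cone_add C ?A ?B) = cone_add C (cone_add C (a 0) ?A) (cone_add C (b 0) ?B)"
    using cl by (simp add: cone_add_assoc cone_add_closed cone_add_left_commute)
  then show ?case using Suc by simp
qed (simp add: cone_add_zero cone_zero_closed)

lemma cone_sum_scale:
  "\<lbrakk>X \<in> Ob C; Y \<in> Ob C; 0 \<le> r; \<And>j. j < n \<Longrightarrow> a j \<in> Cone C X Y\<rbrakk> \<Longrightarrow>
   cone_sum C X Y n (\<lambda>j. cone_scale C r (a j)) = cone_scale C r (cone_sum C X Y n a)"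
proof (induction n arbitrary: a)
  case (Suc n)
  have "a 0 \<in> Cone C X Y" "cone_sum C X Y n (\<lambda>j. a (Suc j)) \<in> Cone C X Y"
    using Suc.prems by (auto intro: cone_sum_closed)
  from cone_scale_add[OF this Suc.prems(3)] show ?case
    using Suc.IH[of "\<lambda>j. a (Suc j)"] Suc.prems by simp
qed (simp add: cone_scale_zero)

lemma cone_sum_mul_left:
  "\<lbrakk>c \<in> Cone C W X; Y \<in> Ob C; \<And>j. j < n \<Longrightarrow> a j \<in> Cone C X Y\<rbrakk> \<Longrightarrow>
   cone_mul C c (cone_sum C X Y n a) = cone_sum C W Y n (\<lambda>j. cone_mul C c (a j))"
proof (induction n arbitrary: a)
  case (Suc n)
  have "a 0 \<in> Cone C X Y" "cone_sum C X Y n (\<lambda>j. a (Suc j)) \<in> Cone C X Y"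
    using Suc.prems Cone_Ob[OF Suc.prems(1)] by (auto intro: cone_sum_closed)
  from cone_mul_add_right[OF Suc.prems(1) this] show ?case
    using Suc.IH[of "\<lambda>j. a (Suc j)"] Suc.prems by simp
qed (simp add: cone_mul_zero_right)

lemma cone_sum_mul_right:
  "\<lbrakk>c \<in> Cone C Y Z; X \<in> Ob C; \<And>j. j < n \<Longrightarrow> a j \<in> Cone C X Y\<rbrakk> \<Longrightarrow>
   cone_mul C (cone_sum C X Y n a) c = cone_sum C X Z n (\<lambda>j. cone_mul C (a j) c)"
proof (induction n arbitrary: a)
  case (Suc n)
  have "a 0 \<in> Cone C X Y" "cone_sum C X Y n (\<lambda>j. a (Suc j)) \<in> Cone C X Y"
    using Suc.prems Cone_Ob[OF Suc.prems(1)] by (auto intro: cone_sum_closed)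
  from cone_mul_add_left[OF this Suc.prems(1)] show ?case
    using Suc.IH[of "\<lambda>j. a (Suc j)"] Suc.prems by simp
qed (simp add: cone_mul_zero_left)

lemma cone_sum_swap:
  "\<lbrakk>X \<in> Ob C; Y \<in> Ob C; \<And>i j. i < m \<Longrightarrow> j < n \<Longrightarrow> a i j \<in> Cone C X Y\<rbrakk> \<Longrightarrow>
   cone_sum C X Y m (\<lambda>i. cone_sum C X Y n (a i)) = cone_sum C X Y n (\<lambda>j. cone_sum C X Y m (\<lambda>i. a i j))"
  by (induction m arbitrary: a) (auto simp: cone_sum_zero cone_sum_add cone_sum_closed)

section \<open>Convex sums of arrows as sums in a cone\<close>

lemma csum_weights:
  fixes p :: "nat \<Rightarrow> real"
  assumes "\<And>j. j < Suc n \<Longrightarrow> 0 \<le> p j" "(\<Sum>j<Suc n. p j) \<le> 1"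
  shows "0 \<le> p 0" "p 0 \<le> 1" "\<And>j. j < n \<Longrightarrow> 0 \<le> p (Suc j) / (1 - p 0)" "(\<Sum>j<n. p (Suc j) / (1 - p 0)) \<le> 1"
    "p 0 = 1 \<Longrightarrow> j < n \<Longrightarrow> p (Suc j) = 0"
proof -
  have *: "p 0 + (\<Sum>j<n. p (Suc j)) \<le> 1" using assms(2) by (simp only: sum.lessThan_Suc_shift)
  have nn: "0 \<le> p (Suc j)" if "j < n" for j using assms(1) that by simp
  then have s0: "0 \<le> (\<Sum>j<n. p (Suc j))" by (intro sum_nonneg) auto
  show p0: "0 \<le> p 0" "p 0 \<le> 1" using assms(1)[of 0] * s0 by auto
  show "0 \<le> p (Suc j) / (1 - p 0)" if "j < n" for j using nn[OF that] p0 by simp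
  show "(\<Sum>j<n. p (Suc j) / (1 - p 0)) \<le> 1"
    using * p0 by (simp only: sum_divide_distrib[symmetric]) (simp add: divide_simps)
  \<comment> \<open>If the first weight is 1, nothing is left for the others. This agrees with the
    weights 0 that division by zero assigns to them in \<open>csum\<close>.\<close>
  show "p (Suc j) = 0" if "p 0 = 1" "j < n"
    using * that s0 sum_nonneg_eq_0_iff[of "{..<n}" "\<lambda>j. p (Suc j)"] nn by auto
qed

lemma csum_closed:
  "\<lbrakk>X \<in> Ob C; Y \<in> Ob C; \<And>j. j < n \<Longrightarrow> 0 \<le> p j; (\<Sum>j<n. p j) \<le> 1; \<And>j. j < n \<Longrightarrow> f j \<in> Hom C X Y\<rbrakk> \<Longrightarrow>
   csum C X Y n p f \<in> Hom C X Y"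
proof (induction n arbitrary: p f)
  case (Suc n)
  have "csum C X Y n (\<lambda>j. p (Suc j) / (1 - p 0)) (\<lambda>j. f (Suc j)) \<in> Hom C X Y"
    using csum_weights[OF Suc.prems(3,4)] Suc.prems by (intro Suc.IH) auto
  then show ?case using csum_weights[OF Suc.prems(3,4)] Suc.prems by (auto intro: cplus_closed)
qed (simp add: Star_closed)

text \<open>Each step of \<open>csum\<close> divides the remaining weights by 1 - p 0. In the cone,
  scaling the tail by 1 - p 0 undoes this, and the nested convex sum becomes a plain sum of weighted
  arrows.\<close>

lemma cone_csum:
  "\<lbrakk>X \<in> Ob C; Y \<in> Ob C; \<And>j. j < n \<Longrightarrow> 0 \<le> p j; (\<Sum>j<n. p j) \<le> 1; \<And>j. j < n \<Longrightarrow> f j \<in> Hom C X Y\<rbrakk> \<Longrightarrow>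
   cone C 1 (csum C X Y n p f) = cone_sum C X Y n (\<lambda>j. cone C (p j) (f j))"
proof (induction n arbitrary: p f)
  case (Suc n)
  let ?q = "\<lambda>j. p (Suc j) / (1 - p 0)"
  note w = csum_weights[OF Suc.prems(3,4)]
  have cl: "csum C X Y n ?q (\<lambda>j. f (Suc j)) \<in> Hom C X Y"
    using w Suc.prems by (intro csum_closed) auto
  have IH: "cone C 1 (csum C X Y n ?q (\<lambda>j. f (Suc j))) = cone_sum C X Y n (\<lambda>j. cone C (?q j) (f (Suc j)))"
    using w Suc.prems by (intro Suc.IH) auto
  have "cone C (1 - p 0) (csum C X Y n ?q (\<lambda>j. f (Suc j)))
     = cone_sum C X Y n (\<lambda>j. cone_scale C (1 - p 0) (cone C (?q j) (f (Suc j))))"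
    using w Suc.prems cone_as_scale[OF cl, of "1 - p 0"] unfolding IH
    by (subst cone_sum_scale) (auto intro!: cone_closed)
  also have "\<dots> = cone_sum C X Y n (\<lambda>j. cone C (p (Suc j)) (f (Suc j)))"
  proof (intro cone_sum_cong)
    fix j assume j: "j < n"
    then have "f (Suc j) \<in> Hom C X Y" using Suc.prems by simp
    moreover have "0 \<le> ?q j" "p 0 = 1 \<Longrightarrow> p (Suc j) = 0" using w(3,5) j by blast+
    ultimately show "cone_scale C (1 - p 0) (cone C (?q j) (f (Suc j))) = cone C (p (Suc j)) (f (Suc j))"
      using w(2) cone_scale_cone[of "f (Suc j)" X Y "?q j" "1 - p 0"] by (cases "p 0 = 1") auto
  qed
  finally show ?case
    using cone_cplus[OF Suc.prems(5)[of 0] cl w(1,2)] by simp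
qed (simp add: cone_Star)

end


section \<open>Matrices up to congruence\<close>

definition entry :: "('o, 'a, 'z) pca_cat_scheme \<Rightarrow> ('o, 'a) smat \<Rightarrow> nat \<Rightarrow> nat \<Rightarrow> (real \<times> 'a) set" where
  "entry C M j i = cone C (wgt M j i) (arw M j i)"

lemma mk_smat_simps [simp]:
  "sdom (mk_smat Us Vs e) = Us" "scod (mk_smat Us Vs e) = Vs"
  "sent (mk_smat Us Vs e) \<in> carrier_mat (length Vs) (length Us)"
  "\<lbrakk>j < length Vs; i < length Us\<rbrakk> \<Longrightarrow> sent (mk_smat Us Vs e) $$ (j, i) = e j i"
  by (simp_all add: mk_smat_def)

lemma smat_unit_simps [simp]: "sdom (smat_unit C Us Vs P) = Us" "scod (smat_unit C Us Vs P) = Vs"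
  by (simp_all add: smat_unit_def)

lemma smat_seq_simps [simp]: "sdom (smat_seq C M N) = sdom M" "scod (smat_seq C M N) = scod N"
  by (simp_all add: smat_seq_def)

lemma smat_plus_simps [simp]: "sdom (smat_plus C q M N) = sdom M" "scod (smat_plus C q M N) = scod M"
  by (simp_all add: smat_plus_def)

lemma entry_mk_smat [simp]:
  "\<lbrakk>j < length Vs; i < length Us\<rbrakk> \<Longrightarrow> entry C (mk_smat Us Vs e) j i = cone C (fst (e j i)) (snd (e j i))"
  by (simp add: entry_def)

lemma smatsD:
  assumes "M \<in> smats C"
  shows "set (sdom M) \<subseteq> Ob C" "set (scod M) \<subseteq> Ob C"
    "\<lbrakk>i < length (sdom M); j < length (scod M)\<rbrakk> \<Longrightarrow> 0 \<le> wgt M j i"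
    "\<lbrakk>i < length (sdom M); j < length (scod M)\<rbrakk> \<Longrightarrow> wgt M j i \<le> 1"
    "\<lbrakk>i < length (sdom M); j < length (scod M)\<rbrakk> \<Longrightarrow> arw M j i \<in> Hom C (sdom M ! i) (scod M ! j)"
    "i < length (sdom M) \<Longrightarrow> (\<Sum>j<length (scod M). wgt M j i) \<le> 1"
  using assms by (auto simp: smats_def)

lemma mk_smat_closed:
  assumes "set Us \<subseteq> Ob C" "set Vs \<subseteq> Ob C"
    and e: "\<And>i j. \<lbrakk>i < length Us; j < length Vs\<rbrakk> \<Longrightarrow> 0 \<le> fst (e j i) \<and> snd (e j i) \<in> Hom C (Us ! i) (Vs ! j)"
    and s: "\<And>i. i < length Us \<Longrightarrow> (\<Sum>j<length Vs. fst (e j i)) \<le> 1"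
  shows "mk_smat Us Vs e \<in> smats C"
proof -
  have "fst (e j i) \<le> 1" if "i < length Us" "j < length Vs" for i j
    using member_le_sum[of j "{..<length Vs}" "\<lambda>j. fst (e j i)"] s[OF that(1)] e that by auto
  moreover have "(\<Sum>j<length Vs. wgt (mk_smat Us Vs e) j i) \<le> 1" if "i < length Us" for i
    using s[OF that] that by simp
  ultimately show ?thesis using assms by (simp add: smats_def)
qed

lemma sum_lessThan_append:
  "(\<Sum>j<length (Us @ Vs). f j) = (\<Sum>j<length Us. f j) + (\<Sum>j<length Vs. f (length Us + j) :: real)"
  by (induction Vs rule: rev_induct) auto

context pca_category
begin

section \<open>Composites and convex combinations of matrices, entry by entry\<close>

lemma entry_closed:
  "\<lbrakk>M \<in> smats C; i < length (sdom M); j < length (scod M)\<rbrakk> \<Longrightarrow> entry C M j i \<in> Cone C (sdom M ! i) (scod M ! j)"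
  unfolding entry_def by (intro cone_closed smatsD)

text \<open>Needed to evaluate a composite with the codiagonal. That composite is compared with the
  original matrix through \<open>smat_ident\<close>, an equation in the hom-sets themselves, so the
  sum is evaluated in the pca; passing to cones would lose information.\<close>

lemma csum_const:
  "\<lbrakk>g \<in> Hom C X Y; \<And>j. j < n \<Longrightarrow> 0 \<le> p j; (\<Sum>j<n. p j) \<le> 1; \<And>j. j < n \<Longrightarrow> p j \<noteq> 0 \<Longrightarrow> f j = g;
    \<And>j. j < n \<Longrightarrow> f j \<in> Hom C X Y\<rbrakk> \<Longrightarrow> csum C X Y n p f = scale C (\<Sum>j<n. p j) g"
proof (induction n arbitrary: p f)
  case 0
  then show ?case by (simp add: scale_0)
next
  case (Suc n)
  let ?q = "\<lambda>j. p (Suc j) / (1 - p 0)" and ?t = "\<Sum>j<Suc n. p j"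
  note w = csum_weights[OF Suc.prems(2,3)]
  have IH: "csum C X Y n ?q (\<lambda>j. f (Suc j)) = scale C (\<Sum>j<n. ?q j) g"
    using w Suc.prems by (intro Suc.IH) auto
  have t: "?t = p 0 + (\<Sum>j<n. p (Suc j))" by (simp only: sum.lessThan_Suc_shift)
  have nn: "0 \<le> (\<Sum>j<n. p (Suc j))" using Suc.prems(2) by (intro sum_nonneg) auto
  have q: "(\<Sum>j<n. ?q j) = (\<Sum>j<n. p (Suc j)) / (1 - p 0)" by (simp only: sum_divide_distrib)
  consider "p 0 = 1" | "p 0 = 0" | "0 < p 0" "p 0 < 1" using w(1,2) by linarith
  then show ?case
  proof cases
    case 1
    then have "f 0 = g" "?t = 1" using Suc.prems(3) Suc.prems(4)[of 0] t nn by auto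
    then show ?thesis using 1 by (simp add: cplus_def scale_1 del: sum.lessThan_Suc)
  next
    case 2
    then show ?thesis using IH q t by (simp add: cplus_def del: sum.lessThan_Suc)
  next
    case 3
    have S: "Star C X Y \<in> Hom C X Y" using Suc.prems(1) Hom_Ob Star_closed by blast
    have f0: "f 0 = g" using Suc.prems(4)[of 0] 3 by simp
    have tp: "0 < ?t" "?t \<le> 1" "p 0 \<le> ?t" using 3 nn t Suc.prems(3) by auto
    have e: "0 \<le> p 0 / ?t" "p 0 / ?t \<le> 1" using tp 3 by (auto simp del: sum.lessThan_Suc)
    have "?t * (p 0 / ?t) = p 0" using tp by (simp del: sum.lessThan_Suc)
    moreover have "?t * (1 - p 0 / ?t) = (\<Sum>j<n. p (Suc j))"
      using tp t by (simp add: right_diff_distrib del: sum.lessThan_Suc)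
    \<comment> \<open>Associativity is applied to g split into two copies of itself with relative
      weight p 0 / t inside the total weight t; idempotence merges the copies again.\<close>
    ultimately have "cplus C ?t (cplus C (p 0 / ?t) g g) (Star C X Y)
      = cplus C (p 0) g (cplus C (\<Sum>j<n. ?q j) g (Star C X Y))"
      unfolding q using cplus_assoc[OF Suc.prems(1,1) S, of ?t "p 0 / ?t"] tp e by (simp del: sum.lessThan_Suc)
    then show ?thesis
      using IH f0 by (simp add: cplus_idem[OF Suc.prems(1) e] scale_Hom[OF Suc.prems(1)] del: sum.lessThan_Suc)
  qed
qed

lemma seq_weights:
  assumes M: "M \<in> smats C" and N: "N \<in> smats C" and MN: "scod M = sdom N" and i: "i < length (sdom M)"
  defines "r \<equiv> \<lambda>u. \<Sum>j<length (scod M). wgt N u j * wgt M j i"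
  shows "u < length (scod N) \<Longrightarrow> 0 \<le> r u" "(\<Sum>u<length (scod N). r u) \<le> 1"
    "\<lbrakk>u < length (scod N); j < length (scod M)\<rbrakk> \<Longrightarrow> 0 \<le> wgt N u j * wgt M j i"
    "\<lbrakk>u < length (scod N); j < length (scod M)\<rbrakk> \<Longrightarrow> 0 \<le> wgt N u j * wgt M j i / r u"
    "u < length (scod N) \<Longrightarrow> (\<Sum>j<length (scod M). wgt N u j * wgt M j i / r u) \<le> 1"
    "\<lbrakk>u < length (scod N); j < length (scod M); r u = 0\<rbrakk> \<Longrightarrow> wgt N u j * wgt M j i = 0"
proof -
  show nn: "0 \<le> wgt N u j * wgt M j i" if "u < length (scod N)" "j < length (scod M)" for u j
    using smatsD(3)[OF M i] smatsD(3)[OF N] that MN by simp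
  show r: "0 \<le> r u" if "u < length (scod N)" for u
    unfolding r_def using nn[OF that] by (intro sum_nonneg) simp
  show "0 \<le> wgt N u j * wgt M j i / r u" if "u < length (scod N)" "j < length (scod M)" for u j
    using nn[OF that] r[OF that(1)] by simp
  show "(\<Sum>j<length (scod M). wgt N u j * wgt M j i / r u) \<le> 1"
  proof -
    have "(\<Sum>j<length (scod M). wgt N u j * wgt M j i / r u) = r u / r u"
      unfolding r_def by (rule sum_divide_distrib[symmetric])
    then show ?thesis by simp
  qed
  show "wgt N u j * wgt M j i = 0" if "u < length (scod N)" "j < length (scod M)" "r u = 0" for u j
    using that sum_nonneg_eq_0_iff[of "{..<length (scod M)}" "\<lambda>j. wgt N u j * wgt M j i"] nn[OF that(1)]
    unfolding r_def by blast
  \<comment> \<open>Exchanging the sums factors out the column sums of \<open>N\<close>, each at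
    most 1, and leaves a column sum of \<open>M\<close>.\<close>
  have "(\<Sum>u<length (scod N). r u) = (\<Sum>j<length (scod M). (\<Sum>u<length (scod N). wgt N u j) * wgt M j i)"
    unfolding r_def by (subst sum.swap) (simp add: sum_distrib_right)
  also have "\<dots> \<le> (\<Sum>j<length (scod M). 1 * wgt M j i)"
    using smatsD(6)[OF N] smatsD(3)[OF M i] MN by (intro sum_mono mult_right_mono) auto
  also have "\<dots> \<le> 1" using smatsD(6)[OF M i] by simp
  finally show "(\<Sum>u<length (scod N). r u) \<le> 1" .
qed

lemma seq_arrows:
  assumes M: "M \<in> smats C" and N: "N \<in> smats C" and MN: "scod M = sdom N"
    and "i < length (sdom M)" "u < length (scod N)" "j < length (scod M)"
  shows "Seq C (arw M j i) (arw N u j) \<in> Hom C (sdom M ! i) (scod N ! u)"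
  using assms smatsD(5)[OF M, of i j] smatsD(5)[OF N, of j u] by (auto intro: seq_closed)

lemma smat_seq_closed:
  assumes M: "M \<in> smats C" and N: "N \<in> smats C" and MN: "scod M = sdom N"
  shows "smat_seq C M N \<in> smats C"
  unfolding smat_seq_def Let_def
proof (rule mk_smat_closed)
  let ?r = "\<lambda>u i. \<Sum>j<length (scod M). wgt N u j * wgt M j i"
  let ?e = "\<lambda>u i. (?r u i, csum C (sdom M ! i) (scod N ! u) (length (scod M))
        (\<lambda>j. wgt N u j * wgt M j i / ?r u i) (\<lambda>j. Seq C (arw M j i) (arw N u j)))"
  fix i assume i: "i < length (sdom M)"
  show "(\<Sum>u<length (scod N). fst (?e u i)) \<le> 1"
    unfolding fst_conv by (rule seq_weights[OF M N MN i])
  fix u assume u: "u < length (scod N)"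
  have "sdom M ! i \<in> Ob C" "scod N ! u \<in> Ob C" using i u smatsD(1)[OF M] smatsD(2)[OF N] by auto
  then show "0 \<le> fst (?e u i) \<and> snd (?e u i) \<in> Hom C (sdom M ! i) (scod N ! u)"
    unfolding fst_conv snd_conv
    by (intro conjI csum_closed seq_weights[OF M N MN i] seq_arrows[OF M N MN i u] u)
qed (use smatsD(1)[OF M] smatsD(2)[OF N] in auto)

lemma entry_seq:
  assumes M: "M \<in> smats C" and N: "N \<in> smats C" and MN: "scod M = sdom N"
    and iu: "i < length (sdom M)" "u < length (scod N)"
  shows "entry C (smat_seq C M N) u i = cone_sum C (sdom M ! i) (scod N ! u) (length (scod M))
    (\<lambda>j. cone_mul C (entry C M j i) (entry C N u j))"
proof -
  let ?n = "length (scod M)" and ?X = "sdom M ! i" and ?Y = "scod N ! u"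
  let ?w = "\<lambda>j. wgt N u j * wgt M j i" and ?f = "\<lambda>j. Seq C (arw M j i) (arw N u j)"
  define r where "r = (\<Sum>j<?n. ?w j)"
  have w2: "(\<Sum>j<?n. ?w j / r) \<le> 1" using seq_weights(5)[OF M N MN iu] unfolding r_def .
  have w3: "0 \<le> ?w j / r" if "j < ?n" for j using seq_weights(4)[OF M N MN iu that] unfolding r_def .
  have w4: "?w j = 0" if "j < ?n" "r = 0" for j using seq_weights(6)[OF M N MN iu that(1)] that unfolding r_def by simp
  have r0: "0 \<le> r" using seq_weights(1)[OF M N MN iu] unfolding r_def .
  have XY: "?X \<in> Ob C" "?Y \<in> Ob C" using iu smatsD(1)[OF M] smatsD(2)[OF N] by auto
  have f: "?f j \<in> Hom C ?X ?Y" if "j < ?n" for j using seq_arrows[OF M N MN iu that] .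
  have cl: "csum C ?X ?Y ?n (\<lambda>j. ?w j / r) ?f \<in> Hom C ?X ?Y"
    using XY w2 w3 f by (intro csum_closed)
  have "entry C (smat_seq C M N) u i = cone C r (csum C ?X ?Y ?n (\<lambda>j. ?w j / r) ?f)"
    using iu by (simp add: smat_seq_def Let_def r_def)
  also have "\<dots> = cone_scale C r (cone_sum C ?X ?Y ?n (\<lambda>j. cone C (?w j / r) (?f j)))"
    using cone_as_scale[OF cl r0] cone_csum[OF XY w3 w2 f] by simp
  also have "\<dots> = cone_sum C ?X ?Y ?n (\<lambda>j. cone_scale C r (cone C (?w j / r) (?f j)))"
    by (rule cone_sum_scale[symmetric]) (use XY r0 w3 f in \<open>auto intro: cone_closed\<close>)
  also have "\<dots> = cone_sum C ?X ?Y ?n (\<lambda>j. cone_mul C (entry C M j i) (entry C N u j))"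
  proof (rule cone_sum_cong)
    fix j assume j: "j < ?n"
    \<comment> \<open>The weight r of the entry cancels the division in \<open>smat_seq\<close>. For
      r = 0 all products of weights vanish, so the equation persists.\<close>
    have "r * (?w j / r) = ?w j" using w4[OF j] by (cases "r = 0") simp_all
    then have "cone_scale C r (cone C (?w j / r) (?f j)) = cone C (?w j) (?f j)"
      by (simp only: cone_scale_cone[OF f[OF j] w3[OF j] r0])
    also have "\<dots> = cone_mul C (entry C M j i) (entry C N u j)"
      unfolding entry_def
      using cone_mul_cone[OF smatsD(5)[OF M iu(1) j] _ smatsD(3)[OF M iu(1) j], of "arw N u j" "scod N ! u" "wgt N u j"]
        smatsD(3,5)[OF N _ iu(2), of j] j MN by (simp add: mult.commute)
    finally show "cone_scale C r (cone C (?w j / r) (?f j)) = cone_mul C (entry C M j i) (entry C N u j)" .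
  qed
  finally show ?thesis .
qed

lemma smat_plus_closed:
  assumes M: "M \<in> smats C" and N: "N \<in> smats C" and MN: "sdom M = sdom N" "scod M = scod N"
    and q: "0 \<le> q" "q \<le> 1"
  shows "smat_plus C q M N \<in> smats C"
  unfolding smat_plus_def Let_def
proof (rule mk_smat_closed)
  let ?r = "\<lambda>j i. q * wgt M j i + (1 - q) * wgt N j i"
  let ?e = "\<lambda>j i. (?r j i, cplus C (q * wgt M j i / ?r j i) (arw M j i) (arw N j i))"
  fix i assume i: "i < length (sdom M)"
  have "q * (\<Sum>j<length (scod M). wgt M j i) \<le> q * 1" "(1 - q) * (\<Sum>j<length (scod M). wgt N j i) \<le> (1 - q) * 1"
    using smatsD(6)[OF M i] smatsD(6)[OF N, of i] MN i q by (auto intro!: mult_left_mono simp del: mult_1_right)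
  then show "(\<Sum>j<length (scod M). fst (?e j i)) \<le> 1"
    by (simp add: sum.distrib sum_distrib_left)
  fix j assume j: "j < length (scod M)"
  have "0 \<le> q * wgt M j i" "0 \<le> (1 - q) * wgt N j i"
    using smatsD(3)[OF M i j] smatsD(3)[OF N, of i j] MN i j q by auto
  then show "0 \<le> fst (?e j i) \<and> snd (?e j i) \<in> Hom C (sdom M ! i) (scod M ! j)"
    using smatsD(5)[OF M i j] smatsD(5)[OF N, of i j] MN i j
    unfolding fst_conv snd_conv by (auto intro!: cplus_closed frac_bounds)
qed (use smatsD(1,2)[OF M] in auto)

lemma entry_plus:
  assumes M: "M \<in> smats C" and N: "N \<in> smats C" and MN: "sdom M = sdom N" "scod M = scod N"
    and q: "0 \<le> q" "q \<le> 1" and ij: "i < length (sdom M)" "j < length (scod M)"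
  shows "entry C (smat_plus C q M N) j i = cone_add C (cone_scale C q (entry C M j i)) (cone_scale C (1 - q) (entry C N j i))"
proof -
  have H: "arw M j i \<in> Hom C (sdom M ! i) (scod M ! j)" "arw N j i \<in> Hom C (sdom M ! i) (scod M ! j)"
    and w: "0 \<le> wgt M j i" "0 \<le> wgt N j i"
    using smatsD(3,5)[OF M ij] smatsD(3,5)[OF N, of i j] MN ij by auto
  show ?thesis
    using cone_add_cone[OF H, of "q * wgt M j i" "(1 - q) * wgt N j i"] cone_scale_cone[OF H(1) w(1) q(1)]
      cone_scale_cone[OF H(2) w(2), of "1 - q"] q ij w
    by (simp add: smat_plus_def Let_def) (simp add: entry_def)
qed

text \<open>An identity entry requires equal letters, and at most one marked row per column keeps
  the column sums at most 1. A row may carry several marks, as in the codiagonal.\<close>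

lemma smat_unit_closed:
  assumes Us: "set Us \<subseteq> Ob C" and Vs: "set Vs \<subseteq> Ob C"
    and eq: "\<And>i j. \<lbrakk>i < length Us; j < length Vs; P j i\<rbrakk> \<Longrightarrow> Us ! i = Vs ! j"
    and single: "\<And>i j j'. \<lbrakk>i < length Us; j < length Vs; j' < length Vs; P j i; P j' i\<rbrakk> \<Longrightarrow> j = j'"
  shows "smat_unit C Us Vs P \<in> smats C"
  unfolding smat_unit_def
proof (rule mk_smat_closed[OF Us Vs])
  let ?e = "\<lambda>j i. if P j i then (1 :: real, Idn C (Us ! i)) else (0, Star C (Us ! i) (Vs ! j))"
  fix i assume i: "i < length Us"
  have "(\<Sum>j<length Vs. if P j i then 1 else 0) = real (card {j. j < length Vs \<and> P j i})"
    by (simp add: sum.If_cases) (rule arg_cong[where f=card], auto)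
  also have "card {j. j < length Vs \<and> P j i} \<le> 1"
    using single[OF i] by (auto simp: card_le_Suc0_iff_eq)
  finally show "(\<Sum>j<length Vs. fst (?e j i)) \<le> 1"
    by (simp add: if_distrib[of fst] cong: if_cong)
  fix j assume j: "j < length Vs"
  have "Us ! i \<in> Ob C" "Vs ! j \<in> Ob C" using Us Vs i j by auto
  then show "0 \<le> fst (?e j i) \<and> snd (?e j i) \<in> Hom C (Us ! i) (Vs ! j)"
    using eq[OF i j] idn_closed[of "Us ! i"] Star_closed by auto
qed

lemma entry_unit:
  assumes "i < length Us" "j < length Vs"
  shows "entry C (smat_unit C Us Vs P) j i =
    (if P j i then cone C 1 (Idn C (Us ! i)) else cone_zero C (Us ! i) (Vs ! j))"
  using assms by (simp add: smat_unit_def cone_zero_def)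

text \<open>Column i of the first factor has its only identity in row k, so column i of the product
  is column k of \<open>N\<close>; all other summands are zero in the cone.\<close>

lemma entry_unit_seq:
  assumes U: "smat_unit C Us Ws P \<in> smats C" and N: "N \<in> smats C" "sdom N = Ws"
    and i: "i < length Us" "u < length (scod N)" "k < length Ws" "Us ! i = Ws ! k"
    and P: "\<And>j. j < length Ws \<Longrightarrow> P j i \<longleftrightarrow> j = k"
  shows "entry C (smat_seq C (smat_unit C Us Ws P) N) u i = entry C N u k"
proof -
  let ?a = "\<lambda>j. cone_mul C (entry C (smat_unit C Us Ws P) j i) (entry C N u j)"
  have N': "entry C N u j \<in> Cone C (Ws ! j) (scod N ! u)" if "j < length Ws" for j
    using entry_closed[OF N(1), of j u] N(2) i that by simp
  have X: "Us ! i \<in> Ob C" using smatsD(1)[OF U] nth_mem[OF i(1)] by auto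
  have k: "?a k = entry C N u k"
    using cone_mul_idn(1)[OF N'[OF i(3)]] P[OF i(3)] i by (simp add: entry_unit)
  have "?a j = cone_zero C (Us ! i) (scod N ! u)" if "j < length Ws" "j \<noteq> k" for j
    using cone_mul_zero_left[OF N'[OF that(1)] X] P[OF that(1)] that i by (simp add: entry_unit)
  moreover have "?a k \<in> Cone C (Us ! i) (scod N ! u)" unfolding k using N'[OF i(3)] i by simp
  ultimately have "cone_sum C (Us ! i) (scod N ! u) (length Ws) ?a = ?a k"
    using cone_sum_single[OF i(3), where a = ?a] by blast
  then show ?thesis using entry_seq[OF U N(1), of i u] N i k by simp
qed

lemma entry_seq_unit:
  assumes U: "smat_unit C Ws Vs P \<in> smats C" and M: "M \<in> smats C" "scod M = Ws"
    and i: "i < length (sdom M)" "u < length Vs" "k < length Ws" "Ws ! k = Vs ! u"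
    and P: "\<And>j. j < length Ws \<Longrightarrow> P u j \<longleftrightarrow> j = k"
  shows "entry C (smat_seq C M (smat_unit C Ws Vs P)) u i = entry C M k i"
proof -
  let ?a = "\<lambda>j. cone_mul C (entry C M j i) (entry C (smat_unit C Ws Vs P) u j)"
  have M': "entry C M j i \<in> Cone C (sdom M ! i) (Ws ! j)" if "j < length Ws" for j
    using entry_closed[OF M(1), of i j] M(2) i that by simp
  have X: "Vs ! u \<in> Ob C" using smatsD(2)[OF U] nth_mem[OF i(2)] by auto
  have k: "?a k = entry C M k i"
    using cone_mul_idn(2)[OF M'[OF i(3)]] P[OF i(3)] i by (simp add: entry_unit)
  have "?a j = cone_zero C (sdom M ! i) (Vs ! u)" if "j < length Ws" "j \<noteq> k" for j
    using cone_mul_zero_right[OF M'[OF that(1)] X] P[OF that(1)] that i by (simp add: entry_unit)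
  moreover have "?a k \<in> Cone C (sdom M ! i) (Vs ! u)" unfolding k using M'[OF i(3)] i by simp
  ultimately have "cone_sum C (sdom M ! i) (Vs ! u) (length Ws) ?a = ?a k"
    using cone_sum_single[OF i(3), where a = ?a] by blast
  then show ?thesis using entry_seq[OF M(1) U, of i u] M i k by simp
qed

section \<open>The congruence as entrywise equality in the cones\<close>

definition smat_eq :: "('o, 'a) smat \<Rightarrow> ('o, 'a) smat \<Rightarrow> bool" where
  "smat_eq M N \<longleftrightarrow> M \<in> smats C \<and> N \<in> smats C \<and> sdom M = sdom N \<and> scod M = scod N \<and>
     (\<forall>i<length (sdom M). \<forall>j<length (scod M). entry C M j i = entry C N j i)"

text \<open>Entrywise cone equality contains the generating relation, with witness 1 since the
  weights are at most 1. It respects composition because the entries of a composite are cone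
  expressions in the entries of the factors.\<close>

lemma smat_eq_if_cong: "smat_cong C M N \<Longrightarrow> smat_eq M N"
proof (induction rule: smat_cong.induct)
  case (ident M N)
  then have M: "M \<in> smats C" and N: "N \<in> smats C" and eq: "sdom M = sdom N" "scod M = scod N"
    and sc: "\<And>i j. i < length (sdom M) \<Longrightarrow> j < length (scod M) \<Longrightarrow>
      scale C (wgt M j i) (arw M j i) = scale C (wgt N j i) (arw N j i)"
    by (auto simp: smat_ident_def)
  have "entry C M j i = entry C N j i" if ij: "i < length (sdom M)" "j < length (scod M)" for i j
  proof -
    have "cone_eq C (wgt M j i) (arw M j i) (wgt N j i) (arw N j i)"
      unfolding cone_eq_def using sc[OF ij] smatsD(4)[OF M ij] smatsD(4)[OF N, of i j] eq ij
      by (intro exI[of _ 1]) simp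
    then show ?thesis unfolding entry_def
      using smatsD(3,5)[OF M ij] smatsD(3,5)[OF N, of i j] eq ij
      by (subst cone_eq_iff) auto
  qed
  then show ?case using M N eq by (simp add: smat_eq_def)
next
  case (seq M M' N N')
  then show ?case
    unfolding smat_eq_def
    by (auto simp: smat_seq_closed entry_seq intro!: cone_sum_cong)
qed (auto simp: smat_eq_def)

text \<open>A matrix is the composite of the matrix of its two halves, stacked on top of each other,
  with the codiagonal.  If \<open>M\<close> and \<open>N\<close> agree after scaling by \<open>1 / 2 ^ Suc n\<close>, then their
  halves agree after scaling by \<open>1 / 2 ^ n\<close>.\<close>

lemma smat_cong_if_scaled:
  "\<lbrakk>M \<in> smats C; N \<in> smats C; sdom M = sdom N; scod M = scod N;
    \<And>i j. i < length (sdom M) \<Longrightarrow> j < length (scod M) \<Longrightarrow>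
      scale C (1 / 2 ^ n * wgt M j i) (arw M j i) = scale C (1 / 2 ^ n * wgt N j i) (arw N j i)\<rbrakk> \<Longrightarrow>
   smat_cong C M N"
proof (induction n arbitrary: M N)
  case 0
  then show ?case by (intro smat_cong.ident) (simp add: smat_ident_def)
next
  case (Suc n)
  \<comment> \<open>Folds the row indices of two stacked copies back to those of a single
    copy.\<close>
  define idx where "idx = (\<lambda>Vs::'o list. \<lambda>j. if j < length Vs then j else j - length Vs)"
  define D :: "('o, 'a) smat \<Rightarrow> ('o, 'a) smat" where
    "D = (\<lambda>M. mk_smat (sdom M) (scod M @ scod M)
       (\<lambda>j i. (wgt M (idx (scod M) j) i / 2, arw M (idx (scod M) j) i)))"
  define N0 where "N0 = (\<lambda>Vs. smat_unit C (Vs @ Vs) Vs (\<lambda>j i. i = j \<or> i = length Vs + j))"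
  have idx: "idx Vs j < length Vs" "(Vs @ Vs) ! j = Vs ! idx Vs j" if "j < length (Vs @ Vs)" for Vs j
    using that by (auto simp: idx_def nth_append)
  have D: "D M \<in> smats C" if M: "M \<in> smats C" for M
    unfolding D_def
  proof (rule mk_smat_closed)
    fix i assume i: "i < length (sdom M)"
    have "(\<Sum>j<length (scod M @ scod M). fst (wgt M (idx (scod M) j) i / 2, arw M (idx (scod M) j) i))
        = (\<Sum>j<length (scod M). wgt M j i / 2) + (\<Sum>j<length (scod M). wgt M j i / 2)"
      unfolding sum_lessThan_append by (simp add: idx_def)
    also have "\<dots> \<le> 1" using smatsD(6)[OF M i] by (simp add: sum_divide_distrib[symmetric])
    finally show "(\<Sum>j<length (scod M @ scod M). fst (wgt M (idx (scod M) j) i / 2, arw M (idx (scod M) j) i)) \<le> 1" .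
  next
    fix i j assume "i < length (sdom M)" "j < length (scod M @ scod M)"
    then show "0 \<le> fst (wgt M (idx (scod M) j) i / 2, arw M (idx (scod M) j) i) \<and>
      snd (wgt M (idx (scod M) j) i / 2, arw M (idx (scod M) j) i) \<in> Hom C (sdom M ! i) ((scod M @ scod M) ! j)"
      using smatsD(3,5)[OF M, of i "idx (scod M) j"] idx[of j "scod M"] by simp
  qed (use smatsD(1,2)[OF M] in auto)
  have N0: "N0 Vs \<in> smats C" if "set Vs \<subseteq> Ob C" for Vs
    unfolding N0_def using that by (intro smat_unit_closed) (auto simp: nth_append)
  \<comment> \<open>This has to be an equation of scaled arrows and not only of cone elements, since
    the congruence is still to be derived from cone equality. The two halves of an entry carry the
    same arrow and add up to its weight, so \<open>csum_const\<close> applies.\<close>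
  have ident_D: "smat_ident C (smat_seq C (D M) (N0 (scod M))) M" if M: "M \<in> smats C" for M
  proof -
    let ?S = "smat_seq C (D M) (N0 (scod M))"
    have S: "?S \<in> smats C"
      using smat_seq_closed[OF D[OF M] N0[OF smatsD(2)[OF M]]] by (simp add: D_def N0_def)
    have "scale C (wgt ?S u i) (arw ?S u i) = scale C (wgt M u i) (arw M u i)"
      if iu: "i < length (sdom M)" "u < length (scod M)" for i u
    proof -
      let ?n = "length (scod M @ scod M)" and ?f = "arw M u i" and ?X = "sdom M ! i" and ?Y = "scod M ! u"
      let ?w = "\<lambda>j. wgt (N0 (scod M)) u j * wgt (D M) j i"
      let ?g = "\<lambda>j. Seq C (arw (D M) j i) (arw (N0 (scod M)) u j)"
      define r where "r = (\<Sum>j<?n. ?w j)"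
      have f: "?f \<in> Hom C ?X ?Y" using smatsD(5)[OF M iu] .
      have DN: "scod (D M) = sdom (N0 (scod M))" "sdom (D M) = sdom M" "scod (N0 (scod M)) = scod M" "scod (D M) = scod M @ scod M"
        by (auto simp: D_def N0_def)
      have w0: "?w j = (if j = u \<or> j = length (scod M) + u then wgt M u i / 2 else 0)" if "j < ?n" for j
        using that iu by (auto simp: N0_def D_def smat_unit_def idx_def)
      have "r = (\<Sum>j<?n. if j = u \<or> j = length (scod M) + u then wgt M u i / 2 else 0)"
        unfolding r_def by (rule sum.cong) (use w0 in auto)
      also have "\<dots> = wgt M u i"
        unfolding sum_lessThan_append using iu by (simp add: sum.delta)
      finally have r: "r = wgt M u i" .
      have S1: "wgt ?S u i = r" "arw ?S u i = csum C ?X ?Y ?n (\<lambda>j. ?w j / r) ?g"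
        using iu DN by (simp_all add: smat_seq_def Let_def r_def)
      have cl: "arw ?S u i \<in> Hom C ?X ?Y"
        using smatsD(5)[OF S, of i u] iu DN by simp
      show ?thesis
      proof (cases "r = 0")
        case True
        then show ?thesis using S1 r scale_0[OF cl] scale_0[OF f] by simp
      next
        case False
        note sw = seq_weights[OF D[OF M] N0[OF smatsD(2)[OF M]] DN(1), unfolded DN(2-4), OF iu(1)]
        have "csum C ?X ?Y ?n (\<lambda>j. ?w j / r) ?g = scale C (\<Sum>j<?n. ?w j / r) ?f"
        proof (rule csum_const[OF f])
          show "?g j = ?f" if j: "j < ?n" "?w j / r \<noteq> 0" for j
          proof -
            have "j = u \<or> j = length (scod M) + u" using w0[OF j(1)] j(2) by (auto split: if_splits)
            then have "arw (D M) j i = ?f" "arw (N0 (scod M)) u j = Idn C ?Y"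
              using iu by (auto simp: D_def N0_def smat_unit_def idx_def nth_append)
            then show ?thesis using seq_idn_right[OF f] by simp
          qed
          show "?g j \<in> Hom C ?X ?Y" if "j < ?n" for j
            using seq_arrows[OF D[OF M] N0[OF smatsD(2)[OF M]] DN(1), unfolded DN(2-4), OF iu that] .
          show "0 \<le> ?w j / r" if "j < ?n" for j using sw(4)[OF iu(2) that] unfolding r_def .
          show "(\<Sum>j<?n. ?w j / r) \<le> 1" using sw(5)[OF iu(2)] unfolding r_def .
        qed
        also have "(\<Sum>j<?n. ?w j / r) = 1"
          using False by (simp only: sum_divide_distrib[symmetric] r_def[symmetric]) simp
        finally show ?thesis using S1 r by (simp add: scale_1)
      qed
    qed
    then show ?thesis using M S by (simp add: smat_ident_def) (simp add: D_def N0_def)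
  qed
  \<comment> \<open>The weights of the split matrices carry a factor 1/2, so the assumption for
    \<open>Suc n\<close> on \<open>M\<close> and \<open>N\<close> is the one for \<open>n\<close> on
    their splittings.\<close>
  have "smat_cong C (D M) (D N)"
  proof (rule Suc.IH[OF D[OF Suc.prems(1)] D[OF Suc.prems(2)]])
    fix i j assume "i < length (sdom (D M))" "j < length (scod (D M))"
    then have ij: "i < length (sdom M)" "j < length (scod M @ scod M)" by (auto simp: D_def)
    show "scale C (1 / 2 ^ n * wgt (D M) j i) (arw (D M) j i) = scale C (1 / 2 ^ n * wgt (D N) j i) (arw (D N) j i)"
      using Suc.prems(5)[OF ij(1) idx(1)[OF ij(2)]] ij Suc.prems(3,4) by (simp add: D_def mult.commute)
  qed (simp_all add: D_def Suc.prems(3,4))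
  moreover have "smat_cong C (N0 (scod M)) (N0 (scod N))"
    using N0[OF smatsD(2)[OF Suc.prems(2)]] Suc.prems(4) by (auto intro!: smat_cong.ident simp: smat_ident_def)
  ultimately have "smat_cong C (smat_seq C (D M) (N0 (scod M))) (smat_seq C (D N) (N0 (scod N)))"
    by (rule smat_cong.seq) (simp add: D_def N0_def)
  moreover note smat_cong.ident[OF ident_D[OF Suc.prems(1)]] smat_cong.ident[OF ident_D[OF Suc.prems(2)]]
  ultimately show ?case by (meson smat_cong.sym smat_cong.trans)
qed

text \<open>Each pair of equal cone entries has a witness s > 0, and every power 1 / 2 ^ n below s
  is again a witness. There are finitely many entries, so one n serves all of them and
  \<open>smat_cong_if_scaled\<close> applies.\<close>

lemma smat_cong_iff: "smat_cong C M N \<longleftrightarrow> smat_eq M N"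
proof
  assume "smat_eq M N"
  then have M: "M \<in> smats C" and N: "N \<in> smats C" and eq: "sdom M = sdom N" "scod M = scod N"
    and ent: "\<And>i j. i < length (sdom M) \<Longrightarrow> j < length (scod M) \<Longrightarrow> entry C M j i = entry C N j i"
    by (auto simp: smat_eq_def)
  let ?Q = "\<lambda>n i j. scale C (1 / 2 ^ n * wgt M j i) (arw M j i) = scale C (1 / 2 ^ n * wgt N j i) (arw N j i)"
  have "eventually (\<lambda>n. ?Q n i j) sequentially" if ij: "i < length (sdom M)" "j < length (scod M)" for i j
  proof -
    have H: "arw M j i \<in> Hom C (sdom M ! i) (scod M ! j)" "arw N j i \<in> Hom C (sdom M ! i) (scod M ! j)"
      "0 \<le> wgt M j i" "0 \<le> wgt N j i"
      using smatsD(3,5)[OF M ij] smatsD(3,5)[OF N, of i j] eq ij by auto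
    obtain s where s: "0 < s" "s * wgt M j i \<le> 1" "s * wgt N j i \<le> 1"
      "scale C (s * wgt M j i) (arw M j i) = scale C (s * wgt N j i) (arw N j i)"
      using ent[OF ij] cone_eq_iff[OF H] unfolding entry_def cone_eq_def by blast
    obtain n0 where n0: "(1 / 2) ^ n0 < s" using real_arch_pow_inv[OF s(1), of "1/2"] by auto
    have "?Q n i j" if "n0 \<le> n" for n
    proof -
      have "(1 / 2 :: real) ^ n \<le> (1 / 2) ^ n0" using that by (intro power_decreasing) auto
      then have "1 / 2 ^ n \<le> s" using n0 by (simp add: power_one_over)
      then show ?thesis using cone_eq_smaller[OF H s, of "1 / 2 ^ n"] by simp
    qed
    then show ?thesis by (auto simp: eventually_sequentially)
  qed
  then have "eventually (\<lambda>n. \<forall>i\<in>{..<length (sdom M)}. \<forall>j\<in>{..<length (scod M)}. ?Q n i j) sequentially"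
    by (intro eventually_ball_finite ballI) auto
  then obtain n where "\<forall>i\<in>{..<length (sdom M)}. \<forall>j\<in>{..<length (scod M)}. ?Q n i j"
    unfolding eventually_sequentially by blast
  then show "smat_cong C M N" using smat_cong_if_scaled[OF M N eq, of n] by simp
qed (rule smat_eq_if_cong)

lemma smat_class_eqI:
  assumes "M \<in> smats C" "N \<in> smats C" "sdom M = sdom N" "scod M = scod N"
    "\<And>i j. \<lbrakk>i < length (sdom M); j < length (scod M)\<rbrakk> \<Longrightarrow> entry C M j i = entry C N j i"
  shows "smat_class C M = smat_class C N"
proof -
  have "smat_cong C M N" using assms by (simp add: smat_cong_iff smat_eq_def)
  then show ?thesis unfolding smat_class_def by (auto intro: smat_cong.sym smat_cong.trans)
qed

lemma in_smat_class: "N \<in> smat_class C M \<longleftrightarrow> smat_eq M N"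
  by (simp add: smat_class_def smat_cong_iff)

lemma smat_class_refl: "M \<in> smats C \<Longrightarrow> M \<in> smat_class C M"
  by (simp add: in_smat_class smat_eq_def)

lemma smat_class_eqD:
  assumes "smat_class C M = smat_class C N" "N \<in> smats C"
  shows "sdom M = sdom N" "scod M = scod N"
    "\<lbrakk>i < length (sdom M); j < length (scod M)\<rbrakk> \<Longrightarrow> entry C M j i = entry C N j i"
proof -
  have "smat_eq M N" using smat_class_refl[OF assms(2)] unfolding assms(1)[symmetric] in_smat_class .
  then show "sdom M = sdom N" "scod M = scod N"
    "\<lbrakk>i < length (sdom M); j < length (scod M)\<rbrakk> \<Longrightarrow> entry C M j i = entry C N j i"
    by (simp_all add: smat_eq_def)
qed

end


section \<open>The category of stochastic matrices\<close>

lemma Stmat_simps [simp]: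
  "Ob (Stmat C) = lists (Ob C)"
  "Ar (Stmat C) = smat_class C ` smats C"
  "Idn (Stmat C) Us = smat_class C (smat_unit C Us Us (\<lambda>j i. j = i))"
  "Star (Stmat C) Us Vs = smat_class C (smat_unit C Us Vs (\<lambda>j i. False))"
  "Zero (Stmat C) = []"
  "Oplus (Stmat C) Us Vs = Us @ Vs"
  "Inj1 (Stmat C) Us Vs = smat_class C (smat_unit C Us (Us @ Vs) (\<lambda>j i. j = i))"
  "Inj2 (Stmat C) Us Vs = smat_class C (smat_unit C Vs (Us @ Vs) (\<lambda>j i. j = length Us + i))"
  "Proj1 (Stmat C) Us Vs = smat_class C (smat_unit C (Us @ Vs) Us (\<lambda>j i. i = j))"
  "Proj2 (Stmat C) Us Vs = smat_class C (smat_unit C (Us @ Vs) Vs (\<lambda>j i. i = length Us + j))"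
  by (simp_all add: Stmat_def)

text \<open>The mediating arrow into a convex product; p and q are the weights of the
  pairing.\<close>

definition smat_stack :: "real \<Rightarrow> real \<Rightarrow> ('o, 'a) smat \<Rightarrow> ('o, 'a) smat \<Rightarrow> ('o, 'a) smat" where
  "smat_stack p q M N = mk_smat (sdom M) (scod M @ scod N) (\<lambda>j i.
     if j < length (scod M) then (p * wgt M j i, arw M j i)
     else (q * wgt N (j - length (scod M)) i, arw N (j - length (scod M)) i))"

text \<open>The mediating arrow out of a coproduct.\<close>

definition smat_row :: "('o, 'a) smat \<Rightarrow> ('o, 'a) smat \<Rightarrow> ('o, 'a) smat" where
  "smat_row M N = mk_smat (sdom M @ sdom N) (scod M) (\<lambda>j i.
     if i < length (sdom M) then (wgt M j i, arw M j i)
     else (wgt N j (i - length (sdom M)), arw N j (i - length (sdom M))))"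

lemma smat_stack_simps [simp]: "sdom (smat_stack p q M N) = sdom M" "scod (smat_stack p q M N) = scod M @ scod N"
  by (simp_all add: smat_stack_def)

lemma smat_row_simps [simp]: "sdom (smat_row M N) = sdom M @ sdom N" "scod (smat_row M N) = scod M"
  by (simp_all add: smat_row_def)

context pca_category
begin

section \<open>Operations on classes of matrices\<close>

lemma Src_Tgt_class: "M \<in> smats C \<Longrightarrow> Src (Stmat C) (smat_class C M) = sdom M \<and> Tgt (Stmat C) (smat_class C M) = scod M"
proof -
  assume M: "M \<in> smats C"
  have "sdom ` smat_class C M = {sdom M}" "scod ` smat_class C M = {scod M}"
    using smat_class_refl[OF M] by (auto simp: in_smat_class smat_eq_def image_iff)
  then show ?thesis by (simp add: Stmat_def)
qed

lemma Stmat_HomI: "\<lbrakk>M \<in> smats C; sdom M = Us; scod M = Vs\<rbrakk> \<Longrightarrow> smat_class C M \<in> Hom (Stmat C) Us Vs"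
  using Src_Tgt_class by (simp add: Hom_def)

lemma Stmat_HomE:
  assumes "A \<in> Hom (Stmat C) Us Vs"
  obtains M where "M \<in> smats C" "sdom M = Us" "scod M = Vs" "A = smat_class C M"
  using assms Src_Tgt_class by (auto simp: Hom_def)

text \<open>The union over all representatives collapses: their composites have the same cone
  entries and hence the same class.\<close>

lemma Seq_class:
  assumes "M \<in> smats C" "N \<in> smats C" "scod M = sdom N"
  shows "Seq (Stmat C) (smat_class C M) (smat_class C N) = smat_class C (smat_seq C M N)"
proof -
  have *: "smat_class C (smat_seq C M' N') = smat_class C (smat_seq C M N)"
    if "M' \<in> smat_class C M" "N' \<in> smat_class C N" for M' N'
  proof -
    have M': "M' \<in> smats C" "sdom M' = sdom M" "scod M' = scod M"
      "\<And>i j. i < length (sdom M) \<Longrightarrow> j < length (scod M) \<Longrightarrow> entry C M' j i = entry C M j i"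
      using that(1) by (auto simp: in_smat_class smat_eq_def)
    have N': "N' \<in> smats C" "sdom N' = sdom N" "scod N' = scod N"
      "\<And>i j. i < length (sdom N) \<Longrightarrow> j < length (scod N) \<Longrightarrow> entry C N' j i = entry C N j i"
      using that(2) by (auto simp: in_smat_class smat_eq_def)
    have e: "scod M' = sdom N'" using assms M' N' by simp
    show ?thesis
    proof (rule smat_class_eqI[OF smat_seq_closed[OF M'(1) N'(1) e] smat_seq_closed[OF assms]])
      fix i u assume "i < length (sdom (smat_seq C M' N'))" "u < length (scod (smat_seq C M' N'))"
      then show "entry C (smat_seq C M' N') u i = entry C (smat_seq C M N) u i"
        using entry_seq[OF M'(1) N'(1) e, of i u] entry_seq[OF assms, of i u] M' N' assms(3)
        by (auto intro!: cone_sum_cong)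
    qed (simp_all add: M' N')
  qed
  have "Seq (Stmat C) (smat_class C M) (smat_class C N)
      = (\<Union>M'\<in>smat_class C M. \<Union>N'\<in>smat_class C N. smat_class C (smat_seq C M' N'))"
    by (simp add: Stmat_def)
  also have "\<dots> = (\<Union>M'\<in>smat_class C M. \<Union>N'\<in>smat_class C N. smat_class C (smat_seq C M N))"
    using * by (intro SUP_cong refl)
  also have "\<dots> = smat_class C (smat_seq C M N)"
    using smat_class_refl[OF assms(1)] smat_class_refl[OF assms(2)] by blast
  finally show ?thesis .
qed

lemma Plus_class:
  assumes "M \<in> smats C" "N \<in> smats C" "sdom M = sdom N" "scod M = scod N" "0 \<le> q" "q \<le> 1"
  shows "Plus (Stmat C) q (smat_class C M) (smat_class C N) = smat_class C (smat_plus C q M N)"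
proof -
  have *: "smat_class C (smat_plus C q M' N') = smat_class C (smat_plus C q M N)"
    if "M' \<in> smat_class C M" "N' \<in> smat_class C N" for M' N'
  proof -
    have M': "M' \<in> smats C" "sdom M' = sdom M" "scod M' = scod M"
      "\<And>i j. i < length (sdom M) \<Longrightarrow> j < length (scod M) \<Longrightarrow> entry C M' j i = entry C M j i"
      using that(1) by (auto simp: in_smat_class smat_eq_def)
    have N': "N' \<in> smats C" "sdom N' = sdom N" "scod N' = scod N"
      "\<And>i j. i < length (sdom N) \<Longrightarrow> j < length (scod N) \<Longrightarrow> entry C N' j i = entry C N j i"
      using that(2) by (auto simp: in_smat_class smat_eq_def)
    have e: "sdom M' = sdom N'" "scod M' = scod N'" using assms M' N' by simp_all
    show ?thesis
    proof (rule smat_class_eqI[OF smat_plus_closed[OF M'(1) N'(1) e assms(5,6)] smat_plus_closed[OF assms]])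
      fix i j assume "i < length (sdom (smat_plus C q M' N'))" "j < length (scod (smat_plus C q M' N'))"
      then show "entry C (smat_plus C q M' N') j i = entry C (smat_plus C q M N) j i"
        using entry_plus[OF M'(1) N'(1) e assms(5,6), of i j] entry_plus[OF assms, of i j] M' N' assms(3,4)
        by simp
    qed (simp_all add: M' N')
  qed
  have "Plus (Stmat C) q (smat_class C M) (smat_class C N)
      = (\<Union>M'\<in>smat_class C M. \<Union>N'\<in>smat_class C N. smat_class C (smat_plus C q M' N'))"
    by (simp add: Stmat_def)
  also have "\<dots> = (\<Union>M'\<in>smat_class C M. \<Union>N'\<in>smat_class C N. smat_class C (smat_plus C q M N))"
    using * by (intro SUP_cong refl)
  also have "\<dots> = smat_class C (smat_plus C q M N)"
    using smat_class_refl[OF assms(1)] smat_class_refl[OF assms(2)] by blast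
  finally show ?thesis .
qed

lemma smat_stack_closed:
  assumes M: "M \<in> smats C" and N: "N \<in> smats C" and MN: "sdom M = sdom N"
    and pq: "0 \<le> p" "0 \<le> q" "p + q \<le> 1"
  shows "smat_stack p q M N \<in> smats C"
  unfolding smat_stack_def
proof (rule mk_smat_closed)
  let ?e = "\<lambda>j i. if j < length (scod M) then (p * wgt M j i, arw M j i)
     else (q * wgt N (j - length (scod M)) i, arw N (j - length (scod M)) i)"
  fix i assume i: "i < length (sdom M)"
  have "(\<Sum>j<length (scod M @ scod N). fst (?e j i)) = p * (\<Sum>j<length (scod M). wgt M j i) + q * (\<Sum>j<length (scod N). wgt N j i)"
    unfolding sum_lessThan_append by (simp add: sum_distrib_left)
  also have "\<dots> \<le> p * 1 + q * 1"
    using smatsD(6)[OF M i] smatsD(6)[OF N, of i] i MN pq by (intro add_mono mult_left_mono) auto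
  finally show "(\<Sum>j<length (scod M @ scod N). fst (?e j i)) \<le> 1" using pq by simp
  fix i j assume "i < length (sdom M)" "j < length (scod M @ scod N)"
  then show "0 \<le> fst (?e j i) \<and> snd (?e j i) \<in> Hom C (sdom M ! i) ((scod M @ scod N) ! j)"
    using smatsD(3,5)[OF M, of i j] smatsD(3,5)[OF N, of i "j - length (scod M)"] MN pq
    by (auto simp: nth_append)
qed (use smatsD(1,2)[OF M] smatsD(1,2)[OF N] in auto)

lemma entry_stack:
  assumes M: "M \<in> smats C" and N: "N \<in> smats C" and MN: "sdom M = sdom N" and pq: "0 \<le> p" "0 \<le> q"
    and ij: "i < length (sdom M)" "j < length (scod M @ scod N)"
  shows "entry C (smat_stack p q M N) j i =
    (if j < length (scod M) then cone_scale C p (entry C M j i)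
     else cone_scale C q (entry C N (j - length (scod M)) i))"
proof (cases "j < length (scod M)")
  case True
  then show ?thesis
    using cone_scale_cone[OF smatsD(5)[OF M ij(1) True] smatsD(3)[OF M ij(1) True] pq(1)] ij
    by (simp add: smat_stack_def) (simp add: entry_def)
next
  case False
  then have "i < length (sdom N)" "j - length (scod M) < length (scod N)" using ij MN by auto
  then show ?thesis
    using cone_scale_cone[OF smatsD(5)[OF N] smatsD(3)[OF N] pq(2)] ij False
    by (simp add: smat_stack_def) (simp add: entry_def)
qed

lemma smat_row_closed:
  assumes M: "M \<in> smats C" and N: "N \<in> smats C" and MN: "scod M = scod N"
  shows "smat_row M N \<in> smats C"
  unfolding smat_row_def
proof (rule mk_smat_closed)
  let ?e = "\<lambda>j i. if i < length (sdom M) then (wgt M j i, arw M j i)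
     else (wgt N j (i - length (sdom M)), arw N j (i - length (sdom M)))"
  fix i assume i: "i < length (sdom M @ sdom N)"
  then show "(\<Sum>j<length (scod M). fst (?e j i)) \<le> 1"
    using smatsD(6)[OF M, of i] smatsD(6)[OF N, of "i - length (sdom M)"] MN
    by (cases "i < length (sdom M)") auto
  fix j assume "j < length (scod M)"
  then show "0 \<le> fst (?e j i) \<and> snd (?e j i) \<in> Hom C ((sdom M @ sdom N) ! i) (scod M ! j)"
    using smatsD(3,5)[OF M, of i j] smatsD(3,5)[OF N, of "i - length (sdom M)" j] MN i
    by (auto simp: nth_append)
qed (use smatsD(1,2)[OF M] smatsD(1,2)[OF N] in auto)

lemma entry_row:
  "\<lbrakk>i < length (sdom M @ sdom N); j < length (scod M)\<rbrakk> \<Longrightarrow> entry C (smat_row M N) j i =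
    (if i < length (sdom M) then entry C M j i else entry C N j (i - length (sdom M)))"
  by (simp add: smat_row_def) (simp add: entry_def)

lemma Idn_smats: "set Us \<subseteq> Ob C \<Longrightarrow> smat_unit C Us Us (\<lambda>j i. j = i) \<in> smats C"
  and Star_smats: "\<lbrakk>set Us \<subseteq> Ob C; set Vs \<subseteq> Ob C\<rbrakk> \<Longrightarrow> smat_unit C Us Vs (\<lambda>j i. False) \<in> smats C"
  and Inj1_smats: "\<lbrakk>set Us \<subseteq> Ob C; set Vs \<subseteq> Ob C\<rbrakk> \<Longrightarrow> smat_unit C Us (Us @ Vs) (\<lambda>j i. j = i) \<in> smats C"
  and Inj2_smats: "\<lbrakk>set Us \<subseteq> Ob C; set Vs \<subseteq> Ob C\<rbrakk> \<Longrightarrow> smat_unit C Vs (Us @ Vs) (\<lambda>j i. j = length Us + i) \<in> smats C"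
  and Proj1_smats: "\<lbrakk>set Us \<subseteq> Ob C; set Vs \<subseteq> Ob C\<rbrakk> \<Longrightarrow> smat_unit C (Us @ Vs) Us (\<lambda>j i. i = j) \<in> smats C"
  and Proj2_smats: "\<lbrakk>set Us \<subseteq> Ob C; set Vs \<subseteq> Ob C\<rbrakk> \<Longrightarrow> smat_unit C (Us @ Vs) Vs (\<lambda>j i. i = length Us + j) \<in> smats C"
  by (auto intro!: smat_unit_closed simp: nth_append)

text \<open>Associativity of matrix multiplication for one entry: distribute on both sides and
  exchange the two sums. The intermediate objects vary with the indices.\<close>

lemma cone_sum_assoc:
  assumes a: "\<And>j. j < m \<Longrightarrow> a j \<in> Cone C W (X j)"
    and b: "\<And>j k. j < m \<Longrightarrow> k < n \<Longrightarrow> b k j \<in> Cone C (X j) (Y k)"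
    and c: "\<And>k. k < n \<Longrightarrow> c k \<in> Cone C (Y k) Z"
    and WZ: "W \<in> Ob C" "Z \<in> Ob C"
  shows "cone_sum C W Z n (\<lambda>k. cone_mul C (cone_sum C W (Y k) m (\<lambda>j. cone_mul C (a j) (b k j))) (c k))
    = cone_sum C W Z m (\<lambda>j. cone_mul C (a j) (cone_sum C (X j) Z n (\<lambda>k. cone_mul C (b k j) (c k))))"
proof -
  have "cone_sum C W Z n (\<lambda>k. cone_mul C (cone_sum C W (Y k) m (\<lambda>j. cone_mul C (a j) (b k j))) (c k))
      = cone_sum C W Z n (\<lambda>k. cone_sum C W Z m (\<lambda>j. cone_mul C (a j) (cone_mul C (b k j) (c k))))"
  proof (rule cone_sum_cong)
    fix k assume k: "k < n"
    have "cone_mul C (cone_sum C W (Y k) m (\<lambda>j. cone_mul C (a j) (b k j))) (c k)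
        = cone_sum C W Z m (\<lambda>j. cone_mul C (cone_mul C (a j) (b k j)) (c k))"
      using cone_mul_closed[OF a b] k by (intro cone_sum_mul_right[OF c[OF k] WZ(1)]) auto
    also have "\<dots> = cone_sum C W Z m (\<lambda>j. cone_mul C (a j) (cone_mul C (b k j) (c k)))"
      using cone_mul_assoc[OF a b c] k by (intro cone_sum_cong) auto
    finally show "cone_mul C (cone_sum C W (Y k) m (\<lambda>j. cone_mul C (a j) (b k j))) (c k)
      = cone_sum C W Z m (\<lambda>j. cone_mul C (a j) (cone_mul C (b k j) (c k)))" .
  qed
  also have "\<dots> = cone_sum C W Z m (\<lambda>j. cone_sum C W Z n (\<lambda>k. cone_mul C (a j) (cone_mul C (b k j) (c k))))"
    using cone_mul_closed[OF a cone_mul_closed[OF b c]] by (intro cone_sum_swap WZ) auto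
  also have "\<dots> = cone_sum C W Z m (\<lambda>j. cone_mul C (a j) (cone_sum C (X j) Z n (\<lambda>k. cone_mul C (b k j) (c k))))"
  proof (rule cone_sum_cong)
    fix j assume j: "j < m"
    show "cone_sum C W Z n (\<lambda>k. cone_mul C (a j) (cone_mul C (b k j) (c k)))
      = cone_mul C (a j) (cone_sum C (X j) Z n (\<lambda>k. cone_mul C (b k j) (c k)))"
      using cone_mul_closed[OF b c] j by (intro cone_sum_mul_left[OF a[OF j] WZ(2), symmetric]) auto
  qed
  finally show ?thesis .
qed

text \<open>An equivalence, because one direction verifies the triangles of a universal property and
  the other reads off the entries of any arrow that satisfies them, which gives uniqueness. Here
  \<open>\<phi>\<close> takes a column to the row of its identity.\<close>

lemma unit_seq_eq_iff:
  assumes U: "smat_unit C Us Ws P \<in> smats C" and N: "N \<in> smats C" "sdom N = Ws"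
    and K: "K \<in> smats C" "sdom K = Us" "scod K = scod N"
    and \<phi>: "\<And>i. i < length Us \<Longrightarrow> \<phi> i < length Ws \<and> Us ! i = Ws ! \<phi> i"
    and P: "\<And>i j. i < length Us \<Longrightarrow> j < length Ws \<Longrightarrow> P j i \<longleftrightarrow> j = \<phi> i"
  shows "Seq (Stmat C) (smat_class C (smat_unit C Us Ws P)) (smat_class C N) = smat_class C K \<longleftrightarrow>
    (\<forall>i<length Us. \<forall>u<length (scod N). entry C N u (\<phi> i) = entry C K u i)"
proof -
  let ?S = "smat_seq C (smat_unit C Us Ws P) N"
  have S: "?S \<in> smats C" using smat_seq_closed[OF U N(1)] N by simp
  have e: "entry C ?S u i = entry C N u (\<phi> i)" if "i < length Us" "u < length (scod N)" for i u
    using entry_unit_seq[OF U N, of i u "\<phi> i"] \<phi>[of i] P[of i] that by simp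
  have "Seq (Stmat C) (smat_class C (smat_unit C Us Ws P)) (smat_class C N) = smat_class C ?S"
    using Seq_class[OF U N(1)] N by simp
  then show ?thesis
    using smat_class_eqI[OF S K(1)] smat_class_eqD(3)[of ?S K] K N e by auto
qed

text \<open>The counterpart for projections: \<open>\<psi>\<close> takes a row to the column of its
  identity, and the composite selects rows of \<open>M\<close>.\<close>

lemma seq_unit_eq_iff:
  assumes U: "smat_unit C Ws Vs P \<in> smats C" and M: "M \<in> smats C" "scod M = Ws"
    and K: "K \<in> smats C" "sdom K = sdom M" "scod K = Vs"
    and \<psi>: "\<And>u. u < length Vs \<Longrightarrow> \<psi> u < length Ws \<and> Ws ! \<psi> u = Vs ! u"
    and P: "\<And>u j. u < length Vs \<Longrightarrow> j < length Ws \<Longrightarrow> P u j \<longleftrightarrow> j = \<psi> u"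
  shows "Seq (Stmat C) (smat_class C M) (smat_class C (smat_unit C Ws Vs P)) = smat_class C K \<longleftrightarrow>
    (\<forall>i<length (sdom M). \<forall>u<length Vs. entry C M (\<psi> u) i = entry C K u i)"
proof -
  let ?S = "smat_seq C M (smat_unit C Ws Vs P)"
  have S: "?S \<in> smats C" using smat_seq_closed[OF M(1) U] M by simp
  have e: "entry C ?S u i = entry C M (\<psi> u) i" if "i < length (sdom M)" "u < length Vs" for i u
    using entry_seq_unit[OF U M, of i u "\<psi> u"] \<psi>[of u] P[of u] that by simp
  have "Seq (Stmat C) (smat_class C M) (smat_class C (smat_unit C Ws Vs P)) = smat_class C ?S"
    using Seq_class[OF M(1) U] M by simp
  then show ?thesis
    using smat_class_eqI[OF S K(1)] smat_class_eqD(3)[of ?S K] K M e by auto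
qed

lemma smat_class_unit_unit:
  assumes U: "smat_unit C Us Vs P \<in> smats C" "smat_unit C Vs Ws Q \<in> smats C" "smat_unit C Us Ws R \<in> smats C"
    and \<phi>: "\<And>i. i < length Us \<Longrightarrow> \<phi> i < length Vs \<and> Us ! i = Vs ! \<phi> i"
    and P: "\<And>i j. i < length Us \<Longrightarrow> j < length Vs \<Longrightarrow> P j i \<longleftrightarrow> j = \<phi> i"
    and R: "\<And>i u. i < length Us \<Longrightarrow> u < length Ws \<Longrightarrow> R u i \<longleftrightarrow> Q u (\<phi> i)"
  shows "Seq (Stmat C) (smat_class C (smat_unit C Us Vs P)) (smat_class C (smat_unit C Vs Ws Q))
    = smat_class C (smat_unit C Us Ws R)"
  using \<phi> R by (subst unit_seq_eq_iff[OF U(1,2) _ U(3), where \<phi> = \<phi>]) (auto simp: entry_unit P)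

lemma smat_class_unit_eq:
  assumes "smat_unit C Us Vs P \<in> smats C" "smat_unit C Us Vs Q \<in> smats C"
    "\<And>i j. i < length Us \<Longrightarrow> j < length Vs \<Longrightarrow> P j i = Q j i"
  shows "smat_class C (smat_unit C Us Vs P) = smat_class C (smat_unit C Us Vs Q)"
  using assms by (intro smat_class_eqI) (auto simp: entry_unit)

text \<open>The skewed associativity law of a pca becomes plain associativity of addition once the
  scalars are multiplied out: r is such that the coefficients on both sides are p * q, p * (1 - q)
  and 1 - p.\<close>

lemma cone_plus_assoc:
  assumes "a \<in> Cone C X Y" "b \<in> Cone C X Y" "c \<in> Cone C X Y"
    and pq: "0 < p" "p < 1" "0 < q" "q < 1"
  defines "r \<equiv> p * (1 - q) / (1 - p * q)"
  shows "cone_add C (cone_scale C p (cone_add C (cone_scale C q a) (cone_scale C (1 - q) b))) (cone_scale C (1 - p) c)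
    = cone_add C (cone_scale C (p * q) a) (cone_scale C (1 - p * q) (cone_add C (cone_scale C r b) (cone_scale C (1 - r) c)))"
proof -
  note pq1 = assoc_weights(2)[OF pq] and r = assoc_weights(3,4)[OF pq, folded r_def]
  have e: "(1 - p * q) * r = p * (1 - q)" using pq1 by (simp add: r_def)
  then have e2: "(1 - p * q) * (1 - r) = 1 - p" by (simp add: right_diff_distrib)
  have cl: "cone_scale C q a \<in> Cone C X Y" "cone_scale C (1 - q) b \<in> Cone C X Y"
    "cone_scale C r b \<in> Cone C X Y" "cone_scale C (1 - r) c \<in> Cone C X Y"
    "cone_scale C (p * q) a \<in> Cone C X Y" "cone_scale C (p * (1 - q)) b \<in> Cone C X Y" "cone_scale C (1 - p) c \<in> Cone C X Y"
    using assms r by (auto intro: cone_scale_closed)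
  have "cone_scale C p (cone_add C (cone_scale C q a) (cone_scale C (1 - q) b))
     = cone_add C (cone_scale C (p * q) a) (cone_scale C (p * (1 - q)) b)"
    using cone_scale_add[OF cl(1,2), of p] cone_scale_scale[OF assms(1), of p q] cone_scale_scale[OF assms(2), of p "1 - q"] pq
    by simp
  moreover have "cone_scale C (1 - p * q) (cone_add C (cone_scale C r b) (cone_scale C (1 - r) c))
     = cone_add C (cone_scale C (p * (1 - q)) b) (cone_scale C (1 - p) c)"
    using cone_scale_add[OF cl(3,4), of "1 - p * q"] cone_scale_scale[OF assms(2), of "1 - p * q" r]
      cone_scale_scale[OF assms(3), of "1 - p * q" "1 - r"] pq1 r e e2
    by simp
  ultimately show "cone_add C (cone_scale C p (cone_add C (cone_scale C q a) (cone_scale C (1 - q) b))) (cone_scale C (1 - p) c)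
    = cone_add C (cone_scale C (p * q) a) (cone_scale C (1 - p * q) (cone_add C (cone_scale C r b) (cone_scale C (1 - r) c)))"
    using cone_add_assoc[OF cl(5-7)] by simp
qed

section \<open>The laws of a PCA-enriched category\<close>

lemma Stmat_pca:
  assumes "Us \<in> Ob (Stmat C)" "Vs \<in> Ob (Stmat C)"
  shows "pca (Hom (Stmat C) Us Vs) (Star (Stmat C) Us Vs) (Plus (Stmat C))"
proof
  show "Star (Stmat C) Us Vs \<in> Hom (Stmat C) Us Vs"
    unfolding Stmat_simps using assms by (intro Stmat_HomI Star_smats) (auto simp: in_lists_conv_set)
next
  fix p :: real and A B assume "0 < p" "p < 1" "A \<in> Hom (Stmat C) Us Vs" "B \<in> Hom (Stmat C) Us Vs"
  then show "Plus (Stmat C) p A B \<in> Hom (Stmat C) Us Vs"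
    by (elim Stmat_HomE) (auto simp: Plus_class intro!: Stmat_HomI smat_plus_closed)
next
  fix p q :: real and A1 A2 A3
  assume pq: "0 < p" "p < 1" "0 < q" "q < 1"
    and "A1 \<in> Hom (Stmat C) Us Vs" "A2 \<in> Hom (Stmat C) Us Vs" "A3 \<in> Hom (Stmat C) Us Vs"
  then obtain L M N where L: "L \<in> smats C" "sdom L = Us" "scod L = Vs" "A1 = smat_class C L"
    and M: "M \<in> smats C" "sdom M = Us" "scod M = Vs" "A2 = smat_class C M"
    and N: "N \<in> smats C" "sdom N = Us" "scod N = Vs" "A3 = smat_class C N"
    by (elim Stmat_HomE)
  let ?r = "p * (1 - q) / (1 - p * q)"
  note r = assoc_weights[OF pq]
  have cl: "smat_plus C q L M \<in> smats C" "smat_plus C ?r M N \<in> smats C"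
    using L M N pq r by (auto intro!: smat_plus_closed simp del: times_divide_eq_left times_divide_eq_right)
  have "smat_class C (smat_plus C p (smat_plus C q L M) N) = smat_class C (smat_plus C (p * q) L (smat_plus C ?r M N))"
  proof (rule smat_class_eqI)
    fix i j assume "i < length (sdom (smat_plus C p (smat_plus C q L M) N))" "j < length (scod (smat_plus C p (smat_plus C q L M) N))"
    then have ij: "i < length Us" "j < length Vs" using L by auto
    have c: "entry C L j i \<in> Cone C (Us ! i) (Vs ! j)" "entry C M j i \<in> Cone C (Us ! i) (Vs ! j)" "entry C N j i \<in> Cone C (Us ! i) (Vs ! j)"
      using entry_closed[OF L(1)] entry_closed[OF M(1)] entry_closed[OF N(1)] L M N ij by auto
    show "entry C (smat_plus C p (smat_plus C q L M) N) j i = entry C (smat_plus C (p * q) L (smat_plus C ?r M N)) j i"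
      using entry_plus[OF cl(1) N(1), of p i j] entry_plus[OF L(1) M(1), of q i j]
        entry_plus[OF L(1) cl(2), of "p * q" i j] entry_plus[OF M(1) N(1), of ?r i j]
        cone_plus_assoc[OF c pq] L M N ij pq r by simp
  qed (use L M N pq r cl in \<open>auto intro!: smat_plus_closed\<close>)
  then show "Plus (Stmat C) p (Plus (Stmat C) q A1 A2) A3
      = Plus (Stmat C) (p * q) A1 (Plus (Stmat C) ?r A2 A3)"
    using L M N pq r cl by (simp add: Plus_class)
next
  fix p :: real and A B assume p: "0 < p" "p < 1" and "A \<in> Hom (Stmat C) Us Vs" "B \<in> Hom (Stmat C) Us Vs"
  then obtain M N where M: "M \<in> smats C" "sdom M = Us" "scod M = Vs" "A = smat_class C M"
    and N: "N \<in> smats C" "sdom N = Us" "scod N = Vs" "B = smat_class C N"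
    by (elim Stmat_HomE)
  have "smat_class C (smat_plus C p M N) = smat_class C (smat_plus C (1 - p) N M)"
  proof (rule smat_class_eqI)
    fix i j assume "i < length (sdom (smat_plus C p M N))" "j < length (scod (smat_plus C p M N))"
    then have ij: "i < length Us" "j < length Vs" using M by auto
    have "cone_scale C p (entry C M j i) \<in> Cone C (Us ! i) (Vs ! j)" "cone_scale C (1 - p) (entry C N j i) \<in> Cone C (Us ! i) (Vs ! j)"
      using entry_closed[OF M(1)] entry_closed[OF N(1)] M N ij p by (auto intro!: cone_scale_closed)
    from cone_add_commute[OF this]
    show "entry C (smat_plus C p M N) j i = entry C (smat_plus C (1 - p) N M) j i"
      using entry_plus[OF M(1) N(1), of p i j] entry_plus[OF N(1) M(1), of "1 - p" i j] M N p ij by simp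
  qed (use M N p in \<open>auto intro!: smat_plus_closed\<close>)
  then show "Plus (Stmat C) p A B = Plus (Stmat C) (1 - p) B A"
    using M N p by (simp add: Plus_class)
next
  fix p :: real and A assume p: "0 < p" "p < 1" and "A \<in> Hom (Stmat C) Us Vs"
  then obtain M where M: "M \<in> smats C" "sdom M = Us" "scod M = Vs" "A = smat_class C M"
    by (elim Stmat_HomE)
  have "smat_class C (smat_plus C p M M) = smat_class C M"
  proof (rule smat_class_eqI)
    fix i j assume "i < length (sdom (smat_plus C p M M))" "j < length (scod (smat_plus C p M M))"
    then have ij: "i < length (sdom M)" "j < length (scod M)" by auto
    show "entry C (smat_plus C p M M) j i = entry C M j i"
      using entry_plus[OF M(1,1), of p i j] cone_scale_plus[OF entry_closed[OF M(1) ij], of p "1 - p"]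
        cone_scale_1[OF entry_closed[OF M(1) ij]] p ij by simp
  qed (use M p in \<open>auto intro!: smat_plus_closed\<close>)
  then show "Plus (Stmat C) p A A = A"
    using M p by (simp add: Plus_class)
qed

lemma Stmat_category: "pca_category (Stmat C)"
proof (rule pca_category.intro)
  fix A assume "A \<in> Ar (Stmat C)"
  then obtain M where M: "M \<in> smats C" "A = smat_class C M" by auto
  then show "Src (Stmat C) A \<in> Ob (Stmat C)" "Tgt (Stmat C) A \<in> Ob (Stmat C)"
    using Src_Tgt_class[OF M(1)] smatsD(1,2)[OF M(1)] by auto
next
  fix Us assume "Us \<in> Ob (Stmat C)"
  then show "Idn (Stmat C) Us \<in> Hom (Stmat C) Us Us"
    by (auto intro!: Stmat_HomI Idn_smats simp: in_lists_conv_set)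
next
  fix A B Us Vs Ws assume "A \<in> Hom (Stmat C) Us Vs" "B \<in> Hom (Stmat C) Vs Ws"
  then show "Seq (Stmat C) A B \<in> Hom (Stmat C) Us Ws"
    by (elim Stmat_HomE) (auto simp: Seq_class intro!: Stmat_HomI smat_seq_closed)
next
  fix A Us Vs assume "A \<in> Hom (Stmat C) Us Vs"
  then obtain M where M: "M \<in> smats C" "sdom M = Us" "scod M = Vs" "A = smat_class C M"
    by (elim Stmat_HomE)
  note I = Idn_smats[OF smatsD(1)[OF M(1), unfolded M(2)]] Idn_smats[OF smatsD(2)[OF M(1), unfolded M(3)]]
  show "Seq (Stmat C) (Idn (Stmat C) Us) A = A"
    unfolding M Stmat_simps using M by (subst unit_seq_eq_iff[OF I(1) M(1,2) M(1), where \<phi> = "\<lambda>i. i"]) auto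
  show "Seq (Stmat C) A (Idn (Stmat C) Vs) = A"
    unfolding M Stmat_simps using M by (subst seq_unit_eq_iff[OF I(2) M(1,3) M(1), where \<psi> = "\<lambda>i. i"]) auto
next
  fix A1 A2 A3 Us Vs Ws Zs
  assume "A1 \<in> Hom (Stmat C) Us Vs" "A2 \<in> Hom (Stmat C) Vs Ws" "A3 \<in> Hom (Stmat C) Ws Zs"
  then obtain L M N where L: "L \<in> smats C" "sdom L = Us" "scod L = Vs" "A1 = smat_class C L"
    and M: "M \<in> smats C" "sdom M = Vs" "scod M = Ws" "A2 = smat_class C M"
    and N: "N \<in> smats C" "sdom N = Ws" "scod N = Zs" "A3 = smat_class C N"
    by (elim Stmat_HomE)
  have cl: "smat_seq C L M \<in> smats C" "smat_seq C M N \<in> smats C"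
    using L M N by (auto intro!: smat_seq_closed)
  have "smat_class C (smat_seq C (smat_seq C L M) N) = smat_class C (smat_seq C L (smat_seq C M N))"
  proof (rule smat_class_eqI)
    fix i u assume "i < length (sdom (smat_seq C (smat_seq C L M) N))" "u < length (scod (smat_seq C (smat_seq C L M) N))"
    then have iu: "i < length Us" "u < length Zs" using L N by auto
    have X: "Us ! i \<in> Ob C" "Zs ! u \<in> Ob C"
      using smatsD(1)[OF L(1)] smatsD(2)[OF N(1)] L N iu nth_mem by blast+
    have "entry C (smat_seq C (smat_seq C L M) N) u i = cone_sum C (Us ! i) (Zs ! u) (length Ws)
       (\<lambda>k. cone_mul C (cone_sum C (Us ! i) (Ws ! k) (length Vs) (\<lambda>j. cone_mul C (entry C L j i) (entry C M k j))) (entry C N u k))"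
      using entry_seq[OF cl(1) N(1), of i u] L M N iu entry_seq[OF L(1) M(1), of i]
      by (auto intro!: cone_sum_cong)
    also have "\<dots> = cone_sum C (Us ! i) (Zs ! u) (length Vs)
       (\<lambda>j. cone_mul C (entry C L j i) (cone_sum C (Vs ! j) (Zs ! u) (length Ws) (\<lambda>k. cone_mul C (entry C M k j) (entry C N u k))))"
      using entry_closed[OF L(1)] entry_closed[OF M(1)] entry_closed[OF N(1)] L M N iu X
      by (intro cone_sum_assoc[where X = "\<lambda>j. Vs ! j"]) auto
    also have "\<dots> = entry C (smat_seq C L (smat_seq C M N)) u i"
      using entry_seq[OF L(1) cl(2), of i u] L M N iu entry_seq[OF M(1) N(1)]
      by (auto intro!: cone_sum_cong)
    finally show "entry C (smat_seq C (smat_seq C L M) N) u i = entry C (smat_seq C L (smat_seq C M N)) u i" .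
  qed (use L M N cl in \<open>auto intro!: smat_seq_closed\<close>)
  then show "Seq (Stmat C) (Seq (Stmat C) A1 A2) A3 = Seq (Stmat C) A1 (Seq (Stmat C) A2 A3)"
    using L M N cl by (simp add: Seq_class)
next
  fix p :: real and A A' B Us Vs Ws
  assume p: "0 < p" "p < 1" and "A \<in> Hom (Stmat C) Us Vs" "A' \<in> Hom (Stmat C) Us Vs" "B \<in> Hom (Stmat C) Vs Ws"
  then obtain M M' N where M: "M \<in> smats C" "sdom M = Us" "scod M = Vs" "A = smat_class C M"
    and M': "M' \<in> smats C" "sdom M' = Us" "scod M' = Vs" "A' = smat_class C M'"
    and N: "N \<in> smats C" "sdom N = Vs" "scod N = Ws" "B = smat_class C N"
    by (elim Stmat_HomE)
  have cl: "smat_plus C p M M' \<in> smats C" "smat_seq C M N \<in> smats C" "smat_seq C M' N \<in> smats C"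
    using M M' N p by (auto intro!: smat_plus_closed smat_seq_closed)
  have "smat_class C (smat_seq C (smat_plus C p M M') N) = smat_class C (smat_plus C p (smat_seq C M N) (smat_seq C M' N))"
  proof (rule smat_class_eqI)
    fix i u assume "i < length (sdom (smat_seq C (smat_plus C p M M') N))" "u < length (scod (smat_seq C (smat_plus C p M M') N))"
    then have iu: "i < length Us" "u < length Ws" using M N by auto
    let ?X = "Us ! i" and ?Z = "Ws ! u" and ?n = "length Vs"
    have X: "?X \<in> Ob C" "?Z \<in> Ob C"
      using smatsD(1)[OF M(1)] smatsD(2)[OF N(1)] M N iu nth_mem by blast+
    have c: "entry C M j i \<in> Cone C ?X (Vs ! j)" "entry C M' j i \<in> Cone C ?X (Vs ! j)" "entry C N u j \<in> Cone C (Vs ! j) ?Z"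
      if "j < ?n" for j
      using entry_closed[OF M(1)] entry_closed[OF M'(1)] entry_closed[OF N(1)] M M' N iu that by auto
    let ?a = "\<lambda>j. cone_mul C (entry C M j i) (entry C N u j)" and ?b = "\<lambda>j. cone_mul C (entry C M' j i) (entry C N u j)"
    have ab: "?a j \<in> Cone C ?X ?Z" "?b j \<in> Cone C ?X ?Z" if "j < ?n" for j
      using cone_mul_closed[OF c(1) c(3)] cone_mul_closed[OF c(2) c(3)] that by auto
    have "entry C (smat_seq C (smat_plus C p M M') N) u i = cone_sum C ?X ?Z ?n
       (\<lambda>j. cone_mul C (cone_add C (cone_scale C p (entry C M j i)) (cone_scale C (1 - p) (entry C M' j i))) (entry C N u j))"
      using entry_seq[OF cl(1) N(1), of i u] M M' N iu entry_plus[OF M(1) M'(1), of p i] p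
      by (auto intro!: cone_sum_cong)
    also have "\<dots> = cone_sum C ?X ?Z ?n (\<lambda>j. cone_add C (cone_scale C p (?a j)) (cone_scale C (1 - p) (?b j)))"
    proof (rule cone_sum_cong)
      fix j assume j: "j < ?n"
      have "cone_scale C p (entry C M j i) \<in> Cone C ?X (Vs ! j)" "cone_scale C (1 - p) (entry C M' j i) \<in> Cone C ?X (Vs ! j)"
        using c[OF j] p by (auto intro!: cone_scale_closed)
      from cone_mul_add_left[OF this c(3)[OF j]]
      show "cone_mul C (cone_add C (cone_scale C p (entry C M j i)) (cone_scale C (1 - p) (entry C M' j i))) (entry C N u j)
         = cone_add C (cone_scale C p (?a j)) (cone_scale C (1 - p) (?b j))"
        using cone_scale_mul(1)[OF c(1)[OF j] c(3)[OF j], of p] cone_scale_mul(1)[OF c(2)[OF j] c(3)[OF j], of "1 - p"] p by simp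
    qed
    also have "\<dots> = cone_add C (cone_scale C p (cone_sum C ?X ?Z ?n ?a)) (cone_scale C (1 - p) (cone_sum C ?X ?Z ?n ?b))"
      using cone_sum_add[OF X, of ?n "\<lambda>j. cone_scale C p (?a j)" "\<lambda>j. cone_scale C (1 - p) (?b j)"]
        cone_sum_scale[OF X, of p ?n ?a] cone_sum_scale[OF X, of "1 - p" ?n ?b] ab p
      by (simp add: cone_scale_closed)
    also have "\<dots> = entry C (smat_plus C p (smat_seq C M N) (smat_seq C M' N)) u i"
      using entry_plus[OF cl(2,3), of p i u] entry_seq[OF M(1) N(1), of i u] entry_seq[OF M'(1) N(1), of i u] M M' N p iu by simp
    finally show "entry C (smat_seq C (smat_plus C p M M') N) u i = entry C (smat_plus C p (smat_seq C M N) (smat_seq C M' N)) u i" .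
  qed (use M M' N p cl in \<open>auto intro!: smat_plus_closed smat_seq_closed\<close>)
  then show "Seq (Stmat C) (Plus (Stmat C) p A A') B = Plus (Stmat C) p (Seq (Stmat C) A B) (Seq (Stmat C) A' B)"
    using M M' N cl p by (simp add: Seq_class Plus_class)
next
  fix p :: real and A B B' Us Vs Ws
  assume p: "0 < p" "p < 1" and "A \<in> Hom (Stmat C) Us Vs" "B \<in> Hom (Stmat C) Vs Ws" "B' \<in> Hom (Stmat C) Vs Ws"
  then obtain M N N' where M: "M \<in> smats C" "sdom M = Us" "scod M = Vs" "A = smat_class C M"
    and N: "N \<in> smats C" "sdom N = Vs" "scod N = Ws" "B = smat_class C N"
    and N': "N' \<in> smats C" "sdom N' = Vs" "scod N' = Ws" "B' = smat_class C N'"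
    by (elim Stmat_HomE)
  have cl: "smat_plus C p N N' \<in> smats C" "smat_seq C M N \<in> smats C" "smat_seq C M N' \<in> smats C"
    using M N N' p by (auto intro!: smat_plus_closed smat_seq_closed)
  have "smat_class C (smat_seq C M (smat_plus C p N N')) = smat_class C (smat_plus C p (smat_seq C M N) (smat_seq C M N'))"
  proof (rule smat_class_eqI)
    fix i u assume "i < length (sdom (smat_seq C M (smat_plus C p N N')))" "u < length (scod (smat_seq C M (smat_plus C p N N')))"
    then have iu: "i < length Us" "u < length Ws" using M N by auto
    let ?X = "Us ! i" and ?Z = "Ws ! u" and ?n = "length Vs"
    have X: "?X \<in> Ob C" "?Z \<in> Ob C"
      using smatsD(1)[OF M(1)] smatsD(2)[OF N(1)] M N iu nth_mem by blast+
    have c: "entry C M j i \<in> Cone C ?X (Vs ! j)" "entry C N u j \<in> Cone C (Vs ! j) ?Z" "entry C N' u j \<in> Cone C (Vs ! j) ?Z"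
      if "j < ?n" for j
      using entry_closed[OF M(1)] entry_closed[OF N(1)] entry_closed[OF N'(1)] M N N' iu that by auto
    let ?a = "\<lambda>j. cone_mul C (entry C M j i) (entry C N u j)" and ?b = "\<lambda>j. cone_mul C (entry C M j i) (entry C N' u j)"
    have ab: "?a j \<in> Cone C ?X ?Z" "?b j \<in> Cone C ?X ?Z" if "j < ?n" for j
      using cone_mul_closed[OF c(1) c(2)] cone_mul_closed[OF c(1) c(3)] that by auto
    have "entry C (smat_seq C M (smat_plus C p N N')) u i = cone_sum C ?X ?Z ?n
       (\<lambda>j. cone_mul C (entry C M j i) (cone_add C (cone_scale C p (entry C N u j)) (cone_scale C (1 - p) (entry C N' u j))))"
      using entry_seq[OF M(1) cl(1), of i u] M N N' iu entry_plus[OF N(1) N'(1), of p _ u] p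
      by (auto intro!: cone_sum_cong)
    also have "\<dots> = cone_sum C ?X ?Z ?n (\<lambda>j. cone_add C (cone_scale C p (?a j)) (cone_scale C (1 - p) (?b j)))"
    proof (rule cone_sum_cong)
      fix j assume j: "j < ?n"
      have "cone_scale C p (entry C N u j) \<in> Cone C (Vs ! j) ?Z" "cone_scale C (1 - p) (entry C N' u j) \<in> Cone C (Vs ! j) ?Z"
        using c[OF j] p by (auto intro!: cone_scale_closed)
      from cone_mul_add_right[OF c(1)[OF j] this]
      show "cone_mul C (entry C M j i) (cone_add C (cone_scale C p (entry C N u j)) (cone_scale C (1 - p) (entry C N' u j)))
         = cone_add C (cone_scale C p (?a j)) (cone_scale C (1 - p) (?b j))"
        using cone_scale_mul(2)[OF c(1)[OF j] c(2)[OF j], of p] cone_scale_mul(2)[OF c(1)[OF j] c(3)[OF j], of "1 - p"] p by simp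
    qed
    also have "\<dots> = cone_add C (cone_scale C p (cone_sum C ?X ?Z ?n ?a)) (cone_scale C (1 - p) (cone_sum C ?X ?Z ?n ?b))"
      using cone_sum_add[OF X, of ?n "\<lambda>j. cone_scale C p (?a j)" "\<lambda>j. cone_scale C (1 - p) (?b j)"]
        cone_sum_scale[OF X, of p ?n ?a] cone_sum_scale[OF X, of "1 - p" ?n ?b] ab p
      by (simp add: cone_scale_closed)
    also have "\<dots> = entry C (smat_plus C p (smat_seq C M N) (smat_seq C M N')) u i"
      using entry_plus[OF cl(2,3), of p i u] entry_seq[OF M(1) N(1), of i u] entry_seq[OF M(1) N'(1), of i u] M N N' p iu by simp
    finally show "entry C (smat_seq C M (smat_plus C p N N')) u i = entry C (smat_plus C p (smat_seq C M N) (smat_seq C M N')) u i" .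
  qed (use M N N' p cl in \<open>auto intro!: smat_plus_closed smat_seq_closed\<close>)
  then show "Seq (Stmat C) A (Plus (Stmat C) p B B') = Plus (Stmat C) p (Seq (Stmat C) A B) (Seq (Stmat C) A B')"
    using M N N' cl p by (simp add: Seq_class Plus_class)
next
  fix Us B Vs Ws assume Us: "Us \<in> Ob (Stmat C)" and "B \<in> Hom (Stmat C) Vs Ws"
  then obtain N where N: "N \<in> smats C" "sdom N = Vs" "scod N = Ws" "B = smat_class C N"
    by (elim Stmat_HomE)
  have S: "smat_unit C Us Vs (\<lambda>j i. False) \<in> smats C" "smat_unit C Us Ws (\<lambda>j i. False) \<in> smats C"
    using Us smatsD(1,2)[OF N(1)] N by (auto intro!: Star_smats simp: in_lists_conv_set)
  have "smat_class C (smat_seq C (smat_unit C Us Vs (\<lambda>j i. False)) N) = smat_class C (smat_unit C Us Ws (\<lambda>j i. False))"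
  proof (rule smat_class_eqI)
    fix i u assume "i < length (sdom (smat_seq C (smat_unit C Us Vs (\<lambda>j i. False)) N))"
      "u < length (scod (smat_seq C (smat_unit C Us Vs (\<lambda>j i. False)) N))"
    then have iu: "i < length Us" "u < length Ws" using N by auto
    have X: "Us ! i \<in> Ob C" "Ws ! u \<in> Ob C"
      using smatsD(1)[OF S(2)] smatsD(2)[OF S(2)] iu nth_mem by auto
    have "cone_mul C (entry C (smat_unit C Us Vs (\<lambda>j i. False)) j i) (entry C N u j) = cone_zero C (Us ! i) (Ws ! u)"
      if j: "j < length Vs" for j
      using cone_mul_zero_left[OF _ X(1), of "entry C N u j" "Vs ! j" "Ws ! u"] entry_closed[OF N(1), of j u] N iu j
      by (simp add: entry_unit)
    then show "entry C (smat_seq C (smat_unit C Us Vs (\<lambda>j i. False)) N) u i = entry C (smat_unit C Us Ws (\<lambda>j i. False)) u i"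
      using entry_seq[OF S(1) N(1), of i u] N iu cone_sum_zero[OF X, of "length Vs"] by (simp add: entry_unit)
  qed (use S N in \<open>auto intro!: smat_seq_closed\<close>)
  then show "Seq (Stmat C) (Star (Stmat C) Us Vs) B = Star (Stmat C) Us Ws"
    using N S by (simp add: Seq_class)
next
  fix A Us Vs Ws assume Ws: "Ws \<in> Ob (Stmat C)" and "A \<in> Hom (Stmat C) Us Vs"
  then obtain M where M: "M \<in> smats C" "sdom M = Us" "scod M = Vs" "A = smat_class C M"
    by (elim Stmat_HomE)
  have S: "smat_unit C Vs Ws (\<lambda>j i. False) \<in> smats C" "smat_unit C Us Ws (\<lambda>j i. False) \<in> smats C"
    using Ws smatsD(1,2)[OF M(1)] M by (auto intro!: Star_smats simp: in_lists_conv_set)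
  have "smat_class C (smat_seq C M (smat_unit C Vs Ws (\<lambda>j i. False))) = smat_class C (smat_unit C Us Ws (\<lambda>j i. False))"
  proof (rule smat_class_eqI)
    fix i u assume "i < length (sdom (smat_seq C M (smat_unit C Vs Ws (\<lambda>j i. False))))"
      "u < length (scod (smat_seq C M (smat_unit C Vs Ws (\<lambda>j i. False))))"
    then have iu: "i < length Us" "u < length Ws" using M by auto
    have X: "Us ! i \<in> Ob C" "Ws ! u \<in> Ob C"
      using smatsD(1)[OF S(2)] smatsD(2)[OF S(2)] iu nth_mem by auto
    have "cone_mul C (entry C M j i) (entry C (smat_unit C Vs Ws (\<lambda>j i. False)) u j) = cone_zero C (Us ! i) (Ws ! u)"
      if j: "j < length Vs" for j
      using cone_mul_zero_right[OF _ X(2), of "entry C M j i" "Us ! i" "Vs ! j"] entry_closed[OF M(1), of i j] M iu j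
      by (simp add: entry_unit)
    then show "entry C (smat_seq C M (smat_unit C Vs Ws (\<lambda>j i. False))) u i = entry C (smat_unit C Us Ws (\<lambda>j i. False)) u i"
      using entry_seq[OF M(1) S(1), of i u] M iu cone_sum_zero[OF X, of "length Vs"] by (simp add: entry_unit)
  qed (use S M in \<open>auto intro!: smat_seq_closed\<close>)
  then show "Seq (Stmat C) A (Star (Stmat C) Vs Ws) = Star (Stmat C) Us Ws"
    using M S by (simp add: Seq_class)
qed (rule Stmat_pca)

end


section \<open>Convex biproducts of words\<close>

context pca_category
begin

text \<open>By definition, \<open>scale\<close> distinguishes the weights 0 and 1 from the others,
  and each case yields a different representative. What they share, and what is used later, are the
  cone entries.\<close>

lemma scale_class:
  assumes M: "M \<in> smats C" and p: "0 \<le> p" "p \<le> 1"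
  obtains K where "scale (Stmat C) p (smat_class C M) = smat_class C K" "K \<in> smats C" "sdom K = sdom M" "scod K = scod M"
    "\<And>i j. \<lbrakk>i < length (sdom M); j < length (scod M)\<rbrakk> \<Longrightarrow> entry C K j i = cone_scale C p (entry C M j i)"
proof -
  let ?S = "smat_unit C (sdom M) (scod M) (\<lambda>j i. False)"
  have S: "?S \<in> smats C" using smatsD(1,2)[OF M] by (rule Star_smats)
  have sc: "scale (Stmat C) p (smat_class C M) = cplus (Stmat C) p (smat_class C M) (smat_class C ?S)"
    using Src_Tgt_class[OF M] by (simp add: scale_def)
  have Ob: "sdom M ! i \<in> Ob C" "scod M ! j \<in> Ob C" if "i < length (sdom M)" "j < length (scod M)" for i j
    using smatsD(1,2)[OF M] that by auto
  consider "p = 1" | "p = 0" | "0 < p" "p < 1" using p by linarith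
  then show thesis
  proof cases
    case 1
    show ?thesis
      by (rule that[of M]) (use sc M 1 cone_scale_1[OF entry_closed[OF M]] in \<open>auto simp: cplus_def\<close>)
  next
    case 2
    show ?thesis
      by (rule that[of ?S]) (use sc S 2 cone_scale_0[OF entry_closed[OF M]] in \<open>auto simp: cplus_def entry_unit\<close>)
  next
    case 3
    show ?thesis
    proof (rule that[of "smat_plus C p M ?S"])
      fix i j assume ij: "i < length (sdom M)" "j < length (scod M)"
      show "entry C (smat_plus C p M ?S) j i = cone_scale C p (entry C M j i)"
        using entry_plus[OF M S, of p i j] ij 3 cone_scale_zero[OF Ob[OF ij], of "1 - p"]
          cone_add_zero(2)[OF cone_scale_closed[OF entry_closed[OF M ij], of p]]
        by (simp add: entry_unit)
    qed (use sc S M 3 in \<open>auto simp: cplus_def Plus_class intro!: smat_plus_closed\<close>)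
  qed
qed

text \<open>The injections select blocks of columns, and the projections below select blocks of
  rows. Each equivalence turns a triangle of a universal property into equations between
  entries.\<close>

lemma Inj1_seq:
  assumes N: "N \<in> smats C" "sdom N = Us @ Vs"
    and K: "K \<in> smats C" "sdom K = Us" "scod K = scod N"
  shows "Seq (Stmat C) (Inj1 (Stmat C) Us Vs) (smat_class C N) = smat_class C K \<longleftrightarrow>
    (\<forall>i<length Us. \<forall>u<length (scod N). entry C N u i = entry C K u i)"
proof -
  have "set Us \<subseteq> Ob C" "set Vs \<subseteq> Ob C" using smatsD(1)[OF N(1)] N(2) by auto
  from unit_seq_eq_iff[OF Inj1_smats[OF this] N K, where \<phi> = "\<lambda>i. i"] show ?thesis
    by (simp add: nth_append)
qed

lemma Inj2_seq:
  assumes N: "N \<in> smats C" "sdom N = Us @ Vs"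
    and K: "K \<in> smats C" "sdom K = Vs" "scod K = scod N"
  shows "Seq (Stmat C) (Inj2 (Stmat C) Us Vs) (smat_class C N) = smat_class C K \<longleftrightarrow>
    (\<forall>i<length Vs. \<forall>u<length (scod N). entry C N u (length Us + i) = entry C K u i)"
proof -
  have "set Us \<subseteq> Ob C" "set Vs \<subseteq> Ob C" using smatsD(1)[OF N(1)] N(2) by auto
  from unit_seq_eq_iff[OF Inj2_smats[OF this] N K, where \<phi> = "\<lambda>i. length Us + i"] show ?thesis
    by (simp add: nth_append)
qed

lemma seq_Proj1:
  assumes M: "M \<in> smats C" "scod M = Us @ Vs"
    and K: "K \<in> smats C" "sdom K = sdom M" "scod K = Us"
  shows "Seq (Stmat C) (smat_class C M) (Proj1 (Stmat C) Us Vs) = smat_class C K \<longleftrightarrow>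
    (\<forall>i<length (sdom M). \<forall>u<length Us. entry C M u i = entry C K u i)"
proof -
  have "set Us \<subseteq> Ob C" "set Vs \<subseteq> Ob C" using smatsD(2)[OF M(1)] M(2) by auto
  from seq_unit_eq_iff[OF Proj1_smats[OF this] M K, where \<psi> = "\<lambda>u. u"] show ?thesis
    by (simp add: nth_append)
qed

lemma seq_Proj2:
  assumes M: "M \<in> smats C" "scod M = Us @ Vs"
    and K: "K \<in> smats C" "sdom K = sdom M" "scod K = Vs"
  shows "Seq (Stmat C) (smat_class C M) (Proj2 (Stmat C) Us Vs) = smat_class C K \<longleftrightarrow>
    (\<forall>i<length (sdom M). \<forall>u<length Vs. entry C M (length Us + u) i = entry C K u i)"
proof -
  have "set Us \<subseteq> Ob C" "set Vs \<subseteq> Ob C" using smatsD(2)[OF M(1)] M(2) by auto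
  from seq_unit_eq_iff[OF Proj2_smats[OF this] M K, where \<psi> = "\<lambda>u. length Us + u"] show ?thesis
    by (simp add: nth_append)
qed

text \<open>Stochasticity is a condition on each column alone, so two matrices with a common target
  can be put side by side freely, and their columns determine the result.\<close>

lemma Stmat_coproduct:
  assumes Us: "set Us \<subseteq> Ob C" and Vs: "set Vs \<subseteq> Ob C"
  shows "is_coproduct (Stmat C) Us Vs (Us @ Vs) (Inj1 (Stmat C) Us Vs) (Inj2 (Stmat C) Us Vs)"
  unfolding is_coproduct_def
proof (intro conjI ballI)
  fix Ws A B assume "A \<in> Hom (Stmat C) Us Ws" "B \<in> Hom (Stmat C) Vs Ws"
  then obtain M N where M: "M \<in> smats C" "sdom M = Us" "scod M = Ws" "A = smat_class C M"
    and N: "N \<in> smats C" "sdom N = Vs" "scod N = Ws" "B = smat_class C N"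
    by (elim Stmat_HomE)
  have R: "smat_row M N \<in> smats C" using smat_row_closed[OF M(1) N(1)] M N by simp
  have iff: "H \<in> Hom (Stmat C) (Us @ Vs) Ws \<and> Seq (Stmat C) (Inj1 (Stmat C) Us Vs) H = A \<and> Seq (Stmat C) (Inj2 (Stmat C) Us Vs) H = B
    \<longleftrightarrow> H = smat_class C (smat_row M N)" for H
  proof (intro iffI conjI)
    assume "H \<in> Hom (Stmat C) (Us @ Vs) Ws \<and> Seq (Stmat C) (Inj1 (Stmat C) Us Vs) H = A \<and> Seq (Stmat C) (Inj2 (Stmat C) Us Vs) H = B"
    then have *: "H \<in> Hom (Stmat C) (Us @ Vs) Ws" "Seq (Stmat C) (Inj1 (Stmat C) Us Vs) H = A" "Seq (Stmat C) (Inj2 (Stmat C) Us Vs) H = B"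
      by blast+
    from *(1) obtain K where K: "K \<in> smats C" "sdom K = Us @ Vs" "scod K = Ws" "H = smat_class C K"
      by (elim Stmat_HomE)
    have 1: "entry C K u i = entry C M u i" if "i < length Us" "u < length Ws" for i u
      using *(2) Inj1_seq[OF K(1,2) M(1,2)] M K that by simp
    have 2: "entry C K u (length Us + i) = entry C N u i" if "i < length Vs" "u < length Ws" for i u
      using *(3) Inj2_seq[OF K(1,2) N(1,2)] N K that by simp
    have 3: "entry C K u i = entry C N u (i - length Us)" if "\<not> i < length Us" "i < length Us + length Vs" "u < length Ws" for i u
      using 2[of "i - length Us" u] that by simp
    show "H = smat_class C (smat_row M N)"
      unfolding K(4) using K M N R 1 3 by (intro smat_class_eqI) (auto simp: entry_row)
  next
    assume H: "H = smat_class C (smat_row M N)"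
    show "H \<in> Hom (Stmat C) (Us @ Vs) Ws" unfolding H using R M N by (intro Stmat_HomI) auto
    show "Seq (Stmat C) (Inj1 (Stmat C) Us Vs) H = A"
      unfolding H M(4) by (subst Inj1_seq[OF R _ M(1,2)]) (use M N in \<open>auto simp: entry_row\<close>)
    show "Seq (Stmat C) (Inj2 (Stmat C) Us Vs) H = B"
      unfolding H N(4) by (subst Inj2_seq[OF R _ N(1,2)]) (use M N in \<open>auto simp: entry_row\<close>)
  qed
  show "\<exists>!H. H \<in> Hom (Stmat C) (Us @ Vs) Ws \<and> Seq (Stmat C) (Inj1 (Stmat C) Us Vs) H = A \<and> Seq (Stmat C) (Inj2 (Stmat C) Us Vs) H = B"
    unfolding iff by simp
qed (use Us Vs Inj1_smats[OF Us Vs] Inj2_smats[OF Us Vs] in \<open>auto intro!: Stmat_HomI\<close>)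

text \<open>Stacking adds column sums. Hence the two parts have to be weighted by p and q with p + q
  at most 1, and this is enough.\<close>

lemma Stmat_convex_product:
  assumes Us: "set Us \<subseteq> Ob C" and Vs: "set Vs \<subseteq> Ob C"
  shows "is_convex_product (Stmat C) Us Vs (Us @ Vs) (Proj1 (Stmat C) Us Vs) (Proj2 (Stmat C) Us Vs)"
  unfolding is_convex_product_def
proof (intro conjI ballI allI impI)
  fix p q :: real and Ws A B assume pq: "0 \<le> p \<and> 0 \<le> q \<and> p + q \<le> 1"
    and "A \<in> Hom (Stmat C) Ws Us" "B \<in> Hom (Stmat C) Ws Vs"
  then obtain M N where M: "M \<in> smats C" "sdom M = Ws" "scod M = Us" "A = smat_class C M"
    and N: "N \<in> smats C" "sdom N = Ws" "scod N = Vs" "B = smat_class C N"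
    by (elim Stmat_HomE)
  obtain M' where M': "scale (Stmat C) p A = smat_class C M'" "M' \<in> smats C" "sdom M' = Ws" "scod M' = Us"
    "\<And>i j. i < length Ws \<Longrightarrow> j < length Us \<Longrightarrow> entry C M' j i = cone_scale C p (entry C M j i)"
    using scale_class[OF M(1), of p] pq unfolding M(2-4) by auto
  obtain N' where N': "scale (Stmat C) q B = smat_class C N'" "N' \<in> smats C" "sdom N' = Ws" "scod N' = Vs"
    "\<And>i j. i < length Ws \<Longrightarrow> j < length Vs \<Longrightarrow> entry C N' j i = cone_scale C q (entry C N j i)"
    using scale_class[OF N(1), of q] pq unfolding N(2-4) by auto
  have R: "smat_stack p q M N \<in> smats C" using smat_stack_closed[OF M(1) N(1)] M N pq by simp
  have e: "entry C (smat_stack p q M N) j i = (if j < length Us then entry C M' j i else entry C N' (j - length Us) i)"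
    if "i < length Ws" "j < length Us + length Vs" for i j
    using entry_stack[OF M(1) N(1), of p q i j] M N M' N' that pq by simp
  have iff: "H \<in> Hom (Stmat C) Ws (Us @ Vs) \<and> Seq (Stmat C) H (Proj1 (Stmat C) Us Vs) = scale (Stmat C) p A
      \<and> Seq (Stmat C) H (Proj2 (Stmat C) Us Vs) = scale (Stmat C) q B
    \<longleftrightarrow> H = smat_class C (smat_stack p q M N)" for H
  proof (intro iffI conjI)
    assume "H \<in> Hom (Stmat C) Ws (Us @ Vs) \<and> Seq (Stmat C) H (Proj1 (Stmat C) Us Vs) = scale (Stmat C) p A
      \<and> Seq (Stmat C) H (Proj2 (Stmat C) Us Vs) = scale (Stmat C) q B"
    then have *: "H \<in> Hom (Stmat C) Ws (Us @ Vs)" "Seq (Stmat C) H (Proj1 (Stmat C) Us Vs) = smat_class C M'"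
      "Seq (Stmat C) H (Proj2 (Stmat C) Us Vs) = smat_class C N'"
      using M' N' by auto
    from *(1) obtain K where K: "K \<in> smats C" "sdom K = Ws" "scod K = Us @ Vs" "H = smat_class C K"
      by (elim Stmat_HomE)
    have 1: "entry C K u i = entry C M' u i" if "i < length Ws" "u < length Us" for i u
      using *(2) seq_Proj1[OF K(1,3) M'(2)] M' K that by simp
    have 2: "entry C K (length Us + u) i = entry C N' u i" if "i < length Ws" "u < length Vs" for i u
      using *(3) seq_Proj2[OF K(1,3) N'(2)] N' K that by simp
    have 3: "entry C K u i = entry C N' (u - length Us) i" if "\<not> u < length Us" "u < length Us + length Vs" "i < length Ws" for i u
      using 2[of i "u - length Us"] that by simp
    show "H = smat_class C (smat_stack p q M N)"
      unfolding K(4)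
    proof (rule smat_class_eqI[OF K(1) R])
      fix i j assume "i < length (sdom K)" "j < length (scod K)"
      then show "entry C K j i = entry C (smat_stack p q M N) j i"
        using e[of i j] 1[of i j] 3[of j i] K by simp
    qed (use K M N in auto)
  next
    assume H: "H = smat_class C (smat_stack p q M N)"
    show "H \<in> Hom (Stmat C) Ws (Us @ Vs)" unfolding H using R M N by (intro Stmat_HomI) auto
    show "Seq (Stmat C) H (Proj1 (Stmat C) Us Vs) = scale (Stmat C) p A"
      unfolding H M'(1) by (subst seq_Proj1[OF R _ M'(2)]) (use M M' N e in auto)
    show "Seq (Stmat C) H (Proj2 (Stmat C) Us Vs) = scale (Stmat C) q B"
      unfolding H N'(1) by (subst seq_Proj2[OF R _ N'(2)]) (use M N N' e in auto)
  qed
  show "\<exists>!H. H \<in> Hom (Stmat C) Ws (Us @ Vs) \<and> Seq (Stmat C) H (Proj1 (Stmat C) Us Vs) = scale (Stmat C) p A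
      \<and> Seq (Stmat C) H (Proj2 (Stmat C) Us Vs) = scale (Stmat C) q B"
    unfolding iff by simp
qed (use Us Vs Proj1_smats[OF Us Vs] Proj2_smats[OF Us Vs] in \<open>auto intro!: Stmat_HomI\<close>)

lemma Stmat_initial: "is_initial (Stmat C) []"
  unfolding is_initial_def
proof (intro conjI ballI)
  fix Us assume "Us \<in> Ob (Stmat C)"
  then have Us: "smat_unit C [] Us (\<lambda>j i. False) \<in> smats C" by (intro Star_smats) (auto simp: in_lists_conv_set)
  show "\<exists>!A. A \<in> Hom (Stmat C) [] Us"
  proof (rule ex1I)
    show "smat_class C (smat_unit C [] Us (\<lambda>j i. False)) \<in> Hom (Stmat C) [] Us"
      using Us by (intro Stmat_HomI) auto
    show "A = smat_class C (smat_unit C [] Us (\<lambda>j i. False))" if "A \<in> Hom (Stmat C) [] Us" for A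
      using that Us by (elim Stmat_HomE) (simp, intro smat_class_eqI, auto)
  qed
qed simp

lemma Stmat_terminal: "is_terminal (Stmat C) []"
  unfolding is_terminal_def
proof (intro conjI ballI)
  fix Us assume "Us \<in> Ob (Stmat C)"
  then have Us: "smat_unit C Us [] (\<lambda>j i. False) \<in> smats C" by (intro Star_smats) (auto simp: in_lists_conv_set)
  show "\<exists>!A. A \<in> Hom (Stmat C) Us []"
  proof (rule ex1I)
    show "smat_class C (smat_unit C Us [] (\<lambda>j i. False)) \<in> Hom (Stmat C) Us []"
      using Us by (intro Stmat_HomI) auto
    show "A = smat_class C (smat_unit C Us [] (\<lambda>j i. False))" if "A \<in> Hom (Stmat C) Us []" for A
      using that Us by (elim Stmat_HomE) (simp, intro smat_class_eqI, auto)
  qed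
qed simp

lemma Stmat_convex_biproduct: "convex_biproduct_category (Stmat C)"
proof (intro convex_biproduct_category.intro convex_biproduct_category_axioms.intro)
  fix Us Vs assume "Us \<in> Ob (Stmat C)" "Vs \<in> Ob (Stmat C)"
  then have UV: "set Us \<subseteq> Ob C" "set Vs \<subseteq> Ob C" by auto
  note I = Inj1_smats[OF UV] Inj2_smats[OF UV] Proj1_smats[OF UV] Proj2_smats[OF UV]
    Idn_smats[OF UV(1)] Idn_smats[OF UV(2)] Star_smats[OF UV] Star_smats[OF UV(2,1)]
  show "is_coproduct (Stmat C) Us Vs (Oplus (Stmat C) Us Vs) (Inj1 (Stmat C) Us Vs) (Inj2 (Stmat C) Us Vs)"
    using Stmat_coproduct[OF UV] by simp
  show "is_convex_product (Stmat C) Us Vs (Oplus (Stmat C) Us Vs) (Proj1 (Stmat C) Us Vs) (Proj2 (Stmat C) Us Vs)"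
    using Stmat_convex_product[OF UV] by simp
  show "Seq (Stmat C) (Inj1 (Stmat C) Us Vs) (Proj1 (Stmat C) Us Vs) = Idn (Stmat C) Us"
    unfolding Stmat_simps
    by (rule smat_class_unit_unit[OF I(1,3,5), where \<phi> = "\<lambda>i. i"]) (auto simp: nth_append)
  show "Seq (Stmat C) (Inj1 (Stmat C) Us Vs) (Proj2 (Stmat C) Us Vs) = Star (Stmat C) Us Vs"
    unfolding Stmat_simps
    by (rule smat_class_unit_unit[OF I(1,4,7), where \<phi> = "\<lambda>i. i"]) (auto simp: nth_append)
  show "Seq (Stmat C) (Inj2 (Stmat C) Us Vs) (Proj1 (Stmat C) Us Vs) = Star (Stmat C) Vs Us"
    unfolding Stmat_simps
    by (rule smat_class_unit_unit[OF I(2,3,8), where \<phi> = "\<lambda>i. length Us + i"]) (auto simp: nth_append)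
  show "Seq (Stmat C) (Inj2 (Stmat C) Us Vs) (Proj2 (Stmat C) Us Vs) = Idn (Stmat C) Vs"
    unfolding Stmat_simps
    by (rule smat_class_unit_unit[OF I(2,4,6), where \<phi> = "\<lambda>i. length Us + i"]) (auto simp: nth_append)
qed (use Stmat_category Stmat_initial Stmat_terminal in simp_all)

lemma Stmat_strict: "strict_convex_biproduct_category (Stmat C)"
proof (intro strict_convex_biproduct_category.intro strict_convex_biproduct_category_axioms.intro Stmat_convex_biproduct)
  fix Us assume "Us \<in> Ob (Stmat C)"
  then have U: "set Us \<subseteq> Ob C" by auto
  show "Inj2 (Stmat C) (Zero (Stmat C)) Us = Idn (Stmat C) Us" "Inj1 (Stmat C) Us (Zero (Stmat C)) = Idn (Stmat C) Us"
    by simp_all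
next
  fix Us Vs Ws assume "Us \<in> Ob (Stmat C)" "Vs \<in> Ob (Stmat C)" "Ws \<in> Ob (Stmat C)"
  then have U: "set Us \<subseteq> Ob C" "set Vs \<subseteq> Ob C" "set Ws \<subseteq> Ob C"
    "set (Us @ Vs) \<subseteq> Ob C" "set (Vs @ Ws) \<subseteq> Ob C" "set (Us @ Vs @ Ws) \<subseteq> Ob C" by auto
  \<comment> \<open>The inclusion of the middle block, to which both sides of the mixed equation
    between \<open>Inj2\<close> and \<open>Inj1\<close> reduce.\<close>
  have I: "smat_unit C Vs (Us @ Vs @ Ws) (\<lambda>j i. j = length Us + i) \<in> smats C"
    using U by (intro smat_unit_closed) (auto simp: nth_append)
  show "Seq (Stmat C) (Inj1 (Stmat C) Us Vs) (Inj1 (Stmat C) (Oplus (Stmat C) Us Vs) Ws) = Inj1 (Stmat C) Us (Oplus (Stmat C) Vs Ws)"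
    unfolding Stmat_simps append_assoc
    by (rule smat_class_unit_unit[OF Inj1_smats[OF U(1,2)] Inj1_smats[OF U(4,3), unfolded append_assoc] Inj1_smats[OF U(1,5)], where \<phi> = "\<lambda>i. i"])
      (auto simp: nth_append)
  have "Seq (Stmat C) (Inj2 (Stmat C) Us Vs) (Inj1 (Stmat C) (Oplus (Stmat C) Us Vs) Ws) = smat_class C (smat_unit C Vs (Us @ Vs @ Ws) (\<lambda>j i. j = length Us + i))"
    unfolding Stmat_simps append_assoc
    by (rule smat_class_unit_unit[OF Inj2_smats[OF U(1,2)] Inj1_smats[OF U(4,3), unfolded append_assoc] I, where \<phi> = "\<lambda>i. length Us + i"])
      (auto simp: nth_append)
  also have "\<dots> = Seq (Stmat C) (Inj1 (Stmat C) Vs Ws) (Inj2 (Stmat C) Us (Oplus (Stmat C) Vs Ws))"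
    unfolding Stmat_simps
    by (rule smat_class_unit_unit[OF Inj1_smats[OF U(2,3)] Inj2_smats[OF U(1,5)] I, where \<phi> = "\<lambda>i. i", symmetric])
      (auto simp: nth_append)
  finally show "Seq (Stmat C) (Inj2 (Stmat C) Us Vs) (Inj1 (Stmat C) (Oplus (Stmat C) Us Vs) Ws)
    = Seq (Stmat C) (Inj1 (Stmat C) Vs Ws) (Inj2 (Stmat C) Us (Oplus (Stmat C) Vs Ws))" .
  show "Inj2 (Stmat C) (Oplus (Stmat C) Us Vs) Ws = Seq (Stmat C) (Inj2 (Stmat C) Vs Ws) (Inj2 (Stmat C) Us (Oplus (Stmat C) Vs Ws))"
    unfolding Stmat_simps append_assoc
    by (rule smat_class_unit_unit[OF Inj2_smats[OF U(2,3)] Inj2_smats[OF U(1,5)] Inj2_smats[OF U(4,3), unfolded append_assoc], where \<phi> = "\<lambda>i. length Vs + i", symmetric])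
      (auto simp: nth_append)
qed simp_all

end


section \<open>Functoriality\<close>

definition cone_map :: "('p, 'b, 'z) pca_cat_scheme \<Rightarrow> ('o, 'a, 'p, 'b) funct \<Rightarrow> (real \<times> 'a) set \<Rightarrow> (real \<times> 'b) set" where
  "cone_map D F a = (case cone_rep a of (p, f) \<Rightarrow> cone D p (FA F f))"

locale pca_functor = C: pca_category C + D: pca_category D
  for C :: "('o, 'a, 'y) pca_cat_scheme" and D :: "('p, 'b, 'z) pca_cat_scheme" +
  fixes F :: "('o, 'a, 'p, 'b) funct"
  assumes F: "F \<in> pca_hom C D"
begin

lemma FO_Ob: "X \<in> Ob C \<Longrightarrow> FO F X \<in> Ob D"
  and FA_Hom: "f \<in> Hom C X Y \<Longrightarrow> FA F f \<in> Hom D (FO F X) (FO F Y)"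
  and FA_Idn: "X \<in> Ob C \<Longrightarrow> FA F (Idn C X) = Idn D (FO F X)"
  and FA_Seq: "\<lbrakk>f \<in> Hom C X Y; g \<in> Hom C Y Z\<rbrakk> \<Longrightarrow> FA F (Seq C f g) = Seq D (FA F f) (FA F g)"
  and FA_Star: "\<lbrakk>X \<in> Ob C; Y \<in> Ob C\<rbrakk> \<Longrightarrow> FA F (Star C X Y) = Star D (FO F X) (FO F Y)"
  and FA_Plus: "\<lbrakk>f \<in> Hom C X Y; g \<in> Hom C X Y; 0 < p; p < 1\<rbrakk> \<Longrightarrow> FA F (Plus C p f g) = Plus D p (FA F f) (FA F g)"
  using F C.Hom_Ob[of f X Y] C.Hom_Ob[of g Y Z] unfolding pca_hom_def by (blast | auto simp: PiE_iff extensional_def)+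

lemma FA_cplus: "\<lbrakk>f \<in> Hom C X Y; g \<in> Hom C X Y; 0 \<le> p; p \<le> 1\<rbrakk> \<Longrightarrow> FA F (cplus C p f g) = cplus D p (FA F f) (FA F g)"
  using FA_Plus[of f X Y g p] by (auto simp: cplus_def)

lemma FA_scale:
  assumes "f \<in> Hom C X Y" "0 \<le> p" "p \<le> 1"
  shows "FA F (scale C p f) = scale D p (FA F f)"
  using assms C.Hom_Ob[OF assms(1)] FA_cplus[OF assms(1) C.Star_closed]
  by (simp add: scale_Hom[OF assms(1)] scale_Hom[OF FA_Hom[OF assms(1)]] FA_Star)

text \<open>A functor commutes with scaling, so a witness for the equality in \<open>C\<close> is
  one for the images in \<open>D\<close>.\<close>

lemma cone_FA_cong:
  assumes f: "f \<in> Hom C X Y" "g \<in> Hom C X Y" and pq: "0 \<le> p" "0 \<le> q" and eq: "cone C p f = cone C q g"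
  shows "cone D p (FA F f) = cone D q (FA F g)"
proof -
  obtain s where s: "0 < s" "s * p \<le> 1" "s * q \<le> 1" "scale C (s * p) f = scale C (s * q) g"
    using eq C.cone_eq_iff[OF f pq] by (auto simp: cone_eq_def)
  then have "scale D (s * p) (FA F f) = scale D (s * q) (FA F g)"
    using FA_scale[OF f(1), of "s * p"] FA_scale[OF f(2), of "s * q"] pq by simp
  then show ?thesis
    using s D.cone_eq_iff[OF FA_Hom[OF f(1)] FA_Hom[OF f(2)] pq] by (auto simp: cone_eq_def)
qed

lemma cone_map_cone:
  assumes "f \<in> Hom C X Y" "0 \<le> p"
  shows "cone_map D F (cone C p f) = cone D p (FA F f)"
proof -
  obtain q g where "cone_rep (cone C p f) = (q, g)" "0 \<le> q" "g \<in> Hom C X Y" "cone C q g = cone C p f"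
    using C.cone_rep_cone[OF assms] by metis
  then show ?thesis using cone_FA_cong[of g X Y f q p] assms by (simp add: cone_map_def)
qed

lemma cone_map_add:
  assumes "a \<in> Cone C X Y" "b \<in> Cone C X Y"
  shows "cone_map D F (cone_add C a b) = cone_add D (cone_map D F a) (cone_map D F b)"
proof -
  obtain p f q g where a: "a = cone C p f" "0 \<le> p" "f \<in> Hom C X Y" and b: "b = cone C q g" "0 \<le> q" "g \<in> Hom C X Y"
    using assms by (elim C.ConeE)
  note fr = frac_bounds[OF a(2) b(2)]
  show ?thesis
    using a b C.cone_add_cone[OF a(3) b(3) a(2) b(2)] D.cone_add_cone[OF FA_Hom[OF a(3)] FA_Hom[OF b(3)] a(2) b(2)]
      cone_map_cone[OF C.cplus_closed[OF a(3) b(3) fr], of "p + q"] FA_cplus[OF a(3) b(3) fr]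
    by (simp add: cone_map_cone)
qed

lemma cone_map_mul:
  assumes "a \<in> Cone C X Y" "b \<in> Cone C Y Z"
  shows "cone_map D F (cone_mul C a b) = cone_mul D (cone_map D F a) (cone_map D F b)"
proof -
  obtain p f q g where a: "a = cone C p f" "0 \<le> p" "f \<in> Hom C X Y" and b: "b = cone C q g" "0 \<le> q" "g \<in> Hom C Y Z"
    using assms by (elim C.ConeE)
  show ?thesis
    using a b C.cone_mul_cone[OF a(3) b(3) a(2) b(2)] D.cone_mul_cone[OF FA_Hom[OF a(3)] FA_Hom[OF b(3)] a(2) b(2)]
      cone_map_cone[OF C.seq_closed[OF a(3) b(3)], of "p * q"] FA_Seq[OF a(3) b(3)]
    by (simp add: cone_map_cone)
qed

lemma cone_map_scale:
  assumes "a \<in> Cone C X Y" "0 \<le> r"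
  shows "cone_map D F (cone_scale C r a) = cone_scale D r (cone_map D F a)"
  using assms(1) by (rule C.ConeE)
    (simp add: C.cone_scale_cone cone_map_cone D.cone_scale_cone[OF FA_Hom] assms(2))

lemma cone_map_zero:
  assumes "X \<in> Ob C" "Y \<in> Ob C"
  shows "cone_map D F (cone_zero C X Y) = cone_zero D (FO F X) (FO F Y)"
  using cone_map_cone[OF C.Star_closed[OF assms], of 0] FA_Star[OF assms] by (simp add: cone_zero_def)

lemma cone_map_sum:
  "\<lbrakk>X \<in> Ob C; Y \<in> Ob C; \<And>j. j < n \<Longrightarrow> a j \<in> Cone C X Y\<rbrakk> \<Longrightarrow>
   cone_map D F (cone_sum C X Y n a) = cone_sum D (FO F X) (FO F Y) n (\<lambda>j. cone_map D F (a j))"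
proof (induction n arbitrary: a)
  case (Suc n)
  have "a 0 \<in> Cone C X Y" "cone_sum C X Y n (\<lambda>j. a (Suc j)) \<in> Cone C X Y"
    using Suc.prems by (auto intro: C.cone_sum_closed)
  from cone_map_add[OF this] show ?case
    using Suc.IH[of "\<lambda>j. a (Suc j)"] Suc.prems by simp
qed (simp add: cone_map_zero)

lemma smat_map_simps: "sdom (smat_map F M) = map (FO F) (sdom M)" "scod (smat_map F M) = map (FO F) (scod M)"
  by (simp_all add: smat_map_def)

lemma smat_map_closed:
  assumes M: "M \<in> smats C"
  shows "smat_map F M \<in> smats D"
  unfolding smat_map_def
proof (rule mk_smat_closed)
  fix i assume "i < length (map (FO F) (sdom M))"
  then show "(\<Sum>j<length (map (FO F) (scod M)). fst (wgt M j i, FA F (arw M j i))) \<le> 1"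
    using smatsD(6)[OF M, of i] by simp
next
  fix i j assume "i < length (map (FO F) (sdom M))" "j < length (map (FO F) (scod M))"
  then show "0 \<le> fst (wgt M j i, FA F (arw M j i)) \<and>
    snd (wgt M j i, FA F (arw M j i)) \<in> Hom D (map (FO F) (sdom M) ! i) (map (FO F) (scod M) ! j)"
    using smatsD(3,5)[OF M, of i j] FA_Hom by simp
qed (use smatsD(1,2)[OF M] FO_Ob in auto)

lemma entry_smat_map:
  assumes M: "M \<in> smats C" and ij: "i < length (sdom M)" "j < length (scod M)"
  shows "entry D (smat_map F M) j i = cone_map D F (entry C M j i)"
  using cone_map_cone[OF smatsD(5)[OF M ij] smatsD(3)[OF M ij]] ij
  by (simp add: smat_map_def) (simp add: entry_def)

lemma FA_Stmat_fun:
  assumes M: "M \<in> smats C"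
  shows "FA (Stmat_fun C D F) (smat_class C M) = smat_class D (smat_map F M)"
proof -
  have *: "smat_class D (smat_map F M') = smat_class D (smat_map F M)" if "M' \<in> smat_class C M" for M'
  proof -
    have M': "M' \<in> smats C" "sdom M' = sdom M" "scod M' = scod M"
      "\<And>i j. i < length (sdom M) \<Longrightarrow> j < length (scod M) \<Longrightarrow> entry C M' j i = entry C M j i"
      using that by (auto simp: C.in_smat_class C.smat_eq_def)
    then show ?thesis
      by (intro D.smat_class_eqI smat_map_closed M) (auto simp: smat_map_simps entry_smat_map M)
  qed
  have "(\<Union>M'\<in>smat_class C M. smat_class D (smat_map F M')) = (\<Union>M'\<in>smat_class C M. smat_class D (smat_map F M))"
    using * by (intro SUP_cong refl)
  also have "\<dots> = smat_class D (smat_map F M)"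
    using C.smat_class_refl[OF M] by blast
  finally show ?thesis using M by (simp add: Stmat_fun_def)
qed

lemma FO_Stmat_fun: "set Us \<subseteq> Ob C \<Longrightarrow> FO (Stmat_fun C D F) Us = map (FO F) Us"
  by (auto simp: Stmat_fun_def in_lists_conv_set)

lemma smat_map_unit:
  assumes U: "smat_unit C Us Vs P \<in> smats C"
  shows "smat_class D (smat_map F (smat_unit C Us Vs P)) = smat_class D (smat_unit D (map (FO F) Us) (map (FO F) Vs) P)"
proof -
  have Ob: "Us ! i \<in> Ob C" "Vs ! j \<in> Ob C" if "i < length Us" "j < length Vs" for i j
    using smatsD(1,2)[OF U] that by auto
  have Hom: "Us ! i = Vs ! j" if "i < length Us" "j < length Vs" "P j i" for i j
    using smatsD(5)[OF U, of i j] that C.idn_closed[OF Ob(1)[OF that(1,2)]]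
    by (simp add: smat_unit_def Hom_def)
  have "smat_map F (smat_unit C Us Vs P) = smat_unit D (map (FO F) Us) (map (FO F) Vs) P"
    unfolding smat_map_def smat_unit_def mk_smat_def
    using Ob Hom by (auto intro!: eq_matI simp: FA_Idn FA_Star)
  then show ?thesis by simp
qed

text \<open>The entries of composites and convex combinations are built from sums, products and
  scalings in the cones, and \<open>cone_map\<close> commutes with all three.\<close>

lemma Stmat_fun_pca_hom: "Stmat_fun C D F \<in> pca_hom (Stmat C) (Stmat D)"
  unfolding pca_hom_def
proof (intro CollectI conjI ballI allI impI)
  show "FO (Stmat_fun C D F) \<in> Ob (Stmat C) \<rightarrow>\<^sub>E Ob (Stmat D)"
    using FO_Ob by (auto simp: Stmat_fun_def in_lists_conv_set)
  show "FA (Stmat_fun C D F) \<in> extensional (Ar (Stmat C))"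
    by (simp add: Stmat_fun_def)
next
  fix Us Vs A assume "A \<in> Hom (Stmat C) Us Vs"
  then obtain M where M: "M \<in> smats C" "sdom M = Us" "scod M = Vs" "A = smat_class C M"
    by (elim C.Stmat_HomE)
  show "FA (Stmat_fun C D F) A \<in> Hom (Stmat D) (FO (Stmat_fun C D F) Us) (FO (Stmat_fun C D F) Vs)"
    unfolding M(4) FA_Stmat_fun[OF M(1)] using M smatsD(1,2)[OF M(1)]
    by (intro D.Stmat_HomI smat_map_closed) (auto simp: smat_map_simps FO_Stmat_fun)
next
  fix Us assume "Us \<in> Ob (Stmat C)"
  then have U: "set Us \<subseteq> Ob C" by auto
  then show "FA (Stmat_fun C D F) (Idn (Stmat C) Us) = Idn (Stmat D) (FO (Stmat_fun C D F) Us)"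
    by (simp add: FA_Stmat_fun[OF C.Idn_smats] smat_map_unit[OF C.Idn_smats] FO_Stmat_fun)
next
  fix Us Vs Ws A B assume "A \<in> Hom (Stmat C) Us Vs" "B \<in> Hom (Stmat C) Vs Ws"
  then obtain M N where M: "M \<in> smats C" "sdom M = Us" "scod M = Vs" "A = smat_class C M"
    and N: "N \<in> smats C" "sdom N = Vs" "scod N = Ws" "B = smat_class C N"
    by (elim C.Stmat_HomE)
  have cl: "smat_seq C M N \<in> smats C" using C.smat_seq_closed[OF M(1) N(1)] M N by simp
  have "smat_class D (smat_map F (smat_seq C M N)) = smat_class D (smat_seq D (smat_map F M) (smat_map F N))"
  proof (rule D.smat_class_eqI)
    fix i u assume "i < length (sdom (smat_map F (smat_seq C M N)))" "u < length (scod (smat_map F (smat_seq C M N)))"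
    then have iu: "i < length Us" "u < length Ws" using M N by (auto simp: smat_map_simps)
    have X: "Us ! i \<in> Ob C" "Ws ! u \<in> Ob C"
      using smatsD(1)[OF M(1)] smatsD(2)[OF N(1)] M N iu nth_mem by blast+
    have c: "entry C M j i \<in> Cone C (Us ! i) (Vs ! j)" "entry C N u j \<in> Cone C (Vs ! j) (Ws ! u)" if "j < length Vs" for j
      using C.entry_closed[OF M(1)] C.entry_closed[OF N(1)] M N iu that by auto
    have "entry D (smat_map F (smat_seq C M N)) u i
        = cone_map D F (cone_sum C (Us ! i) (Ws ! u) (length Vs) (\<lambda>j. cone_mul C (entry C M j i) (entry C N u j)))"
      using entry_smat_map[OF cl, of i u] C.entry_seq[OF M(1) N(1), of i u] M N iu by simp
    also have "\<dots> = cone_sum D (FO F (Us ! i)) (FO F (Ws ! u)) (length Vs) (\<lambda>j. cone_map D F (cone_mul C (entry C M j i) (entry C N u j)))"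
      using C.cone_mul_closed[OF c] by (intro cone_map_sum[OF X])
    also have "\<dots> = entry D (smat_seq D (smat_map F M) (smat_map F N)) u i"
      using D.entry_seq[OF smat_map_closed[OF M(1)] smat_map_closed[OF N(1)], of i u] M N iu
        cone_map_mul[OF c] entry_smat_map[OF M(1)] entry_smat_map[OF N(1)]
      by (auto simp: smat_map_simps intro!: D.cone_sum_cong)
    finally show "entry D (smat_map F (smat_seq C M N)) u i = entry D (smat_seq D (smat_map F M) (smat_map F N)) u i" .
  qed (use M N cl in \<open>auto simp: smat_map_simps intro!: smat_map_closed D.smat_seq_closed\<close>)
  then show "FA (Stmat_fun C D F) (Seq (Stmat C) A B) = Seq (Stmat D) (FA (Stmat_fun C D F) A) (FA (Stmat_fun C D F) B)"
    using M N cl by (simp add: C.Seq_class D.Seq_class FA_Stmat_fun smat_map_closed smat_map_simps)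
next
  fix Us Vs assume "Us \<in> Ob (Stmat C)" "Vs \<in> Ob (Stmat C)"
  then have U: "set Us \<subseteq> Ob C" "set Vs \<subseteq> Ob C" by auto
  then show "FA (Stmat_fun C D F) (Star (Stmat C) Us Vs) = Star (Stmat D) (FO (Stmat_fun C D F) Us) (FO (Stmat_fun C D F) Vs)"
    by (simp add: FA_Stmat_fun[OF C.Star_smats] smat_map_unit[OF C.Star_smats] FO_Stmat_fun)
next
  fix Us Vs A B and p :: real assume "A \<in> Hom (Stmat C) Us Vs" "B \<in> Hom (Stmat C) Us Vs" and p: "0 < p \<and> p < 1"
  then obtain M N where M: "M \<in> smats C" "sdom M = Us" "scod M = Vs" "A = smat_class C M"
    and N: "N \<in> smats C" "sdom N = Us" "scod N = Vs" "B = smat_class C N"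
    by (elim C.Stmat_HomE)
  have cl: "smat_plus C p M N \<in> smats C" using C.smat_plus_closed[OF M(1) N(1)] M N p by simp
  have "smat_class D (smat_map F (smat_plus C p M N)) = smat_class D (smat_plus D p (smat_map F M) (smat_map F N))"
  proof (rule D.smat_class_eqI)
    fix i j assume "i < length (sdom (smat_map F (smat_plus C p M N)))" "j < length (scod (smat_map F (smat_plus C p M N)))"
    then have ij: "i < length Us" "j < length Vs" using M N by (auto simp: smat_map_simps)
    have c: "entry C M j i \<in> Cone C (Us ! i) (Vs ! j)" "entry C N j i \<in> Cone C (Us ! i) (Vs ! j)"
      using C.entry_closed[OF M(1)] C.entry_closed[OF N(1)] M N ij by auto
    have c2: "cone_scale C p (entry C M j i) \<in> Cone C (Us ! i) (Vs ! j)" "cone_scale C (1 - p) (entry C N j i) \<in> Cone C (Us ! i) (Vs ! j)"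
      using c p by (auto intro: C.cone_scale_closed)
    show "entry D (smat_map F (smat_plus C p M N)) j i = entry D (smat_plus D p (smat_map F M) (smat_map F N)) j i"
      using entry_smat_map[OF cl, of i j] C.entry_plus[OF M(1) N(1), of p i j] M N ij p
        D.entry_plus[OF smat_map_closed[OF M(1)] smat_map_closed[OF N(1)], of p i j]
        entry_smat_map[OF M(1), of i j] entry_smat_map[OF N(1), of i j] cone_map_add[OF c2] cone_map_scale[OF c(1), of p] cone_map_scale[OF c(2), of "1 - p"]
      by (simp add: smat_map_simps)
  qed (use M N cl p in \<open>auto simp: smat_map_simps intro!: smat_map_closed D.smat_plus_closed\<close>)
  then show "FA (Stmat_fun C D F) (Plus (Stmat C) p A B) = Plus (Stmat D) p (FA (Stmat_fun C D F) A) (FA (Stmat_fun C D F) B)"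
    using M N cl p by (simp add: C.Plus_class D.Plus_class FA_Stmat_fun smat_map_closed smat_map_simps)
qed

lemma Stmat_fun_units:
  assumes Us: "set Us \<subseteq> Ob C" and Vs: "set Vs \<subseteq> Ob C"
  shows "FA (Stmat_fun C D F) (Inj1 (Stmat C) Us Vs) = Inj1 (Stmat D) (map (FO F) Us) (map (FO F) Vs)"
    "FA (Stmat_fun C D F) (Inj2 (Stmat C) Us Vs) = Inj2 (Stmat D) (map (FO F) Us) (map (FO F) Vs)"
    "FA (Stmat_fun C D F) (Proj1 (Stmat C) Us Vs) = Proj1 (Stmat D) (map (FO F) Us) (map (FO F) Vs)"
    "FA (Stmat_fun C D F) (Proj2 (Stmat C) Us Vs) = Proj2 (Stmat D) (map (FO F) Us) (map (FO F) Vs)"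
  using assms C.Inj1_smats[OF assms] C.Inj2_smats[OF assms] C.Proj1_smats[OF assms] C.Proj2_smats[OF assms]
  by (simp_all add: FA_Stmat_fun smat_map_unit)

end

text \<open>Coproducts are unique up to isomorphism and functors preserve isomorphisms, so it
  suffices to treat one initial object and one coproduct for each pair. Existence is transported
  along the image of the comparison arrow u, and uniqueness by the equation that u followed by v is
  the identity.\<close>

lemma preserves_finite_coproductsI:
  assumes F: "pca_functor C D F"
    and Z: "is_initial C Z" "is_initial D (FO F Z)"
    and co: "\<And>X Y. \<lbrakk>X \<in> Ob C; Y \<in> Ob C\<rbrakk> \<Longrightarrow> \<exists>P i j. is_coproduct C X Y P i j \<and>
      is_coproduct D (FO F X) (FO F Y) (FO F P) (FA F i) (FA F j)"
  shows "preserves_finite_coproducts C D F"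
  unfolding preserves_finite_coproducts_def
proof (intro conjI allI impI)
  interpret pca_functor C D F by fact
  fix W assume W: "is_initial C W"
  obtain u where u: "u \<in> Hom C W Z" using W Z(1) by (auto simp: is_initial_def)
  obtain v where v: "v \<in> Hom C Z W" using W Z(1) by (auto simp: is_initial_def)
  have WO: "W \<in> Ob C" using W by (simp add: is_initial_def)
  have "Seq C u v = Idn C W"
    using W WO C.seq_closed[OF u v] C.idn_closed[OF WO] by (auto simp: is_initial_def)
  then have uv: "Seq D (FA F u) (FA F v) = Idn D (FO F W)" using FA_Seq[OF u v] FA_Idn[OF WO] by simp
  show "is_initial D (FO F W)"
    unfolding is_initial_def
  proof (intro conjI ballI FO_Ob WO)
    fix A assume "A \<in> Ob D"
    then obtain f where f: "f \<in> Hom D (FO F Z) A" "\<And>g. g \<in> Hom D (FO F Z) A \<Longrightarrow> g = f"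
      using Z(2) unfolding is_initial_def by blast
    show "\<exists>!h. h \<in> Hom D (FO F W) A"
    proof (rule ex1I)
      show "Seq D (FA F u) f \<in> Hom D (FO F W) A" using D.seq_closed[OF FA_Hom[OF u] f(1)] .
      fix h assume h: "h \<in> Hom D (FO F W) A"
      have "h = Seq D (FA F u) (Seq D (FA F v) h)"
        using D.seq_idn_left[OF h] D.seq_assoc[OF FA_Hom[OF u] FA_Hom[OF v] h] uv by simp
      then show "h = Seq D (FA F u) f" using f(2)[OF D.seq_closed[OF FA_Hom[OF v] h]] by simp
    qed
  qed
next
  interpret pca_functor C D F by fact
  fix X Y P i1 i2 assume P: "is_coproduct C X Y P i1 i2"
  then have XY: "X \<in> Ob C" "Y \<in> Ob C" "P \<in> Ob C" and i: "i1 \<in> Hom C X P" "i2 \<in> Hom C Y P"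
    by (auto simp: is_coproduct_def)
  obtain Q j1 j2 where Q: "is_coproduct C X Y Q j1 j2" "is_coproduct D (FO F X) (FO F Y) (FO F Q) (FA F j1) (FA F j2)"
    using co XY by blast
  then have QO: "Q \<in> Ob C" and j: "j1 \<in> Hom C X Q" "j2 \<in> Hom C Y Q"
    by (auto simp: is_coproduct_def)
  obtain u where u: "u \<in> Hom C P Q" "Seq C i1 u = j1" "Seq C i2 u = j2"
    using P QO j unfolding is_coproduct_def by blast
  obtain v where v: "v \<in> Hom C Q P" "Seq C j1 v = i1" "Seq C j2 v = i2"
    using Q(1) XY i unfolding is_coproduct_def by blast
  have "\<exists>!h. h \<in> Hom C P P \<and> Seq C i1 h = i1 \<and> Seq C i2 h = i2"
    using P i XY unfolding is_coproduct_def by blast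
  moreover have "Seq C u v \<in> Hom C P P" "Seq C i1 (Seq C u v) = i1" "Seq C i2 (Seq C u v) = i2"
    using C.seq_closed[OF u(1) v(1)] C.seq_assoc[OF i(1) u(1) v(1)] C.seq_assoc[OF i(2) u(1) v(1)] u v by simp_all
  moreover have "Idn C P \<in> Hom C P P" "Seq C i1 (Idn C P) = i1" "Seq C i2 (Idn C P) = i2"
    using C.idn_closed[OF XY(3)] C.seq_idn_right i by auto
  ultimately have "Seq C u v = Idn C P" by blast
  then have uv: "Seq D (FA F u) (FA F v) = Idn D (FO F P)" using FA_Seq[OF u(1) v(1)] FA_Idn[OF XY(3)] by simp
  note Fu = FA_Hom[OF u(1)] and Fv = FA_Hom[OF v(1)] and Fi = FA_Hom[OF i(1)] FA_Hom[OF i(2)] and Fj = FA_Hom[OF j(1)] FA_Hom[OF j(2)]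
  have Fiu: "Seq D (FA F i1) (FA F u) = FA F j1" "Seq D (FA F i2) (FA F u) = FA F j2"
    using FA_Seq[OF i(1) u(1)] FA_Seq[OF i(2) u(1)] u by simp_all
  have Fjv: "Seq D (FA F j1) (FA F v) = FA F i1" "Seq D (FA F j2) (FA F v) = FA F i2"
    using FA_Seq[OF j(1) v(1)] FA_Seq[OF j(2) v(1)] v by simp_all
  show "is_coproduct D (FO F X) (FO F Y) (FO F P) (FA F i1) (FA F i2)"
    unfolding is_coproduct_def
  proof (intro conjI ballI FO_Ob XY Fi)
    fix A f1 f2 assume f: "A \<in> Ob D" "f1 \<in> Hom D (FO F X) A" "f2 \<in> Hom D (FO F Y) A"
    then have ex1: "\<exists>!h. h \<in> Hom D (FO F Q) A \<and> Seq D (FA F j1) h = f1 \<and> Seq D (FA F j2) h = f2"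
      using Q(2) unfolding is_coproduct_def by blast
    then obtain h0 where h0: "h0 \<in> Hom D (FO F Q) A" "Seq D (FA F j1) h0 = f1" "Seq D (FA F j2) h0 = f2" by blast
    show "\<exists>!h. h \<in> Hom D (FO F P) A \<and> Seq D (FA F i1) h = f1 \<and> Seq D (FA F i2) h = f2"
    proof (rule ex1I)
      show "Seq D (FA F u) h0 \<in> Hom D (FO F P) A \<and> Seq D (FA F i1) (Seq D (FA F u) h0) = f1 \<and> Seq D (FA F i2) (Seq D (FA F u) h0) = f2"
        using D.seq_closed[OF Fu h0(1)] D.seq_assoc[OF Fi(1) Fu h0(1)] D.seq_assoc[OF Fi(2) Fu h0(1)] Fiu h0 by simp
      fix h assume h: "h \<in> Hom D (FO F P) A \<and> Seq D (FA F i1) h = f1 \<and> Seq D (FA F i2) h = f2"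
      then have "Seq D (FA F v) h \<in> Hom D (FO F Q) A" "Seq D (FA F j1) (Seq D (FA F v) h) = f1" "Seq D (FA F j2) (Seq D (FA F v) h) = f2"
        using D.seq_closed[OF Fv, of h] D.seq_assoc[OF Fj(1) Fv, of h A] D.seq_assoc[OF Fj(2) Fv, of h A] Fjv by simp_all
      then have "Seq D (FA F v) h = h0" using ex1 h0 by blast
      then show "h = Seq D (FA F u) h0"
        using D.seq_idn_left[of h "FO F P" A] D.seq_assoc[OF Fu Fv, of h A] uv h by simp
    qed
  qed
qed

section \<open>The forgetful functor, identities and composites\<close>

lemma forget_simps [simp]:
  "Ob (forget D) = Ob D" "Ar (forget D) = Ar D" "Src (forget D) = Src D" "Tgt (forget D) = Tgt D"
  "Idn (forget D) = Idn D" "Seq (forget D) = Seq D" "Star (forget D) = Star D" "Plus (forget D) = Plus D"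
  "Hom (forget D) = Hom D"
  by (auto simp: forget_def pca_cat.truncate_def Hom_def fun_eq_iff)

lemma pca_hom_forget_left [simp]: "pca_hom (forget C) D = pca_hom C D"
  by (simp add: pca_hom_def)

lemma pca_hom_forget_right [simp]: "pca_hom C (forget D) = pca_hom C D"
  by (simp add: pca_hom_def)

lemma nat_trans_forget [simp]: "nat_trans C (forget D) = nat_trans C D"
  by (simp add: nat_trans_def fun_eq_iff)

lemma funct_eqI:
  assumes "F \<in> pca_hom C D" "G \<in> pca_hom C D'"
    "\<And>X. X \<in> Ob C \<Longrightarrow> FO F X = FO G X" "\<And>f. f \<in> Ar C \<Longrightarrow> FA F f = FA G f"
  shows "F = G"
proof -
  have "FO F = FO G" "FA F = FA G"
    using assms by (auto intro!: extensionalityI[of _ "Ob C"] extensionalityI[of _ "Ar C"] simp: pca_hom_def PiE_iff)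
  then show ?thesis by simp
qed

lemma funct_comp_pca_hom:
  assumes "pca_functor C D F" "pca_functor D E G"
  shows "funct_comp C F G \<in> pca_hom C E"
proof -
  interpret F: pca_functor C D F by fact
  interpret G: pca_functor D E G by fact
  have FA: "FA (funct_comp C F G) f = FA G (FA F f)" if "f \<in> Hom C X Y" for f X Y
    using that by (auto simp: funct_comp_def compose_def dest: Hom_Ar)
  have FO: "FO (funct_comp C F G) X = FO G (FO F X)" if "X \<in> Ob C" for X
    using that by (simp add: funct_comp_def compose_def)
  show ?thesis
    unfolding pca_hom_def
  proof (intro CollectI conjI ballI allI impI)
    show "FO (funct_comp C F G) \<in> Ob C \<rightarrow>\<^sub>E Ob E"
      using F.FO_Ob G.FO_Ob by (auto simp: funct_comp_def compose_def)
    show "FA (funct_comp C F G) \<in> extensional (Ar C)" by (simp add: funct_comp_def)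
  next
    fix X Y f g and p :: real assume *: "X \<in> Ob C" "Y \<in> Ob C" "f \<in> Hom C X Y" "g \<in> Hom C X Y" "0 < p \<and> p < 1"
    then have "Plus C p f g \<in> Hom C X Y"
      using pca.plus_closed[OF F.C.pca_Hom] by blast
    then show "FA (funct_comp C F G) (Plus C p f g) = Plus E p (FA (funct_comp C F G) f) (FA (funct_comp C F G) g)"
      using * FA F.FA_Plus[OF *(3,4)] G.FA_Plus[OF F.FA_Hom[OF *(3)] F.FA_Hom[OF *(4)]] by simp
  next
    fix X Y f assume *: "X \<in> Ob C" "Y \<in> Ob C" "f \<in> Hom C X Y"
    then show "FA (funct_comp C F G) f \<in> Hom E (FO (funct_comp C F G) X) (FO (funct_comp C F G) Y)"
      using FA[OF *(3)] FO G.FA_Hom[OF F.FA_Hom[OF *(3)]] by simp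
  next
    fix X assume *: "X \<in> Ob C"
    then show "FA (funct_comp C F G) (Idn C X) = Idn E (FO (funct_comp C F G) X)"
      using FA[OF F.C.idn_closed[OF *]] FO F.FA_Idn G.FA_Idn F.FO_Ob by simp
  next
    fix X Y assume *: "X \<in> Ob C" "Y \<in> Ob C"
    then show "FA (funct_comp C F G) (Star C X Y) = Star E (FO (funct_comp C F G) X) (FO (funct_comp C F G) Y)"
      using FA[OF F.C.Star_closed[OF *]] FO F.FA_Star G.FA_Star F.FO_Ob by simp
  next
    fix X Y Z f g assume *: "X \<in> Ob C" "Y \<in> Ob C" "Z \<in> Ob C" "f \<in> Hom C X Y" "g \<in> Hom C Y Z"
    then show "FA (funct_comp C F G) (Seq C f g) = Seq E (FA (funct_comp C F G) f) (FA (funct_comp C F G) g)"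
      using FA[OF F.C.seq_closed[OF *(4,5)]] FA[OF *(4)] FA[OF *(5)] F.FA_Seq[OF *(4,5)] G.FA_Seq[OF F.FA_Hom[OF *(4)] F.FA_Hom[OF *(5)]] by simp
  qed
qed

lemma Stmat_fun_strict:
  assumes "pca_functor C D F"
  shows "Stmat_fun C D F \<in> strict_cb_hom (Stmat C) (Stmat D)"
proof -
  interpret pca_functor C D F by fact
  have pf: "pca_functor (Stmat C) (Stmat D) (Stmat_fun C D F)"
    by (intro pca_functor.intro pca_functor_axioms.intro C.Stmat_category D.Stmat_category Stmat_fun_pca_hom)
  have "preserves_finite_coproducts (Stmat C) (Stmat D) (Stmat_fun C D F)"
  proof (rule preserves_finite_coproductsI[OF pf C.Stmat_initial])
    show "is_initial (Stmat D) (FO (Stmat_fun C D F) [])" using D.Stmat_initial FO_Stmat_fun[of "[]"] by simp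
    fix Us Vs assume "Us \<in> Ob (Stmat C)" "Vs \<in> Ob (Stmat C)"
    then have U: "set Us \<subseteq> Ob C" "set Vs \<subseteq> Ob C" by auto
    then have U': "set (map (FO F) Us) \<subseteq> Ob D" "set (map (FO F) Vs) \<subseteq> Ob D" using FO_Ob by auto
    show "\<exists>P i j. is_coproduct (Stmat C) Us Vs P i j \<and>
       is_coproduct (Stmat D) (FO (Stmat_fun C D F) Us) (FO (Stmat_fun C D F) Vs) (FO (Stmat_fun C D F) P) (FA (Stmat_fun C D F) i) (FA (Stmat_fun C D F) j)"
      using C.Stmat_coproduct[OF U] D.Stmat_coproduct[OF U'] Stmat_fun_units(1,2)[OF U] U
      by (metis FO_Stmat_fun Un_subset_iff map_append set_append)
  qed
  then have "Stmat_fun C D F \<in> cb_hom (Stmat C) (Stmat D)"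
    using Stmat_fun_pca_hom by (simp add: cb_hom_def)
  moreover have "FO (Stmat_fun C D F) [] = []" using FO_Stmat_fun[of "[]"] by simp
  ultimately show ?thesis
    unfolding strict_cb_hom_def
  proof (intro CollectI conjI ballI)
    fix Us Vs assume "Us \<in> Ob (Stmat C)" "Vs \<in> Ob (Stmat C)"
    then have U: "set Us \<subseteq> Ob C" "set Vs \<subseteq> Ob C" "set (Us @ Vs) \<subseteq> Ob C" by auto
    show "FO (Stmat_fun C D F) (Oplus (Stmat C) Us Vs) = Oplus (Stmat D) (FO (Stmat_fun C D F) Us) (FO (Stmat_fun C D F) Vs)"
      using FO_Stmat_fun U by simp
    show "FA (Stmat_fun C D F) (Inj1 (Stmat C) Us Vs) = Inj1 (Stmat D) (FO (Stmat_fun C D F) Us) (FO (Stmat_fun C D F) Vs)"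
      "FA (Stmat_fun C D F) (Inj2 (Stmat C) Us Vs) = Inj2 (Stmat D) (FO (Stmat_fun C D F) Us) (FO (Stmat_fun C D F) Vs)"
      "FA (Stmat_fun C D F) (Proj1 (Stmat C) Us Vs) = Proj1 (Stmat D) (FO (Stmat_fun C D F) Us) (FO (Stmat_fun C D F) Vs)"
      "FA (Stmat_fun C D F) (Proj2 (Stmat C) Us Vs) = Proj2 (Stmat D) (FO (Stmat_fun C D F) Us) (FO (Stmat_fun C D F) Vs)"
      using Stmat_fun_units[OF U(1,2)] FO_Stmat_fun U by simp_all
  qed auto
qed

lemma funct_id_functor:
  assumes "pca_category C"
  shows "pca_functor C C (funct_id C)"
proof -
  interpret pca_category C by fact
  have "funct_id C \<in> pca_hom C C"
    unfolding pca_hom_def funct_id_def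
    by (auto simp: Hom_Ar[OF idn_closed] Hom_Ar[OF seq_closed] Hom_Ar[OF Star_closed] Hom_Ar Hom_Ar[OF pca.plus_closed[OF pca_Hom]])
  then show ?thesis by (intro pca_functor.intro assms pca_functor_axioms.intro)
qed

lemma Stmat_fun_id:
  assumes "pca_category C"
  shows "Stmat_fun C C (funct_id C) = funct_id (Stmat C)"
proof -
  interpret pca_functor C C "funct_id C" using assms by (rule funct_id_functor)
  interpret S: pca_functor "Stmat C" "Stmat C" "funct_id (Stmat C)" using C.Stmat_category by (rule funct_id_functor)
  show ?thesis
  proof (rule funct_eqI[OF Stmat_fun_pca_hom S.F])
    fix Us assume "Us \<in> Ob (Stmat C)"
    then have "set Us \<subseteq> Ob C" by auto
    then have "FO (Stmat_fun C C (funct_id C)) Us = Us"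
      unfolding FO_Stmat_fun[OF \<open>set Us \<subseteq> Ob C\<close>] by (auto simp: funct_id_def intro!: map_idI)
    then show "FO (Stmat_fun C C (funct_id C)) Us = FO (funct_id (Stmat C)) Us"
      using \<open>Us \<in> _\<close> by (simp add: funct_id_def)
  next
    fix A assume "A \<in> Ar (Stmat C)"
    then obtain M where M: "M \<in> smats C" "A = smat_class C M" by auto
    have "map (FO (funct_id C)) Us = Us" if "set Us \<subseteq> Ob C" for Us
      using that by (auto simp: funct_id_def intro!: map_idI)
    then have d: "map (FO (funct_id C)) (sdom M) = sdom M" "map (FO (funct_id C)) (scod M) = scod M"
      using smatsD(1,2)[OF M(1)] by auto
    have "smat_class C (smat_map (funct_id C) M) = smat_class C M"
    proof (rule C.smat_class_eqI[OF smat_map_closed[OF M(1)] M(1)])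
      fix i j assume "i < length (sdom (smat_map (funct_id C) M))" "j < length (scod (smat_map (funct_id C) M))"
      then have ij: "i < length (sdom M)" "j < length (scod M)" by (auto simp: smat_map_simps)
      show "entry C (smat_map (funct_id C) M) j i = entry C M j i"
        using Hom_Ar[OF smatsD(5)[OF M(1) ij]] ij by (simp add: smat_map_def funct_id_def) (simp add: entry_def)
    qed (simp_all add: smat_map_simps d)
    then show "FA (Stmat_fun C C (funct_id C)) A = FA (funct_id (Stmat C)) A"
      using M FA_Stmat_fun[OF M(1)] by (simp add: funct_id_def)
  qed
qed

lemma Stmat_fun_comp:
  assumes "pca_functor C D F" "pca_functor D E G"
  shows "Stmat_fun C E (funct_comp C F G) = funct_comp (Stmat C) (Stmat_fun C D F) (Stmat_fun D E G)"
proof -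
  interpret F: pca_functor C D F by fact
  interpret G: pca_functor D E G by fact
  interpret FG: pca_functor C E "funct_comp C F G"
    by (intro pca_functor.intro pca_functor_axioms.intro F.C.pca_category_axioms G.D.pca_category_axioms funct_comp_pca_hom[OF assms])
  interpret SF: pca_functor "Stmat C" "Stmat D" "Stmat_fun C D F"
    by (intro pca_functor.intro pca_functor_axioms.intro F.C.Stmat_category F.D.Stmat_category F.Stmat_fun_pca_hom)
  interpret SG: pca_functor "Stmat D" "Stmat E" "Stmat_fun D E G"
    by (intro pca_functor.intro pca_functor_axioms.intro F.D.Stmat_category G.D.Stmat_category G.Stmat_fun_pca_hom)
  show ?thesis
  proof (rule funct_eqI[OF FG.Stmat_fun_pca_hom funct_comp_pca_hom[OF SF.pca_functor_axioms SG.pca_functor_axioms]])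
    fix Us assume "Us \<in> Ob (Stmat C)"
    then have U: "set Us \<subseteq> Ob C" by auto
    then have "set (map (FO F) Us) \<subseteq> Ob D" using F.FO_Ob by auto
    then show "FO (Stmat_fun C E (funct_comp C F G)) Us = FO (funct_comp (Stmat C) (Stmat_fun C D F) (Stmat_fun D E G)) Us"
      using U \<open>Us \<in> _\<close> FG.FO_Stmat_fun[OF U] F.FO_Stmat_fun[OF U] G.FO_Stmat_fun[of "map (FO F) Us"]
      by (auto simp: funct_comp_def compose_def)
  next
    fix A assume A: "A \<in> Ar (Stmat C)"
    then obtain M where M: "M \<in> smats C" "A = smat_class C M" by auto
    have "map (FO (funct_comp C F G)) Us = map (FO G) (map (FO F) Us)" if "set Us \<subseteq> Ob C" for Us
      using that by (auto simp: funct_comp_def compose_def)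
    then have d: "map (FO (funct_comp C F G)) (sdom M) = map (FO G) (map (FO F) (sdom M))"
      "map (FO (funct_comp C F G)) (scod M) = map (FO G) (map (FO F) (scod M))"
      using smatsD(1,2)[OF M(1)] by auto
    have "smat_class E (smat_map (funct_comp C F G) M) = smat_class E (smat_map G (smat_map F M))"
    proof (rule G.D.smat_class_eqI[OF FG.smat_map_closed[OF M(1)] G.smat_map_closed[OF F.smat_map_closed[OF M(1)]]])
      fix i j assume "i < length (sdom (smat_map (funct_comp C F G) M))" "j < length (scod (smat_map (funct_comp C F G) M))"
      then have ij: "i < length (sdom M)" "j < length (scod M)" by (auto simp: FG.smat_map_simps)
      show "entry E (smat_map (funct_comp C F G) M) j i = entry E (smat_map G (smat_map F M)) j i"
        using Hom_Ar[OF smatsD(5)[OF M(1) ij]] ij by (simp add: smat_map_def funct_comp_def compose_def)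
    qed (simp_all add: FG.smat_map_simps F.smat_map_simps G.smat_map_simps d del: map_map)
    then show "FA (Stmat_fun C E (funct_comp C F G)) A = FA (funct_comp (Stmat C) (Stmat_fun C D F) (Stmat_fun D E G)) A"
      using M A FG.FA_Stmat_fun[OF M(1)] F.FA_Stmat_fun[OF M(1)] G.FA_Stmat_fun[OF F.smat_map_closed[OF M(1)]]
      by (simp add: funct_comp_def compose_def)
  qed
qed


section \<open>The unit and finite coproducts\<close>

lemma pca_functorI: "\<lbrakk>pca_category C; pca_category D; F \<in> pca_hom C D\<rbrakk> \<Longrightarrow> pca_functor C D F"
  by (intro pca_functor.intro pca_functor_axioms.intro)

lemma FO_funct_comp: "X \<in> Ob C \<Longrightarrow> FO (funct_comp C F G) X = FO G (FO F X)"
  and FA_funct_comp: "f \<in> Ar C \<Longrightarrow> FA (funct_comp C F G) f = FA G (FA F f)"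
  by (simp_all add: funct_comp_def compose_def)

context pca_category
begin

definition single :: "'a \<Rightarrow> ('o, 'a) smat" where
  "single f = mk_smat [Src C f] [Tgt C f] (\<lambda>j i. (1, f))"

lemma single_simps: "f \<in> Hom C X Y \<Longrightarrow> sdom (single f) = [X]" "f \<in> Hom C X Y \<Longrightarrow> scod (single f) = [Y]"
  by (simp_all add: single_def Hom_def)

lemma single_closed: "f \<in> Hom C X Y \<Longrightarrow> single f \<in> smats C"
  using Hom_Ob[of f X Y] unfolding single_def by (intro mk_smat_closed) (auto simp: Hom_Src Hom_Tgt)

lemma entry_single: "f \<in> Hom C X Y \<Longrightarrow> entry C (single f) 0 0 = cone C 1 f"
  by (simp add: single_def)

lemma FO_eta: "X \<in> Ob C \<Longrightarrow> FO (eta C) X = [X]"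
  and FA_eta: "f \<in> Hom C X Y \<Longrightarrow> FA (eta C) f = smat_class C (single f)"
  by (simp_all add: eta_def single_def Hom_Ar)

lemma single_class_eqI:
  assumes "f \<in> Hom C X Y" "N \<in> smats C" "sdom N = [X]" "scod N = [Y]" "entry C N 0 0 = cone C 1 f"
  shows "smat_class C (single f) = smat_class C N"
  using assms by (intro smat_class_eqI single_closed[OF assms(1)])
    (auto simp: single_simps[OF assms(1)] entry_single[OF assms(1)])

lemma eta_pca_hom: "eta C \<in> pca_hom C (Stmat C)"
  unfolding pca_hom_def
proof (intro CollectI conjI ballI allI impI)
  show "FO (eta C) \<in> Ob C \<rightarrow>\<^sub>E Ob (Stmat C)" "FA (eta C) \<in> extensional (Ar C)"
    by (auto simp: eta_def)
next
  fix X Y f assume *: "X \<in> Ob C" "Y \<in> Ob C" "f \<in> Hom C X Y"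
  then show "FA (eta C) f \<in> Hom (Stmat C) (FO (eta C) X) (FO (eta C) Y)"
    using FO_eta FA_eta[OF *(3)] by (auto intro!: Stmat_HomI single_closed simp: single_simps)
next
  fix X assume X: "X \<in> Ob C"
  have U: "set [X] \<subseteq> Ob C" using X by simp
  have "smat_class C (single (Idn C X)) = smat_class C (smat_unit C [X] [X] (\<lambda>j i. j = i))"
    by (rule single_class_eqI[OF idn_closed[OF X] Idn_smats[OF U]]) (simp_all add: entry_unit)
  then show "FA (eta C) (Idn C X) = Idn (Stmat C) (FO (eta C) X)"
    using X by (simp add: FA_eta[OF idn_closed[OF X]] FO_eta)
next
  fix X Y assume XY: "X \<in> Ob C" "Y \<in> Ob C"
  then have U: "set [X] \<subseteq> Ob C" "set [Y] \<subseteq> Ob C" by simp_all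
  have "smat_class C (single (Star C X Y)) = smat_class C (smat_unit C [X] [Y] (\<lambda>j i. False))"
    by (rule single_class_eqI[OF Star_closed[OF XY] Star_smats[OF U]]) (simp_all add: entry_unit cone_Star XY)
  then show "FA (eta C) (Star C X Y) = Star (Stmat C) (FO (eta C) X) (FO (eta C) Y)"
    using XY by (simp add: FA_eta[OF Star_closed[OF XY]] FO_eta)
next
  fix X Y Z f g assume *: "X \<in> Ob C" "Y \<in> Ob C" "Z \<in> Ob C" "f \<in> Hom C X Y" "g \<in> Hom C Y Z"
  note cl = single_closed[OF *(4)] single_closed[OF *(5)]
  note fg = seq_closed[OF *(4,5)]
  have "entry C (smat_seq C (single f) (single g)) 0 0 = cone_sum C X Z (Suc 0) (\<lambda>j. cone_mul C (entry C (single f) j 0) (entry C (single g) 0 j))"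
    using entry_seq[OF cl, of 0 0] by (simp add: single_simps[OF *(4)] single_simps[OF *(5)])
  also have "\<dots> = cone C 1 (Seq C f g)"
    using cone_mul_cone[OF *(4,5), of 1 1] cone_add_zero(2)[OF cone_closed[OF fg, of 1]]
    by (simp add: entry_single[OF *(4)] entry_single[OF *(5)])
  finally have "smat_class C (single (Seq C f g)) = smat_class C (smat_seq C (single f) (single g))"
    using smat_seq_closed[OF cl] by (intro single_class_eqI[OF fg]) (simp_all add: single_simps[OF *(4)] single_simps[OF *(5)])
  then show "FA (eta C) (Seq C f g) = Seq (Stmat C) (FA (eta C) f) (FA (eta C) g)"
    using Seq_class[OF cl] by (simp add: FA_eta[OF fg] FA_eta[OF *(4)] FA_eta[OF *(5)] single_simps[OF *(4)] single_simps[OF *(5)])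
next
  fix X Y f g and p :: real assume *: "X \<in> Ob C" "Y \<in> Ob C" "f \<in> Hom C X Y" "g \<in> Hom C X Y" and p: "0 < p \<and> p < 1"
  note cl = single_closed[OF *(3)] single_closed[OF *(4)]
  note si = single_simps[OF *(3)] single_simps[OF *(4)]
  have fg: "Plus C p f g \<in> Hom C X Y" using pca.plus_closed[OF pca_Hom[OF *(1,2)]] * p by blast
  have "entry C (smat_plus C p (single f) (single g)) 0 0 = cone C 1 (Plus C p f g)"
    using entry_plus[OF cl, of p 0 0] cone_cplus[OF *(3,4), of p] p cone_scale_cone[OF *(3), of 1 p] cone_scale_cone[OF *(4), of 1 "1 - p"]
    by (simp add: si entry_single[OF *(3)] entry_single[OF *(4)] cplus_def)
  then have "smat_class C (single (Plus C p f g)) = smat_class C (smat_plus C p (single f) (single g))"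
    using smat_plus_closed[OF cl, of p] p by (intro single_class_eqI[OF fg]) (simp_all add: si)
  then show "FA (eta C) (Plus C p f g) = Plus (Stmat C) p (FA (eta C) f) (FA (eta C) g)"
    using Plus_class[OF cl, of p] p by (simp add: FA_eta[OF fg] FA_eta[OF *(3)] FA_eta[OF *(4)] si)
qed

lemma eta_functor: "pca_functor C (Stmat C) (eta C)"
  by (intro pca_functorI pca_category_axioms Stmat_category eta_pca_hom)

text \<open>The starting point of the uniqueness proofs: a functor that commutes with scaling is
  fixed on arrows between one-letter words by its composite with the unit.\<close>

lemma Stmat_single_arrow:
  assumes "A \<in> Hom (Stmat C) [X] [Y]"
  obtains p f where "0 \<le> p" "p \<le> 1" "f \<in> Hom C X Y" "A = scale (Stmat C) p (FA (eta C) f)"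
proof -
  obtain M where M: "M \<in> smats C" "sdom M = [X]" "scod M = [Y]" "A = smat_class C M"
    using assms by (elim Stmat_HomE)
  have p: "0 \<le> wgt M 0 0" "wgt M 0 0 \<le> 1" and f: "arw M 0 0 \<in> Hom C X Y"
    using smatsD(3-5)[OF M(1), of 0 0] M by auto
  note si = single_simps[OF f]
  obtain K where K: "scale (Stmat C) (wgt M 0 0) (smat_class C (single (arw M 0 0))) = smat_class C K" "K \<in> smats C"
      "sdom K = [X]" "scod K = [Y]" "entry C K 0 0 = cone_scale C (wgt M 0 0) (cone C 1 (arw M 0 0))"
    using scale_class[OF single_closed[OF f] p] unfolding si by (metis entry_single[OF f] length_Cons zero_less_Suc)
  have "entry C K 0 0 = entry C M 0 0"
    using K(5) cone_scale_cone[OF f, of 1 "wgt M 0 0"] p by (simp add: entry_def)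
  then have "smat_class C M = smat_class C K"
    using M K by (intro smat_class_eqI) auto
  then show thesis using that[OF p f] K(1) FA_eta[OF f] M(4) by simp
qed

end

lemma transpose_fun_functor:
  assumes "pca_functor (Stmat C) D H" "pca_category C"
  shows "pca_functor C D (transpose_fun C H)"
proof -
  interpret C: pca_category C by fact
  interpret H: pca_functor "Stmat C" D H by fact
  show ?thesis unfolding transpose_fun_def
    by (intro pca_functorI C.pca_category_axioms H.D.pca_category_axioms funct_comp_pca_hom[OF C.eta_functor assms(1)])
qed

lemma eta_natural:
  assumes "pca_functor C D F"
  shows "funct_comp C (eta C) (Stmat_fun C D F) = funct_comp C F (eta D)"
proof -
  interpret pca_functor C D F by fact
  interpret S: pca_functor "Stmat C" "Stmat D" "Stmat_fun C D F"
    by (intro pca_functorI C.Stmat_category D.Stmat_category Stmat_fun_pca_hom)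
  show ?thesis
  proof (rule funct_eqI[OF funct_comp_pca_hom[OF C.eta_functor S.pca_functor_axioms] funct_comp_pca_hom[OF assms D.eta_functor]])
    fix X assume "X \<in> Ob C"
    then show "FO (funct_comp C (eta C) (Stmat_fun C D F)) X = FO (funct_comp C F (eta D)) X"
      by (simp add: FO_funct_comp C.FO_eta D.FO_eta FO_Ob FO_Stmat_fun)
  next
    fix f assume f: "f \<in> Ar C"
    define X Y where "X = Src C f" and "Y = Tgt C f"
    have fH: "f \<in> Hom C X Y" using f by (simp add: Hom_def X_def Y_def)
    note M = C.single_closed[OF fH]
    have "smat_class D (D.single (FA F f)) = smat_class D (smat_map F (C.single f))"
      using smat_map_closed[OF M] entry_smat_map[OF M, of 0 0] cone_map_cone[OF fH, of 1]
      by (intro D.single_class_eqI[OF FA_Hom[OF fH]]) (simp_all add: smat_map_simps C.single_simps[OF fH] C.entry_single[OF fH])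
    then show "FA (funct_comp C (eta C) (Stmat_fun C D F)) f = FA (funct_comp C F (eta D)) f"
      using f by (simp add: FA_funct_comp C.FA_eta[OF fH] D.FA_eta[OF FA_Hom[OF fH]] FA_Stmat_fun[OF M])
  qed
qed

lemma funct_comp_assoc:
  assumes "pca_functor C D F" "pca_functor D E G" "pca_functor E E' K"
  shows "funct_comp C (funct_comp C F G) K = funct_comp C F (funct_comp D G K)"
proof -
  interpret F: pca_functor C D F by fact
  interpret G: pca_functor D E G by fact
  interpret K: pca_functor E E' K by fact
  have *: "pca_functor C E (funct_comp C F G)" "pca_functor D E' (funct_comp D G K)"
    by (intro pca_functorI F.C.pca_category_axioms F.D.pca_category_axioms G.D.pca_category_axioms K.D.pca_category_axioms
        funct_comp_pca_hom[OF assms(1,2)] funct_comp_pca_hom[OF assms(2,3)])+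
  show ?thesis
    by (rule funct_eqI[OF funct_comp_pca_hom[OF *(1) assms(3)] funct_comp_pca_hom[OF assms(1) *(2)]])
      (simp_all add: FO_funct_comp FA_funct_comp F.FO_Ob Hom_Ar[OF F.FA_Hom[OF HomI]])
qed

section \<open>Coproducts of words\<close>

definition is_ncoproduct :: "('o, 'a, 'z) pca_cat_scheme \<Rightarrow> 'o list \<Rightarrow> 'o \<Rightarrow> (nat \<Rightarrow> 'a) \<Rightarrow> bool" where
  "is_ncoproduct C Ws P k \<longleftrightarrow> P \<in> Ob C \<and> (\<forall>i<length Ws. k i \<in> Hom C (Ws ! i) P) \<and>
     (\<forall>A\<in>Ob C. \<forall>f. (\<forall>i<length Ws. f i \<in> Hom C (Ws ! i) A) \<longrightarrow>
        (\<exists>!h. h \<in> Hom C P A \<and> (\<forall>i<length Ws. Seq C (k i) h = f i)))"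

context pca_category
begin

lemma ncoproduct_eqI:
  assumes "is_ncoproduct C Ws P k" "h \<in> Hom C P A" "h' \<in> Hom C P A"
    "\<And>i. i < length Ws \<Longrightarrow> Seq C (k i) h = Seq C (k i) h'"
  shows "h = h'"
proof -
  have "A \<in> Ob C" "\<forall>i<length Ws. Seq C (k i) h' \<in> Hom C (Ws ! i) A"
    using assms Hom_Ob seq_closed by (auto simp: is_ncoproduct_def)
  then have "\<exists>!h. h \<in> Hom C P A \<and> (\<forall>i<length Ws. Seq C (k i) h = Seq C (k i) h')"
    using assms(1) unfolding is_ncoproduct_def by (elim conjE ballE[of _ _ A] allE[of _ "\<lambda>i. Seq C (k i) h'"]) auto
  then show ?thesis using assms by blast
qed

lemma ncoproduct_ex:
  assumes "is_ncoproduct C Ws P k" "A \<in> Ob C" "\<And>i. i < length Ws \<Longrightarrow> f i \<in> Hom C (Ws ! i) A"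
  obtains h where "h \<in> Hom C P A" "\<And>i. i < length Ws \<Longrightarrow> Seq C (k i) h = f i"
  using assms unfolding is_ncoproduct_def by blast

lemma ncoproduct_Nil: "is_initial C P \<Longrightarrow> is_ncoproduct C [] P k"
  by (simp add: is_initial_def is_ncoproduct_def)

lemma ncoproduct_single: "W \<in> Ob C \<Longrightarrow> is_ncoproduct C [W] W (\<lambda>i. Idn C W)"
  unfolding is_ncoproduct_def by (auto simp: idn_closed seq_idn_left)

lemma ncoproduct_Cons:
  assumes P: "is_ncoproduct C Ws P k" and Q: "is_coproduct C W P Q i1 i2"
    and k': "k' 0 = i1" "\<And>j. j < length Ws \<Longrightarrow> k' (Suc j) = Seq C (k j) i2"
  shows "is_ncoproduct C (W # Ws) Q k'"
  unfolding is_ncoproduct_def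
proof (intro conjI allI impI ballI)
  have i: "i1 \<in> Hom C W Q" "i2 \<in> Hom C P Q" using Q by (auto simp: is_coproduct_def)
  have k: "\<And>j. j < length Ws \<Longrightarrow> k j \<in> Hom C (Ws ! j) P" using P by (simp add: is_ncoproduct_def)
  show "Q \<in> Ob C" using Q by (simp add: is_coproduct_def)
  show "k' j \<in> Hom C ((W # Ws) ! j) Q" if "j < length (W # Ws)" for j
    using that i k k' seq_closed[OF k i(2)] by (cases j) auto
  fix A f assume A: "A \<in> Ob C" and f: "\<forall>j<length (W # Ws). f j \<in> Hom C ((W # Ws) ! j) A"
  obtain h2 where h2: "h2 \<in> Hom C P A" "\<And>j. j < length Ws \<Longrightarrow> Seq C (k j) h2 = f (Suc j)"
    using ncoproduct_ex[OF P A, of "\<lambda>j. f (Suc j)"] f[rule_format, of "Suc _"] by auto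
  have f0: "f 0 \<in> Hom C W A" using f by auto
  have ex1: "\<exists>!h. h \<in> Hom C Q A \<and> Seq C i1 h = f 0 \<and> Seq C i2 h = h2"
    using Q A f0 h2(1) unfolding is_coproduct_def by blast
  have iff: "h \<in> Hom C Q A \<and> (\<forall>j<length (W # Ws). Seq C (k' j) h = f j) \<longleftrightarrow>
      h \<in> Hom C Q A \<and> Seq C i1 h = f 0 \<and> Seq C i2 h = h2" for h
  proof (intro iffI conjI; (elim conjE)?)
    assume h: "h \<in> Hom C Q A" and j: "\<forall>j<length (W # Ws). Seq C (k' j) h = f j"
    show "Seq C i1 h = f 0" using j k' by auto
    show "Seq C i2 h = h2"
    proof (rule ncoproduct_eqI[OF P seq_closed[OF i(2) h] h2(1)])
      fix l assume l: "l < length Ws"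
      then show "Seq C (k l) (Seq C i2 h) = Seq C (k l) h2"
        using j[rule_format, of "Suc l"] k'(2)[OF l] h2(2)[OF l] seq_assoc[OF k[OF l] i(2) h] by simp
    qed
  next
    assume h: "h \<in> Hom C Q A" and *: "Seq C i1 h = f 0" "Seq C i2 h = h2"
    show "\<forall>j<length (W # Ws). Seq C (k' j) h = f j"
    proof (intro allI impI)
      fix j assume j: "j < length (W # Ws)"
      show "Seq C (k' j) h = f j"
      proof (cases j)
        case 0
        then show ?thesis using * k' by simp
      next
        case (Suc l)
        then have "l < length Ws" using j by simp
        then show ?thesis using Suc * k'(2) h2(2) seq_assoc[OF k i(2) h] by simp
      qed
    qed
  qed auto
  show "\<exists>!h. h \<in> Hom C Q A \<and> (\<forall>j<length (W # Ws). Seq C (k' j) h = f j)"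
    unfolding iff by (rule ex1)
qed

text \<open>A pair of arrows out of \<open>P\<close> and \<open>Q\<close> amounts to a cocone on the
  concatenated word. Compatibility of i1 and i2 with the injections of the letters then turns the
  universal property of \<open>R\<close> into that of a binary coproduct.\<close>

lemma ncoproduct_append:
  assumes P: "is_ncoproduct C Us P a" and Q: "is_ncoproduct C Vs Q b" and R: "is_ncoproduct C (Us @ Vs) R c"
    and i: "i1 \<in> Hom C P R" "i2 \<in> Hom C Q R"
    and 1: "\<And>j. j < length Us \<Longrightarrow> Seq C (a j) i1 = c j"
    and 2: "\<And>j. j < length Vs \<Longrightarrow> Seq C (b j) i2 = c (length Us + j)"
  shows "is_coproduct C P Q R i1 i2"
  unfolding is_coproduct_def
proof (intro conjI ballI i)
  show "P \<in> Ob C" "Q \<in> Ob C" "R \<in> Ob C" using P Q R by (auto simp: is_ncoproduct_def)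
  have a: "a j \<in> Hom C (Us ! j) P" if "j < length Us" for j using P that by (simp add: is_ncoproduct_def)
  have b: "b j \<in> Hom C (Vs ! j) Q" if "j < length Vs" for j using Q that by (simp add: is_ncoproduct_def)
  fix A f1 f2 assume A: "A \<in> Ob C" and f: "f1 \<in> Hom C P A" "f2 \<in> Hom C Q A"
  define g where "g = (\<lambda>j. if j < length Us then Seq C (a j) f1 else Seq C (b (j - length Us)) f2)"
  have "g j \<in> Hom C ((Us @ Vs) ! j) A" if "j < length (Us @ Vs)" for j
    using that seq_closed[OF a f(1)] seq_closed[OF b f(2)] by (auto simp: g_def nth_append)
  then obtain h where h: "h \<in> Hom C R A" "\<And>j. j < length (Us @ Vs) \<Longrightarrow> Seq C (c j) h = g j"
    using ncoproduct_ex[OF R A] by blast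
  show "\<exists>!h. h \<in> Hom C R A \<and> Seq C i1 h = f1 \<and> Seq C i2 h = f2"
  proof (rule ex1I[of _ h], intro conjI)
    show "h \<in> Hom C R A" by fact
    show "Seq C i1 h = f1"
    proof (rule ncoproduct_eqI[OF P seq_closed[OF i(1) h(1)] f(1)])
      fix j assume j: "j < length Us"
      then show "Seq C (a j) (Seq C i1 h) = Seq C (a j) f1"
        using seq_assoc[OF a[OF j] i(1) h(1)] 1[OF j] h(2)[of j] by (simp add: g_def)
    qed
    show "Seq C i2 h = f2"
    proof (rule ncoproduct_eqI[OF Q seq_closed[OF i(2) h(1)] f(2)])
      fix j assume j: "j < length Vs"
      then show "Seq C (b j) (Seq C i2 h) = Seq C (b j) f2"
        using seq_assoc[OF b[OF j] i(2) h(1)] 2[OF j] h(2)[of "length Us + j"] by (simp add: g_def)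
    qed
  next
    fix h' assume h': "h' \<in> Hom C R A \<and> Seq C i1 h' = f1 \<and> Seq C i2 h' = f2"
    show "h' = h"
    proof (rule ncoproduct_eqI[OF R _ h(1)])
      fix j assume j: "j < length (Us @ Vs)"
      show "Seq C (c j) h' = Seq C (c j) h"
      proof (cases "j < length Us")
        case True
        then show ?thesis
          using seq_assoc[OF a[OF True] i(1), of h' A] 1[OF True] h(2)[OF j] h' by (simp add: g_def)
      next
        case False
        then have l: "j - length Us < length Vs" using j by auto
        then show ?thesis
          using seq_assoc[OF b[OF l] i(2), of h' A] 2[OF l] h(2)[OF j] h' False by (simp add: g_def)
      qed
    qed (use h' in simp)
  qed
qed

end


section \<open>The counit\<close>

text \<open>A word of length one is sent to its letter \<open>W\<close> and not to \<open>W \<oplus> 0\<close>, so that the counit is a strict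
  retraction of the unit even if \<open>D\<close> is not strict.\<close>

fun dsum :: "('o, 'a, 'z) cb_cat_scheme \<Rightarrow> 'o list \<Rightarrow> 'o" where
  "dsum D [] = Zero D"
| "dsum D [W] = W"
| "dsum D (W # V # Ws) = Oplus D W (dsum D (V # Ws))"

fun dinj :: "('o, 'a, 'z) cb_cat_scheme \<Rightarrow> 'o list \<Rightarrow> nat \<Rightarrow> 'a" where
  "dinj D [] i = undefined"
| "dinj D [W] i = Idn D W"
| "dinj D (W # V # Ws) i = (case i of 0 \<Rightarrow> Inj1 D W (dsum D (V # Ws))
     | Suc k \<Rightarrow> Seq D (dinj D (V # Ws) k) (Inj2 D W (dsum D (V # Ws))))"

fun dproj :: "('o, 'a, 'z) cb_cat_scheme \<Rightarrow> 'o list \<Rightarrow> nat \<Rightarrow> 'a" where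
  "dproj D [] i = undefined"
| "dproj D [W] i = Idn D W"
| "dproj D (W # V # Ws) i = (case i of 0 \<Rightarrow> Proj1 D W (dsum D (V # Ws))
     | Suc k \<Rightarrow> Seq D (Proj2 D W (dsum D (V # Ws))) (dproj D (V # Ws) k))"

context convex_biproduct_category
begin

section \<open>Cancellation of scalars, and projections as a jointly monic pair\<close>

lemma structure_Hom:
  assumes "X \<in> Ob D" "Y \<in> Ob D"
  shows "Oplus D X Y \<in> Ob D"
    "Inj1 D X Y \<in> Hom D X (Oplus D X Y)" "Inj2 D X Y \<in> Hom D Y (Oplus D X Y)"
    "Proj1 D X Y \<in> Hom D (Oplus D X Y) X" "Proj2 D X Y \<in> Hom D (Oplus D X Y) Y"
  using oplus_coproduct[OF assms] oplus_convex_product[OF assms]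
  by (auto simp: is_coproduct_def is_convex_product_def)

lemma copair_eqI:
  assumes "X \<in> Ob D" "Y \<in> Ob D" "h \<in> Hom D (Oplus D X Y) A" "h' \<in> Hom D (Oplus D X Y) A"
    "Seq D (Inj1 D X Y) h = Seq D (Inj1 D X Y) h'" "Seq D (Inj2 D X Y) h = Seq D (Inj2 D X Y) h'"
  shows "h = h'"
proof -
  note s = structure_Hom[OF assms(1,2)]
  have "A \<in> Ob D" "Seq D (Inj1 D X Y) h' \<in> Hom D X A" "Seq D (Inj2 D X Y) h' \<in> Hom D Y A"
    using Hom_Ob[OF assms(3)] seq_closed[OF s(2) assms(4)] seq_closed[OF s(3) assms(4)] by auto
  then have "\<exists>!k. k \<in> Hom D (Oplus D X Y) A \<and> Seq D (Inj1 D X Y) k = Seq D (Inj1 D X Y) h' \<and> Seq D (Inj2 D X Y) k = Seq D (Inj2 D X Y) h'"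
    using oplus_coproduct[OF assms(1,2)] unfolding is_coproduct_def by blast
  then show ?thesis using assms by blast
qed

text \<open>The weights 1/2 and 1/2 are admissible for the convex product, so its uniqueness clause
  applies to pairs of halved arrows. Arbitrary components are handled by \<open>pair_eqI\<close>,
  once halves can be cancelled.\<close>

lemma half_pair_eqI:
  assumes XY: "X \<in> Ob D" "Y \<in> Ob D" and f: "f1 \<in> Hom D A X" "f2 \<in> Hom D A Y"
    and h: "h \<in> Hom D A (Oplus D X Y)" "h' \<in> Hom D A (Oplus D X Y)"
    "Seq D h (Proj1 D X Y) = scale D (1/2) f1" "Seq D h (Proj2 D X Y) = scale D (1/2) f2"
    "Seq D h' (Proj1 D X Y) = scale D (1/2) f1" "Seq D h' (Proj2 D X Y) = scale D (1/2) f2"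
  shows "h = h'"
proof -
  have "A \<in> Ob D" using Hom_Ob[OF f(1)] by simp
  then have "\<exists>!k. k \<in> Hom D A (Oplus D X Y) \<and> Seq D k (Proj1 D X Y) = scale D (1/2) f1 \<and> Seq D k (Proj2 D X Y) = scale D (1/2) f2"
    using oplus_convex_product[OF XY] f unfolding is_convex_product_def
    by (elim conjE allE[of _ "1/2 :: real"]) (auto dest!: mp)
  then show ?thesis using h by blast
qed

text \<open>Pairing \<open>f\<close> with itself, both halves weighted by \<open>1/2\<close>, and composing with the codiagonal
  recovers \<open>f\<close>; but by uniqueness the pairing depends on \<open>1/2 \<cdot> f\<close> only.\<close>

lemma half_cancel:
  assumes f: "f \<in> Hom D A X" "g \<in> Hom D A X" and eq: "scale D (1/2) f = scale D (1/2) g"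
  shows "f = g"
proof -
  have AX: "A \<in> Ob D" "X \<in> Ob D" using Hom_Ob[OF f(1)] by auto
  note s = structure_Hom[OF AX(2,2)]
  let ?h = "\<lambda>f. cplus D (1/2) (Seq D f (Inj1 D X X)) (Seq D f (Inj2 D X X))"
  obtain c where c: "c \<in> Hom D (Oplus D X X) X" "Seq D (Inj1 D X X) c = Idn D X" "Seq D (Inj2 D X X) c = Idn D X"
    using oplus_coproduct[OF AX(2,2)] idn_closed[OF AX(2)] AX(2) unfolding is_coproduct_def by blast
  have h: "?h f \<in> Hom D A (Oplus D X X)" "Seq D (?h f) (Proj1 D X X) = scale D (1/2) f"
    "Seq D (?h f) (Proj2 D X X) = scale D (1/2) f" "Seq D (?h f) c = f" if f: "f \<in> Hom D A X" for f
  proof -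
    note i = seq_closed[OF f s(2)] seq_closed[OF f s(3)]
    show "?h f \<in> Hom D A (Oplus D X X)" using cplus_closed[OF i] by simp
    have f1: "Seq D f (Idn D X) = f" "Seq D f (Star D X X) = Star D A X"
      using seq_idn_right[OF f] seq_star_right[OF f AX(2)] by auto
    show "Seq D (?h f) (Proj1 D X X) = scale D (1/2) f"
      using seq_cplus_left[OF _ _ i s(4), of "1/2"] seq_assoc[OF f s(2) s(4)] seq_assoc[OF f s(3) s(4)] inj1_proj1[OF AX(2,2)] inj2_proj1[OF AX(2,2)]
      by (simp add: f1 scale_Hom[OF f])
    show "Seq D (?h f) (Proj2 D X X) = scale D (1/2) f"
      using seq_cplus_left[OF _ _ i s(5), of "1/2"] seq_assoc[OF f s(2) s(5)] seq_assoc[OF f s(3) s(5)] inj1_proj2[OF AX(2,2)] inj2_proj2[OF AX(2,2)]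
        cplus_commute[OF Star_closed[OF AX] f, of "1/2"]
      by (simp add: f1 scale_Hom[OF f])
    show "Seq D (?h f) c = f"
      using seq_cplus_left[OF _ _ i c(1), of "1/2"] seq_assoc[OF f s(2) c(1)] seq_assoc[OF f s(3) c(1)] c f1 cplus_idem[OF f, of "1/2"]
      by simp
  qed
  have "?h f = ?h g"
    by (rule half_pair_eqI[OF AX(2,2) f(1) f(1) h(1)[OF f(1)] h(1)[OF f(2)] h(2,3)[OF f(1)] h(2,3)[OF f(2), folded eq]])
  from arg_cong[OF this, of "\<lambda>k. Seq D k c"] show ?thesis unfolding h(4)[OF f(1)] h(4)[OF f(2)] .
qed

text \<open>The witness of a cone equality can be shrunk to a power of 1/2, and
  \<open>half_cancel\<close> removes the factors 1/2 one by one. Thus the arrows of \<open>D\<close>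
  embed into the cones.\<close>

lemma cone_cancel:
  assumes f: "f \<in> Hom D A X" "g \<in> Hom D A X" and eq: "cone D 1 f = cone D 1 g"
  shows "f = g"
proof -
  obtain s where s: "0 < s" "s * 1 \<le> 1" "s * 1 \<le> 1" "scale D (s * 1) f = scale D (s * 1) g"
    using eq cone_eq_iff[OF f, of 1 1] by (auto simp: cone_eq_def)
  obtain n where n: "(1 / 2) ^ n < s" using real_arch_pow_inv[OF s(1), of "1/2"] by auto
  have "scale D ((1 / 2) ^ n) f = scale D ((1 / 2) ^ n) g"
    using cone_eq_smaller[OF f _ _ s, of "(1/2) ^ n"] n by simp
  then show ?thesis
  proof (induction n)
    case 0
    then show ?case by (simp add: scale_1)
  next
    case (Suc n)
    have p: "(1 / 2 :: real) ^ n \<le> 1" by (rule power_le_one) auto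
    have "scale D (1/2) (scale D ((1/2) ^ n) f) = scale D (1/2) (scale D ((1/2) ^ n) g)"
      using Suc.prems scale_scale[OF f(1), of "1/2" "(1/2) ^ n"] scale_scale[OF f(2), of "1/2" "(1/2) ^ n"] p by simp
    then have "scale D ((1/2) ^ n) f = scale D ((1/2) ^ n) g"
      by (rule half_cancel[rotated 2]) (use f p in \<open>auto intro!: scale_closed\<close>)
    then show ?case by (rule Suc.IH)
  qed
qed

text \<open>The uniqueness clause of the convex product speaks only about components weighted with
  total at most 1. Halving both arrows brings their components into this form, and
  \<open>half_cancel\<close> removes the half.\<close>

lemma pair_eqI:
  assumes XY: "X \<in> Ob D" "Y \<in> Ob D" and h: "h \<in> Hom D A (Oplus D X Y)" "h' \<in> Hom D A (Oplus D X Y)"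
    "Seq D h (Proj1 D X Y) = Seq D h' (Proj1 D X Y)" "Seq D h (Proj2 D X Y) = Seq D h' (Proj2 D X Y)"
  shows "h = h'"
proof (rule half_cancel[OF h(1,2)])
  note s = structure_Hom[OF XY]
  show "scale D (1/2) h = scale D (1/2) h'"
    by (rule half_pair_eqI[OF XY seq_closed[OF h(1) s(4)] seq_closed[OF h(1) s(5)]])
      (use h s in \<open>auto simp: seq_scale(1)[OF h(1) s(4)] seq_scale(1)[OF h(1) s(5)] seq_scale(1)[OF h(2) s(4)] seq_scale(1)[OF h(2) s(5)]
        intro!: scale_closed\<close>)
qed

section \<open>Direct sums of words as biproducts over the cones\<close>

lemma dsum_Ob: "set Ws \<subseteq> Ob D \<Longrightarrow> dsum D Ws \<in> Ob D"
  using zero_initial by (induction Ws rule: induct_list012) (auto simp: structure_Hom is_initial_def)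

lemma dinj_ncoproduct: "set Ws \<subseteq> Ob D \<Longrightarrow> is_ncoproduct D Ws (dsum D Ws) (dinj D Ws)"
proof (induction Ws rule: induct_list012)
  case 1
  then show ?case using ncoproduct_Nil[OF zero_initial] by simp
next
  case (2 W)
  then show ?case using ncoproduct_single[of W] by (simp add: is_ncoproduct_def)
next
  case (3 W V Ws)
  then have "dsum D (V # Ws) \<in> Ob D" "W \<in> Ob D" using dsum_Ob[of "V # Ws"] by simp_all
  then have "is_ncoproduct D (W # V # Ws) (Oplus D W (dsum D (V # Ws))) (dinj D (W # V # Ws))"
    using 3 by (intro ncoproduct_Cons[OF _ oplus_coproduct, of "V # Ws" "dsum D (V # Ws)" "dinj D (V # Ws)"]) simp_all
  then show ?case by (simp only: dsum.simps)
qed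

lemma dinj_Hom: "\<lbrakk>set Ws \<subseteq> Ob D; i < length Ws\<rbrakk> \<Longrightarrow> dinj D Ws i \<in> Hom D (Ws ! i) (dsum D Ws)"
  using dinj_ncoproduct by (simp add: is_ncoproduct_def)

lemma dproj_Hom: "\<lbrakk>set Ws \<subseteq> Ob D; i < length Ws\<rbrakk> \<Longrightarrow> dproj D Ws i \<in> Hom D (dsum D Ws) (Ws ! i)"
proof (induction Ws arbitrary: i rule: induct_list012)
  case (2 W)
  then show ?case by (simp add: idn_closed)
next
  case (3 W V Ws)
  then have Ob: "W \<in> Ob D" "dsum D (V # Ws) \<in> Ob D" using dsum_Ob[of "V # Ws"] by simp_all
  show ?case
    using 3 structure_Hom[OF Ob] by (auto split: nat.split intro: seq_closed)
qed simp

lemma dinj_dproj: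
  "\<lbrakk>set Ws \<subseteq> Ob D; i < length Ws; j < length Ws\<rbrakk> \<Longrightarrow>
    Seq D (dinj D Ws i) (dproj D Ws j) = (if i = j then Idn D (Ws ! i) else Star D (Ws ! i) (Ws ! j))"
proof (induction Ws arbitrary: i j rule: induct_list012)
  case (2 W)
  then show ?case using seq_idn_left[OF idn_closed] by simp
next
  case (3 W V Ws)
  let ?P = "dsum D (V # Ws)"
  have Ob: "W \<in> Ob D" "?P \<in> Ob D" "set (V # Ws) \<subseteq> Ob D" using 3(3) dsum_Ob[of "V # Ws"] by simp_all
  note s = structure_Hom[OF Ob(1,2)]
  have a: "dinj D (V # Ws) k \<in> Hom D ((V # Ws) ! k) ?P" "dproj D (V # Ws) k \<in> Hom D ?P ((V # Ws) ! k)"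
    "(V # Ws) ! k \<in> Ob D" if "k < length (V # Ws)" for k
    using dinj_Hom[OF Ob(3) that] dproj_Hom[OF Ob(3) that] Hom_Ob by blast+
  consider "i = 0" "j = 0" | k where "i = 0" "j = Suc k" "k < length (V # Ws)"
    | k where "i = Suc k" "j = 0" "k < length (V # Ws)" | k l where "i = Suc k" "j = Suc l" "k < length (V # Ws)" "l < length (V # Ws)"
    using 3(4,5) by (cases i; cases j) auto
  then show ?case
  proof cases
    case 1
    then show ?thesis using inj1_proj1[OF Ob(1,2)] by simp
  next
    case (2 k)
    have "Seq D (Inj1 D W ?P) (Seq D (Proj2 D W ?P) (dproj D (V # Ws) k)) = Star D W ((V # Ws) ! k)"
      using seq_assoc[OF s(2) s(5) a(2)] inj1_proj2[OF Ob(1,2)] seq_star_left[OF Ob(1) a(2)] 2(3) by simp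
    then show ?thesis using 2 by simp
  next
    case (3 k)
    have "Seq D (Seq D (dinj D (V # Ws) k) (Inj2 D W ?P)) (Proj1 D W ?P) = Star D ((V # Ws) ! k) W"
      using seq_assoc[OF a(1) s(3) s(4)] inj2_proj1[OF Ob(1,2)] seq_star_right[OF a(1) Ob(1)] 3(3) by simp
    then show ?thesis using 3 by simp
  next
    case (4 k l)
    have "Seq D (Seq D (dinj D (V # Ws) k) (Inj2 D W ?P)) (Seq D (Proj2 D W ?P) (dproj D (V # Ws) l))
       = Seq D (dinj D (V # Ws) k) (Seq D (Seq D (Inj2 D W ?P) (Proj2 D W ?P)) (dproj D (V # Ws) l))"
      using seq_assoc[OF a(1) s(3) seq_closed[OF s(5) a(2)]] seq_assoc[OF s(3) s(5) a(2)] 4(3,4) by simp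
    also have "\<dots> = Seq D (dinj D (V # Ws) k) (dproj D (V # Ws) l)"
      using inj2_proj2[OF Ob(1,2)] seq_idn_left[OF a(2)] 4(4) by simp
    finally show ?thesis using 4 "3.IH"(2)[OF Ob(3), of k l] by simp
  qed
qed simp

lemma dproj_eqI:
  "\<lbrakk>set Ws \<subseteq> Ob D; h \<in> Hom D A (dsum D Ws); h' \<in> Hom D A (dsum D Ws);
    \<And>j. j < length Ws \<Longrightarrow> Seq D h (dproj D Ws j) = Seq D h' (dproj D Ws j)\<rbrakk> \<Longrightarrow> h = h'"
proof (induction Ws arbitrary: h h' rule: induct_list012)
  case 1
  then show ?case using zero_terminal Hom_Ob[OF 1(2)] unfolding is_terminal_def by auto
next
  case (2 W)
  then show ?case using 2(4)[of 0] seq_idn_right[of h A W] seq_idn_right[of h' A W] by simp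
next
  case (3 W V Ws)
  let ?P = "dsum D (V # Ws)"
  have Ob: "W \<in> Ob D" "?P \<in> Ob D" "set (V # Ws) \<subseteq> Ob D" using 3(3) dsum_Ob[of "V # Ws"] by simp_all
  note s = structure_Hom[OF Ob(1,2)]
  have h: "h \<in> Hom D A (Oplus D W ?P)" "h' \<in> Hom D A (Oplus D W ?P)" using 3 by auto
  show ?case
  proof (rule pair_eqI[OF Ob(1,2) h])
    show "Seq D h (Proj1 D W ?P) = Seq D h' (Proj1 D W ?P)" using "3.prems"(4)[of 0] by simp
    show "Seq D h (Proj2 D W ?P) = Seq D h' (Proj2 D W ?P)"
    proof (rule "3.IH"(2)[OF Ob(3) seq_closed[OF h(1) s(5)] seq_closed[OF h(2) s(5)]])
      fix j assume j: "j < length (V # Ws)"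
      show "Seq D (Seq D h (Proj2 D W ?P)) (dproj D (V # Ws) j) = Seq D (Seq D h' (Proj2 D W ?P)) (dproj D (V # Ws) j)"
        using "3.prems"(4)[of "Suc j"] j seq_assoc[OF h(1) s(5) dproj_Hom[OF Ob(3) j]] seq_assoc[OF h(2) s(5) dproj_Hom[OF Ob(3) j]] by simp
    qed
  qed
qed

lemma dinj_eqI:
  "\<lbrakk>set Ws \<subseteq> Ob D; h \<in> Hom D (dsum D Ws) A; h' \<in> Hom D (dsum D Ws) A;
    \<And>j. j < length Ws \<Longrightarrow> Seq D (dinj D Ws j) h = Seq D (dinj D Ws j) h'\<rbrakk> \<Longrightarrow> h = h'"
  using ncoproduct_eqI[OF dinj_ncoproduct] by blast

text \<open>The projections separate arrows. To obtain this for cone elements, both are scaled down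
  until they come from arrows of weight 1, and the scalar is cancelled in the cone.\<close>

lemma cone_dproj_eqI:
  assumes Ws: "set Ws \<subseteq> Ob D" and a: "a \<in> Cone D A (dsum D Ws)" and b: "b \<in> Cone D A (dsum D Ws)"
    and eq: "\<And>j. j < length Ws \<Longrightarrow> cone_mul D a (cone D 1 (dproj D Ws j)) = cone_mul D b (cone D 1 (dproj D Ws j))"
  shows "a = b"
proof -
  obtain p f q g where f: "a = cone D p f" "0 \<le> p" "f \<in> Hom D A (dsum D Ws)"
    and g: "b = cone D q g" "0 \<le> q" "g \<in> Hom D A (dsum D Ws)"
    using a b by (elim ConeE)
  \<comment> \<open>With this factor both scaled weights are at most 1, whatever p and q
    are.\<close>
  define s where "s = 1 / (1 + p + q)"
  have s: "0 < s" "s * p \<le> 1" "s * q \<le> 1" "0 \<le> s * p" "0 \<le> s * q" using f g by (auto simp: s_def field_simps)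
  have fa: "cone_scale D s a = cone D 1 (scale D (s * p) f)" and gb: "cone_scale D s b = cone D 1 (scale D (s * q) g)"
    using cone_scale_cone[OF f(3,2), of s] cone_cone_scale[OF f(3), of 1 "s * p"]
      cone_scale_cone[OF g(3,2), of s] cone_cone_scale[OF g(3), of 1 "s * q"] s f g by simp_all
  have H: "scale D (s * p) f \<in> Hom D A (dsum D Ws)" "scale D (s * q) g \<in> Hom D A (dsum D Ws)"
    using f g s by (auto intro: scale_closed)
  have "scale D (s * p) f = scale D (s * q) g"
  proof (rule dproj_eqI[OF Ws H])
    fix j assume j: "j < length Ws"
    note pj = dproj_Hom[OF Ws j]
    have "cone D 1 (Seq D (scale D (s * p) f) (dproj D Ws j)) = cone_mul D (cone_scale D s a) (cone D 1 (dproj D Ws j))"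
      using cone_mul_cone[OF H(1) pj, of 1 1] fa by simp
    also have "\<dots> = cone_mul D (cone_scale D s b) (cone D 1 (dproj D Ws j))"
      using cone_scale_mul(1)[OF a cone_closed[OF pj, of 1], of s] cone_scale_mul(1)[OF b cone_closed[OF pj, of 1], of s] eq[OF j] s by simp
    also have "\<dots> = cone D 1 (Seq D (scale D (s * q) g) (dproj D Ws j))"
      using cone_mul_cone[OF H(2) pj, of 1 1] gb by simp
    finally show "Seq D (scale D (s * p) f) (dproj D Ws j) = Seq D (scale D (s * q) g) (dproj D Ws j)"
      by (rule cone_cancel[OF seq_closed[OF H(1) pj] seq_closed[OF H(2) pj]])
  qed
  then show "a = b" using cone_scale_cancel[OF _ a b s(1)] fa gb by simp
qed

text \<open>By distributivity and the equations between injections and projections, only the summand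
  k survives.\<close>

lemma cone_inj_sum_proj:
  assumes Ws: "set Ws \<subseteq> Ob D" and A: "A \<in> Ob D" and a: "\<And>j. j < length Ws \<Longrightarrow> a j \<in> Cone D A (Ws ! j)" and k: "k < length Ws"
  shows "cone_mul D (cone_sum D A (dsum D Ws) (length Ws) (\<lambda>j. cone_mul D (a j) (cone D 1 (dinj D Ws j)))) (cone D 1 (dproj D Ws k)) = a k"
proof -
  have ci: "cone D 1 (dinj D Ws j) \<in> Cone D (Ws ! j) (dsum D Ws)" if "j < length Ws" for j
    using cone_closed[OF dinj_Hom[OF Ws that]] by simp
  have cp: "cone D 1 (dproj D Ws k) \<in> Cone D (dsum D Ws) (Ws ! k)" using cone_closed[OF dproj_Hom[OF Ws k]] by simp
  have Ob: "Ws ! j \<in> Ob D" if "j < length Ws" for j using Ws that by auto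
  let ?b = "\<lambda>j. cone_mul D (cone_mul D (a j) (cone D 1 (dinj D Ws j))) (cone D 1 (dproj D Ws k))"
  have b: "?b j = cone_mul D (a j) (cone D 1 (Seq D (dinj D Ws j) (dproj D Ws k)))" if "j < length Ws" for j
    using cone_mul_assoc[OF a[OF that] ci[OF that] cp] cone_mul_cone[OF dinj_Hom[OF Ws that] dproj_Hom[OF Ws k], of 1 1] by simp
  have bk: "?b k = a k" using b[OF k] dinj_dproj[OF Ws k k] cone_mul_idn(2)[OF a[OF k]] by simp
  have "?b j = cone_zero D A (Ws ! k)" if "j < length Ws" "j \<noteq> k" for j
    using b[OF that(1)] dinj_dproj[OF Ws that(1) k] that(2) cone_mul_zero_right[OF a[OF that(1)] Ob[OF k]] cone_Star[OF Ob[OF that(1)] Ob[OF k], of 1]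
    by simp
  moreover have "?b k \<in> Cone D A (Ws ! k)" unfolding bk using a[OF k] .
  ultimately have "cone_sum D A (Ws ! k) (length Ws) ?b = ?b k"
    using cone_sum_single[OF k, where a = ?b] by blast
  moreover have "cone_mul D (cone_sum D A (dsum D Ws) (length Ws) (\<lambda>j. cone_mul D (a j) (cone D 1 (dinj D Ws j)))) (cone D 1 (dproj D Ws k))
      = cone_sum D A (Ws ! k) (length Ws) ?b"
    using cone_mul_closed[OF a ci] by (intro cone_sum_mul_right[OF cp A]) auto
  ultimately show ?thesis using bk by simp
qed

text \<open>The identity of a direct sum is the sum of all projections followed by the injections.
  All coefficients are 1, so for several letters this is no convex combination of arrows. In the
  cone it is a legitimate sum, and composing with the projections verifies it.\<close>

lemma cone_resolution:
  assumes Ws: "set Ws \<subseteq> Ob D" and a: "a \<in> Cone D A (dsum D Ws)"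
  shows "a = cone_sum D A (dsum D Ws) (length Ws) (\<lambda>j. cone_mul D (cone_mul D a (cone D 1 (dproj D Ws j))) (cone D 1 (dinj D Ws j)))"
proof -
  have A: "A \<in> Ob D" "dsum D Ws \<in> Ob D" using Cone_Ob[OF a] by auto
  have cp: "cone_mul D a (cone D 1 (dproj D Ws j)) \<in> Cone D A (Ws ! j)" if "j < length Ws" for j
    using cone_mul_closed[OF a cone_closed[OF dproj_Hom[OF Ws that]]] by simp
  have "cone_mul D (cone_mul D a (cone D 1 (dproj D Ws j))) (cone D 1 (dinj D Ws j)) \<in> Cone D A (dsum D Ws)" if "j < length Ws" for j
    using cone_mul_closed[OF cp[OF that] cone_closed[OF dinj_Hom[OF Ws that]]] by simp
  then show ?thesis
    using cone_sum_closed[of "length Ws" _ A "dsum D Ws"] A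
    by (intro cone_dproj_eqI[OF Ws a]) (simp_all add: cone_inj_sum_proj[OF Ws A(1) cp])
qed

section \<open>The arrow realized by a matrix\<close>

definition realizes :: "('o, 'a) smat \<Rightarrow> 'a \<Rightarrow> bool" where
  "realizes M h \<longleftrightarrow> h \<in> Hom D (dsum D (sdom M)) (dsum D (scod M)) \<and>
     (\<forall>i<length (sdom M). \<forall>j<length (scod M).
        cone D 1 (Seq D (Seq D (dinj D (sdom M) i) h) (dproj D (scod M) j)) = entry D M j i)"

lemma realizes_unique:
  assumes M: "M \<in> smats D" and h: "realizes M h" "realizes M h'"
  shows "h = h'"
proof (rule dinj_eqI[OF smatsD(1)[OF M]])
  let ?U = "sdom M" and ?V = "scod M"
  show H: "h \<in> Hom D (dsum D ?U) (dsum D ?V)" "h' \<in> Hom D (dsum D ?U) (dsum D ?V)" using h by (auto simp: realizes_def)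
  fix i assume i: "i < length ?U"
  note a = dinj_Hom[OF smatsD(1)[OF M] i]
  show "Seq D (dinj D ?U i) h = Seq D (dinj D ?U i) h'"
  proof (rule dproj_eqI[OF smatsD(2)[OF M] seq_closed[OF a H(1)] seq_closed[OF a H(2)]])
    fix j assume j: "j < length ?V"
    note b = dproj_Hom[OF smatsD(2)[OF M] j]
    show "Seq D (Seq D (dinj D ?U i) h) (dproj D ?V j) = Seq D (Seq D (dinj D ?U i) h') (dproj D ?V j)"
      using h i j by (intro cone_cancel[OF seq_closed[OF seq_closed[OF a H(1)] b] seq_closed[OF seq_closed[OF a H(2)] b]])
        (simp add: realizes_def)
  qed
qed

text \<open>A column of a stochastic matrix has total weight at most 1, so its entries, followed by
  the injections of the target, have a convex sum in \<open>D\<close>. These sums are then copaired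
  over all columns.\<close>

lemma realizes_exists:
  assumes M: "M \<in> smats D"
  obtains h where "realizes M h"
proof -
  let ?U = "sdom M" and ?V = "scod M"
  let ?m = "length ?V" and ?Q = "dsum D ?V"
  note U = smatsD(1)[OF M] and V = smatsD(2)[OF M]
  define c where "c = (\<lambda>i. csum D (?U ! i) ?Q ?m (\<lambda>j. wgt M j i) (\<lambda>j. Seq D (arw M j i) (dinj D ?V j)))"
  have Q: "?Q \<in> Ob D" using dsum_Ob[OF V] .
  have UO: "?U ! i \<in> Ob D" if "i < length ?U" for i using U that by auto
  have arr: "Seq D (arw M j i) (dinj D ?V j) \<in> Hom D (?U ! i) ?Q" if "i < length ?U" "j < ?m" for i j
    using seq_closed[OF smatsD(5)[OF M that] dinj_Hom[OF V that(2)]] .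
  have c: "c i \<in> Hom D (?U ! i) ?Q" if i: "i < length ?U" for i
    unfolding c_def using smatsD(3)[OF M i] smatsD(6)[OF M i] arr[OF i] by (intro csum_closed UO[OF i] Q)
  have "cone D 1 (Seq D (c i) (dproj D ?V j)) = entry D M j i" if i: "i < length ?U" and j: "j < ?m" for i j
  proof -
    have "cone D 1 (c i) = cone_sum D (?U ! i) ?Q ?m (\<lambda>j. cone D (wgt M j i) (Seq D (arw M j i) (dinj D ?V j)))"
      unfolding c_def using smatsD(3)[OF M i] smatsD(6)[OF M i] arr[OF i] by (intro cone_csum UO[OF i] Q)
    also have "\<dots> = cone_sum D (?U ! i) ?Q ?m (\<lambda>j. cone_mul D (entry D M j i) (cone D 1 (dinj D ?V j)))"
    proof (rule cone_sum_cong)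
      fix j assume j: "j < ?m"
      show "cone D (wgt M j i) (Seq D (arw M j i) (dinj D ?V j)) = cone_mul D (entry D M j i) (cone D 1 (dinj D ?V j))"
        using cone_mul_cone[OF smatsD(5)[OF M i j] dinj_Hom[OF V j] smatsD(3)[OF M i j], of 1] by (simp add: entry_def)
    qed
    finally show ?thesis
      using cone_mul_cone[OF c[OF i] dproj_Hom[OF V j], of 1 1] cone_inj_sum_proj[OF V UO[OF i] entry_closed[OF M i] j] by simp
  qed
  moreover obtain h where "h \<in> Hom D (dsum D ?U) ?Q" "\<And>i. i < length ?U \<Longrightarrow> Seq D (dinj D ?U i) h = c i"
    using ncoproduct_ex[OF dinj_ncoproduct[OF U] Q c] by blast
  ultimately have "realizes M h" by (simp add: realizes_def)
  then show thesis by (rule that)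
qed

text \<open>All representatives of a class have the same entries and are realized by the same arrow,
  so the description is independent of the representative.\<close>

definition realize :: "('o list, ('o, 'a) smat set, 'o, 'a) funct" where
  "realize = \<lparr>FO = restrict (dsum D) (Ob (Stmat D)),
     FA = restrict (\<lambda>A. THE h. \<exists>M\<in>A. realizes M h) (Ar (Stmat D))\<rparr>"

lemma FO_realize: "set Ws \<subseteq> Ob D \<Longrightarrow> FO realize Ws = dsum D Ws"
  by (auto simp: realize_def in_lists_conv_set)

lemma FA_realize:
  assumes M: "M \<in> smats D"
  shows "FA realize (smat_class D M) = h \<longleftrightarrow> realizes M h"
proof -
  have *: "realizes N k \<longleftrightarrow> realizes M k" if "N \<in> smat_class D M" for N k
    using that by (auto simp: in_smat_class smat_eq_def realizes_def)
  obtain k where k: "realizes M k" using realizes_exists[OF M] by blast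
  have "(THE h. \<exists>M\<in>smat_class D M. realizes M h) = k"
    using k * smat_class_refl[OF M] realizes_unique[OF M] by (intro the_equality) blast+
  then have "FA realize (smat_class D M) = k" using M by (simp add: realize_def)
  then show ?thesis using k realizes_unique[OF M] by blast
qed

lemma realizes_FA: "M \<in> smats D \<Longrightarrow> realizes M (FA realize (smat_class D M))"
  using FA_realize by blast

lemma realizes_unit:
  assumes U: "smat_unit D Us Vs P \<in> smats D" and h: "h \<in> Hom D (dsum D Us) (dsum D Vs)"
    and e: "\<And>i j. \<lbrakk>i < length Us; j < length Vs\<rbrakk> \<Longrightarrow> Seq D (Seq D (dinj D Us i) h) (dproj D Vs j) =
      (if P j i then Idn D (Us ! i) else Star D (Us ! i) (Vs ! j))"
  shows "realizes (smat_unit D Us Vs P) h"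
  unfolding realizes_def
proof (intro conjI allI impI)
  fix i j assume ij: "i < length (sdom (smat_unit D Us Vs P))" "j < length (scod (smat_unit D Us Vs P))"
  then have "Us ! i \<in> Ob D" "Vs ! j \<in> Ob D" using smatsD(1,2)[OF U] by auto
  then show "cone D 1 (Seq D (Seq D (dinj D (sdom (smat_unit D Us Vs P)) i) h) (dproj D (scod (smat_unit D Us Vs P)) j))
     = entry D (smat_unit D Us Vs P) j i"
    using ij e by (auto simp: entry_unit cone_Star)
qed (use h in simp)

lemma realize_pca_hom: "realize \<in> pca_hom (Stmat D) D"
  unfolding pca_hom_def
proof (intro CollectI conjI ballI allI impI)
  show "FO realize \<in> Ob (Stmat D) \<rightarrow>\<^sub>E Ob D" "FA realize \<in> extensional (Ar (Stmat D))"
    using dsum_Ob by (auto simp: realize_def in_lists_conv_set subset_iff)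
next
  fix Us Vs A assume "A \<in> Hom (Stmat D) Us Vs"
  then obtain M where M: "M \<in> smats D" "sdom M = Us" "scod M = Vs" "A = smat_class D M"
    by (elim Stmat_HomE)
  then show "FA realize A \<in> Hom D (FO realize Us) (FO realize Vs)"
    using realizes_FA[OF M(1)] smatsD(1,2)[OF M(1)] by (simp add: realizes_def FO_realize)
next
  fix Us assume "Us \<in> Ob (Stmat D)"
  then have U: "set Us \<subseteq> Ob D" by auto
  have "realizes (smat_unit D Us Us (\<lambda>j i. j = i)) (Idn D (dsum D Us))"
    using idn_closed[OF dsum_Ob[OF U]] seq_idn_right[OF dinj_Hom[OF U]] dinj_dproj[OF U]
    by (intro realizes_unit Idn_smats U) auto
  then show "FA realize (Idn (Stmat D) Us) = Idn D (FO realize Us)"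
    using FA_realize[OF Idn_smats[OF U]] FO_realize[OF U] by simp
next
  fix Us Vs assume "Us \<in> Ob (Stmat D)" "Vs \<in> Ob (Stmat D)"
  then have U: "set Us \<subseteq> Ob D" "set Vs \<subseteq> Ob D" by auto
  note O = dsum_Ob[OF U(1)] dsum_Ob[OF U(2)]
  have "realizes (smat_unit D Us Vs (\<lambda>j i. False)) (Star D (dsum D Us) (dsum D Vs))"
  proof (intro realizes_unit Star_smats U Star_closed O)
    fix i j assume ij: "i < length Us" "j < length Vs"
    have "Us ! i \<in> Ob D" using U ij by auto
    then show "Seq D (Seq D (dinj D Us i) (Star D (dsum D Us) (dsum D Vs))) (dproj D Vs j) =
        (if False then Idn D (Us ! i) else Star D (Us ! i) (Vs ! j))"
      using seq_star_right[OF dinj_Hom[OF U(1) ij(1)] O(2)] seq_star_left[OF _ dproj_Hom[OF U(2) ij(2)], of "Us ! i"] by simp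
  qed
  then show "FA realize (Star (Stmat D) Us Vs) = Star D (FO realize Us) (FO realize Vs)"
    using FA_realize[OF Star_smats[OF U]] FO_realize U by simp
next
  fix Us Vs Ws A B assume "A \<in> Hom (Stmat D) Us Vs" "B \<in> Hom (Stmat D) Vs Ws"
  then obtain M N where M: "M \<in> smats D" "sdom M = Us" "scod M = Vs" "A = smat_class D M"
    and N: "N \<in> smats D" "sdom N = Vs" "scod N = Ws" "B = smat_class D N"
    by (elim Stmat_HomE)
  note U = smatsD(1)[OF M(1), unfolded M(2)] and V = smatsD(1)[OF N(1), unfolded N(2)] and W = smatsD(2)[OF N(1), unfolded N(3)]
  have cl: "smat_seq D M N \<in> smats D" using smat_seq_closed[OF M(1) N(1)] M N by simp
  let ?h = "FA realize A" and ?k = "FA realize B"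
  have h: "?h \<in> Hom D (dsum D Us) (dsum D Vs)"
    and he: "\<And>i j. i < length Us \<Longrightarrow> j < length Vs \<Longrightarrow> cone D 1 (Seq D (Seq D (dinj D Us i) ?h) (dproj D Vs j)) = entry D M j i"
    using realizes_FA[OF M(1)] M by (auto simp: realizes_def)
  have k: "?k \<in> Hom D (dsum D Vs) (dsum D Ws)"
    and ke: "\<And>i j. i < length Vs \<Longrightarrow> j < length Ws \<Longrightarrow> cone D 1 (Seq D (Seq D (dinj D Vs i) ?k) (dproj D Ws j)) = entry D N j i"
    using realizes_FA[OF N(1)] N by (auto simp: realizes_def)
  have "realizes (smat_seq D M N) (Seq D ?h ?k)"
    unfolding realizes_def
  proof (intro conjI allI impI)
    show "Seq D ?h ?k \<in> Hom D (dsum D (sdom (smat_seq D M N))) (dsum D (scod (smat_seq D M N)))"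
      using seq_closed[OF h k] M N by simp
    fix i u assume "i < length (sdom (smat_seq D M N))" "u < length (scod (smat_seq D M N))"
    then have i: "i < length Us" and u: "u < length Ws" using M N by auto
    let ?X = "Us ! i" and ?Z = "Ws ! u" and ?n = "length Vs"
    have X: "?X \<in> Ob D" using U i by auto
    note a = dinj_Hom[OF U i] and b = dproj_Hom[OF W u]
    note ah = seq_closed[OF a h] and kb = seq_closed[OF k b]
    note ch = cone_closed[OF ah, of 1, simplified] and ck = cone_closed[OF kb, of 1, simplified]
    have e1: "cone_mul D (cone D 1 (Seq D (dinj D Us i) ?h)) (cone D 1 (dproj D Vs j)) = entry D M j i" if "j < ?n" for j
      using cone_mul_cone[OF ah dproj_Hom[OF V that], of 1 1] he[OF i that] by simp
    have e2: "cone_mul D (cone D 1 (dinj D Vs j)) (cone D 1 (Seq D ?k (dproj D Ws u))) = entry D N u j" if "j < ?n" for j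
      using cone_mul_cone[OF dinj_Hom[OF V that] kb, of 1 1] ke[OF that u] seq_assoc[OF dinj_Hom[OF V that] k b] by simp
    have ce: "entry D M j i \<in> Cone D ?X (Vs ! j)" "cone D 1 (dinj D Vs j) \<in> Cone D (Vs ! j) (dsum D Vs)" if "j < ?n" for j
      using entry_closed[OF M(1), of i j] M i that cone_closed[OF dinj_Hom[OF V that], of 1] by auto
    \<comment> \<open>Inserting this resolution between the two arrows turns the component of their
      composite into an entry of the matrix product.\<close>
    have res: "cone D 1 (Seq D (dinj D Us i) ?h) = cone_sum D ?X (dsum D Vs) ?n (\<lambda>j. cone_mul D (entry D M j i) (cone D 1 (dinj D Vs j)))"
      using cone_resolution[OF V ch] e1 by (simp cong: cone_sum_cong)
    have "Seq D (Seq D (dinj D Us i) (Seq D ?h ?k)) (dproj D Ws u) = Seq D (Seq D (dinj D Us i) ?h) (Seq D ?k (dproj D Ws u))"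
      using seq_assoc[OF a h k] seq_assoc[OF ah k b] by simp
    then have "cone D 1 (Seq D (Seq D (dinj D Us i) (Seq D ?h ?k)) (dproj D Ws u))
       = cone_mul D (cone D 1 (Seq D (dinj D Us i) ?h)) (cone D 1 (Seq D ?k (dproj D Ws u)))"
      using cone_mul_cone[OF ah kb, of 1 1] by simp
    also have "\<dots> = cone_sum D ?X ?Z ?n (\<lambda>j. cone_mul D (cone_mul D (entry D M j i) (cone D 1 (dinj D Vs j))) (cone D 1 (Seq D ?k (dproj D Ws u))))"
      unfolding res using cone_mul_closed[OF ce] by (intro cone_sum_mul_right[OF ck X])
    also have "\<dots> = cone_sum D ?X ?Z ?n (\<lambda>j. cone_mul D (entry D M j i) (entry D N u j))"
      using cone_mul_assoc[OF ce ck] e2 by (intro cone_sum_cong) simp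
    also have "\<dots> = entry D (smat_seq D M N) u i"
      using entry_seq[OF M(1) N(1), of i u] M N i u by simp
    finally show "cone D 1 (Seq D (Seq D (dinj D (sdom (smat_seq D M N)) i) (Seq D ?h ?k)) (dproj D (scod (smat_seq D M N)) u))
      = entry D (smat_seq D M N) u i" using M N by simp
  qed
  then show "FA realize (Seq (Stmat D) A B) = Seq D ?h ?k"
    using FA_realize[OF cl] Seq_class[OF M(1) N(1)] M N by simp
next
  fix Us Vs A B and p :: real assume "A \<in> Hom (Stmat D) Us Vs" "B \<in> Hom (Stmat D) Us Vs" and p: "0 < p \<and> p < 1"
  then obtain M N where M: "M \<in> smats D" "sdom M = Us" "scod M = Vs" "A = smat_class D M"
    and N: "N \<in> smats D" "sdom N = Us" "scod N = Vs" "B = smat_class D N"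
    by (elim Stmat_HomE)
  note U = smatsD(1)[OF M(1), unfolded M(2)] and V = smatsD(2)[OF N(1), unfolded N(3)]
  have cl: "smat_plus D p M N \<in> smats D" using smat_plus_closed[OF M(1) N(1)] M N p by simp
  let ?h = "FA realize A" and ?k = "FA realize B"
  have h: "?h \<in> Hom D (dsum D Us) (dsum D Vs)"
    and he: "\<And>i j. i < length Us \<Longrightarrow> j < length Vs \<Longrightarrow> cone D 1 (Seq D (Seq D (dinj D Us i) ?h) (dproj D Vs j)) = entry D M j i"
    using realizes_FA[OF M(1)] M by (auto simp: realizes_def)
  have k: "?k \<in> Hom D (dsum D Us) (dsum D Vs)"
    and ke: "\<And>i j. i < length Us \<Longrightarrow> j < length Vs \<Longrightarrow> cone D 1 (Seq D (Seq D (dinj D Us i) ?k) (dproj D Vs j)) = entry D N j i"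
    using realizes_FA[OF N(1)] N by (auto simp: realizes_def)
  have "realizes (smat_plus D p M N) (Plus D p ?h ?k)"
    unfolding realizes_def
  proof (intro conjI allI impI)
    have "Plus D p ?h ?k = cplus D p ?h ?k" using p by (simp add: cplus_def)
    then show "Plus D p ?h ?k \<in> Hom D (dsum D (sdom (smat_plus D p M N))) (dsum D (scod (smat_plus D p M N)))"
      using cplus_closed[OF h k, of p] M p by simp
    fix i j assume "i < length (sdom (smat_plus D p M N))" "j < length (scod (smat_plus D p M N))"
    then have i: "i < length Us" and j: "j < length Vs" using M by auto
    note a = dinj_Hom[OF U i] and b = dproj_Hom[OF V j]
    let ?f = "Seq D (Seq D (dinj D Us i) ?h) (dproj D Vs j)" and ?g = "Seq D (Seq D (dinj D Us i) ?k) (dproj D Vs j)"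
    note f = seq_closed[OF seq_closed[OF a h] b] and g = seq_closed[OF seq_closed[OF a k] b]
    have "Seq D (Seq D (dinj D Us i) (Plus D p ?h ?k)) (dproj D Vs j) = cplus D p ?f ?g"
      using seq_plus_right[OF _ _ a h k, of p] seq_plus_left[OF _ _ seq_closed[OF a h] seq_closed[OF a k] b, of p] p by (simp add: cplus_def)
    then have "cone D 1 (Seq D (Seq D (dinj D Us i) (Plus D p ?h ?k)) (dproj D Vs j)) = cone_add D (cone_scale D p (cone D 1 ?f)) (cone_scale D (1 - p) (cone D 1 ?g))"
      using cone_cplus[OF f g, of p] cone_scale_cone[OF f, of 1 p] cone_scale_cone[OF g, of 1 "1 - p"] p by simp
    then show "cone D 1 (Seq D (Seq D (dinj D (sdom (smat_plus D p M N)) i) (Plus D p ?h ?k)) (dproj D (scod (smat_plus D p M N)) j))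
      = entry D (smat_plus D p M N) j i"
      using entry_plus[OF M(1) N(1), of p i j] he[OF i j] ke[OF i j] M N i j p by simp
  qed
  then show "FA realize (Plus (Stmat D) p A B) = Plus D p ?h ?k"
    using FA_realize[OF cl] Plus_class[OF M(1) N(1), of p] M N p by simp
qed

lemma realize_functor: "pca_functor (Stmat D) D realize"
  by (intro pca_functorI Stmat_category pca_category_axioms realize_pca_hom)

text \<open>Both sides have the same components: an identity at the letter \<open>\<phi> i\<close>
  and stars elsewhere. Equality in the cones is lifted to arrows by
  \<open>cone_cancel\<close>.\<close>

lemma dinj_realize_unit:
  assumes U: "smat_unit D Us Vs P \<in> smats D" and i: "i < length Us" "\<phi> i < length Vs" "Us ! i = Vs ! \<phi> i"
    and P: "\<And>j. j < length Vs \<Longrightarrow> P j i \<longleftrightarrow> j = \<phi> i"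
  shows "Seq D (dinj D Us i) (FA realize (smat_class D (smat_unit D Us Vs P))) = dinj D Vs (\<phi> i)"
proof -
  let ?h = "FA realize (smat_class D (smat_unit D Us Vs P))"
  have Us: "set Us \<subseteq> Ob D" and Vs: "set Vs \<subseteq> Ob D" using smatsD(1,2)[OF U] by simp_all
  have r: "realizes (smat_unit D Us Vs P) ?h" using realizes_FA[OF U] .
  then have h: "?h \<in> Hom D (dsum D Us) (dsum D Vs)" by (simp add: realizes_def)
  note a = dinj_Hom[OF Us i(1)]
  have c: "dinj D Vs (\<phi> i) \<in> Hom D (Us ! i) (dsum D Vs)" using dinj_Hom[OF Vs i(2)] i(3) by simp
  show ?thesis
  proof (rule dproj_eqI[OF Vs seq_closed[OF a h] c])
    fix j assume j: "j < length Vs"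
    note b = dproj_Hom[OF Vs j]
    have "Vs ! \<phi> i \<in> Ob D" "Vs ! j \<in> Ob D" using Vs i(2) j by auto
    then have "cone D 1 (Seq D (Seq D (dinj D Us i) ?h) (dproj D Vs j)) = cone D 1 (Seq D (dinj D Vs (\<phi> i)) (dproj D Vs j))"
      using r i j P[OF j] dinj_dproj[OF Vs i(2) j] by (simp add: realizes_def entry_unit cone_Star)
    then show "Seq D (Seq D (dinj D Us i) ?h) (dproj D Vs j) = Seq D (dinj D Vs (\<phi> i)) (dproj D Vs j)"
      by (rule cone_cancel[OF seq_closed[OF seq_closed[OF a h] b] seq_closed[OF c b]])
  qed
qed

lemma dinj_realize_Inj:
  assumes U: "set Us \<subseteq> Ob D" "set Vs \<subseteq> Ob D"
  shows "i < length Us \<Longrightarrow> Seq D (dinj D Us i) (FA realize (Inj1 (Stmat D) Us Vs)) = dinj D (Us @ Vs) i"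
    "i < length Vs \<Longrightarrow> Seq D (dinj D Vs i) (FA realize (Inj2 (Stmat D) Us Vs)) = dinj D (Us @ Vs) (length Us + i)"
  using dinj_realize_unit[OF Inj1_smats[OF U], where \<phi> = "\<lambda>i. i"]
    dinj_realize_unit[OF Inj2_smats[OF U], where \<phi> = "\<lambda>i. length Us + i"] by (simp_all add: nth_append)

lemma realize_cb_hom: "realize \<in> cb_hom (Stmat D) D"
proof -
  interpret R: pca_functor "Stmat D" D realize by (rule realize_functor)
  have "preserves_finite_coproducts (Stmat D) D realize"
  proof (rule preserves_finite_coproductsI[OF realize_functor Stmat_initial])
    show "is_initial D (FO realize [])" using zero_initial FO_realize[of "[]"] by simp
    fix Us Vs assume "Us \<in> Ob (Stmat D)" "Vs \<in> Ob (Stmat D)"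
    then have U: "set Us \<subseteq> Ob D" "set Vs \<subseteq> Ob D" "set (Us @ Vs) \<subseteq> Ob D" by auto
    have I: "Inj1 (Stmat D) Us Vs \<in> Hom (Stmat D) Us (Us @ Vs)" "Inj2 (Stmat D) Us Vs \<in> Hom (Stmat D) Vs (Us @ Vs)"
      using Stmat_coproduct[OF U(1,2)] unfolding is_coproduct_def by blast+
    \<comment> \<open>The direct sum of a concatenation need not be the chosen sum of the two parts
      unless \<open>D\<close> is strict. Its universal property is therefore obtained from the
      coproducts of the words.\<close>
    have "is_coproduct D (dsum D Us) (dsum D Vs) (dsum D (Us @ Vs)) (FA realize (Inj1 (Stmat D) Us Vs)) (FA realize (Inj2 (Stmat D) Us Vs))"
      using R.FA_Hom[OF I(1)] R.FA_Hom[OF I(2)] dinj_realize_Inj[OF U(1,2)]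
      unfolding FO_realize[OF U(1)] FO_realize[OF U(2)] FO_realize[OF U(3)]
      by (intro ncoproduct_append[OF dinj_ncoproduct[OF U(1)] dinj_ncoproduct[OF U(2)] dinj_ncoproduct[OF U(3)]])
    then show "\<exists>P i j. is_coproduct (Stmat D) Us Vs P i j \<and>
       is_coproduct D (FO realize Us) (FO realize Vs) (FO realize P) (FA realize i) (FA realize j)"
      using Stmat_coproduct[OF U(1,2)] unfolding FO_realize[OF U(1)] FO_realize[OF U(2)] FO_realize[OF U(3), symmetric] by blast
  qed
  then show ?thesis using realize_pca_hom by (simp add: cb_hom_def)
qed

text \<open>The triangle identity that makes every functor the transpose of its extension.\<close>

lemma eta_realize: "funct_comp D (eta D) realize = funct_id D"
proof -
  interpret I: pca_functor D D "funct_id D" by (rule funct_id_functor[OF pca_category_axioms])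
  show ?thesis
  proof (rule funct_eqI[OF funct_comp_pca_hom[OF eta_functor realize_functor] I.F])
    fix X assume "X \<in> Ob D"
    then show "FO (funct_comp D (eta D) realize) X = FO (funct_id D) X"
      using FO_realize[of "[X]"] by (simp add: FO_funct_comp FO_eta funct_id_def)
  next
    fix f assume f: "f \<in> Ar D"
    have fH: "f \<in> Hom D (Src D f) (Tgt D f)" using f by (rule HomI)
    have "realizes (single f) f"
      using fH seq_idn_left[OF fH] seq_idn_right[OF fH] by (simp add: realizes_def single_simps[OF fH] entry_single[OF fH])
    then have "FA realize (smat_class D (single f)) = f" using FA_realize[OF single_closed[OF fH]] by simp
    then show "FA (funct_comp D (eta D) realize) f = FA (funct_id D) f"
      using f by (simp add: FA_funct_comp FA_eta[OF fH] funct_id_def)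
  qed
qed

end

section \<open>The counit in the strict case\<close>

context strict_convex_biproduct_category
begin

text \<open>Strictness removes the special role of one-letter words: adding the zero object to W
  gives W again, with the identity as injection.\<close>

lemma dsum_Cons:
  assumes "W \<in> Ob D" "set Ws \<subseteq> Ob D"
  shows "dsum D (W # Ws) = Oplus D W (dsum D Ws)"
    "dinj D (W # Ws) 0 = Inj1 D W (dsum D Ws)"
    "i < length Ws \<Longrightarrow> dinj D (W # Ws) (Suc i) = Seq D (dinj D Ws i) (Inj2 D W (dsum D Ws))"
  using oplus_zero[OF assms(1)] inj1_zero[OF assms(1)] by (cases Ws; simp)+

lemma dsum_append:
  "\<lbrakk>set Us \<subseteq> Ob D; set Vs \<subseteq> Ob D\<rbrakk> \<Longrightarrow> dsum D (Us @ Vs) = Oplus D (dsum D Us) (dsum D Vs)"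
proof (induction Us)
  case Nil
  then show ?case using zero_oplus[OF dsum_Ob] by simp
next
  case (Cons U Us)
  then show ?case
    using dsum_Cons(1)[of U "Us @ Vs"] dsum_Cons(1)[of U Us] oplus_assoc[of U "dsum D Us" "dsum D Vs"] dsum_Ob[of Us] dsum_Ob[of Vs] by simp
qed

text \<open>Each case of the induction is one strictness law: \<open>inj2_zero\<close> for the empty
  first word, \<open>inj1_inj1\<close> for the first letter, \<open>inj2_inj1\<close> for the other
  letters of the first word and \<open>inj2_inj2\<close> for those of the second.\<close>

lemma dinj_append:
  "\<lbrakk>set Us \<subseteq> Ob D; set Vs \<subseteq> Ob D; i < length Us\<rbrakk> \<Longrightarrow>
     dinj D (Us @ Vs) i = Seq D (dinj D Us i) (Inj1 D (dsum D Us) (dsum D Vs))"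
  "\<lbrakk>set Us \<subseteq> Ob D; set Vs \<subseteq> Ob D; j < length Vs\<rbrakk> \<Longrightarrow>
     dinj D (Us @ Vs) (length Us + j) = Seq D (dinj D Vs j) (Inj2 D (dsum D Us) (dsum D Vs))"
proof (induction Us arbitrary: i)
  case Nil
  case 2
  then show ?case using inj2_zero[OF dsum_Ob, of Vs] seq_idn_right[OF dinj_Hom, of Vs j] by simp
next
  case (Cons U Us)
  have *: "U \<in> Ob D \<and> set Us \<subseteq> Ob D \<and> set (Us @ Vs) \<subseteq> Ob D" if "set (U # Us) \<subseteq> Ob D" "set Vs \<subseteq> Ob D" using that by auto
  {
    case 1
    then have U: "U \<in> Ob D" "set Us \<subseteq> Ob D" "set (Us @ Vs) \<subseteq> Ob D" "set Vs \<subseteq> Ob D" by auto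
    note O = dsum_Ob[OF U(2)] dsum_Ob[OF U(4)]
    show ?case
    proof (cases i)
      case 0
      then show ?thesis
        using dsum_Cons[OF U(1,3)] dsum_Cons[OF U(1,2)] dsum_append[OF U(2,4)] inj1_inj1[OF U(1) O] by simp
    next
      case (Suc k)
      then have k: "k < length Us" using 1 by simp
      note a = dinj_Hom[OF U(2) k] and s1 = structure_Hom[OF U(1) O(1)] and s2 = structure_Hom[OF O]
      note s3 = structure_Hom[OF s1(1) O(2)] and s4 = structure_Hom[OF U(1) s2(1)]
      have "dinj D ((U # Us) @ Vs) i = Seq D (Seq D (dinj D Us k) (Inj1 D (dsum D Us) (dsum D Vs))) (Inj2 D U (Oplus D (dsum D Us) (dsum D Vs)))"
        using Suc dsum_Cons(3)[OF U(1,3), of k] Cons.IH(1)[OF U(2,4) k] dsum_append[OF U(2,4)] k by simp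
      also have "\<dots> = Seq D (Seq D (dinj D Us k) (Inj2 D U (dsum D Us))) (Inj1 D (Oplus D U (dsum D Us)) (dsum D Vs))"
        using seq_assoc[OF a s2(2) s4(3)] seq_assoc[OF a s1(3) s3(2)] inj2_inj1[OF U(1) O] by simp
      finally show ?thesis using Suc dsum_Cons[OF U(1,2)] k by simp
    qed
  next
    case 2
    then have U: "U \<in> Ob D" "set Us \<subseteq> Ob D" "set (Us @ Vs) \<subseteq> Ob D" "set Vs \<subseteq> Ob D" and j: "j < length Vs" by auto
    note O = dsum_Ob[OF U(2)] dsum_Ob[OF U(4)]
    note a = dinj_Hom[OF U(4) j] and s2 = structure_Hom[OF O]
    note s4 = structure_Hom[OF U(1) s2(1)]
    have "dinj D ((U # Us) @ Vs) (length (U # Us) + j) = Seq D (Seq D (dinj D Vs j) (Inj2 D (dsum D Us) (dsum D Vs))) (Inj2 D U (Oplus D (dsum D Us) (dsum D Vs)))"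
      using dsum_Cons(3)[OF U(1,3), of "length Us + j"] Cons.IH(2)[OF U(2,4) j] dsum_append[OF U(2,4)] j by simp
    also have "\<dots> = Seq D (dinj D Vs j) (Inj2 D (Oplus D U (dsum D Us)) (dsum D Vs))"
      using seq_assoc[OF a s2(3) s4(3)] inj2_inj2[OF U(1) O] by simp
    finally show ?case using dsum_Cons[OF U(1,2)] by simp
  }
qed simp

lemma realize_strict: "realize \<in> strict_cb_hom (Stmat D) D"
proof -
  interpret R: pca_functor "Stmat D" D realize by (rule realize_functor)
  interpret S: convex_biproduct_category "Stmat D" by (rule Stmat_convex_biproduct)
  show ?thesis
    unfolding strict_cb_hom_def
  proof (intro CollectI conjI ballI realize_cb_hom)
    show "FO realize (Zero (Stmat D)) = Zero D" using FO_realize[of "[]"] by simp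
    fix Us Vs assume UVs: "Us \<in> Ob (Stmat D)" "Vs \<in> Ob (Stmat D)"
    then have U: "set Us \<subseteq> Ob D" "set Vs \<subseteq> Ob D" "set (Us @ Vs) \<subseteq> Ob D" by auto
    note O = dsum_Ob[OF U(1)] dsum_Ob[OF U(2)]
    note s = structure_Hom[OF O]
    note FO = FO_realize[OF U(1)] FO_realize[OF U(2)] FO_realize[OF U(3), unfolded dsum_append[OF U(1,2)]]
    show "FO realize (Oplus (Stmat D) Us Vs) = Oplus D (FO realize Us) (FO realize Vs)" by (simp add: FO)
    note sS = S.structure_Hom[OF UVs]
    have H: "FA realize (Inj1 (Stmat D) Us Vs) \<in> Hom D (dsum D Us) (Oplus D (dsum D Us) (dsum D Vs))"
      "FA realize (Inj2 (Stmat D) Us Vs) \<in> Hom D (dsum D Vs) (Oplus D (dsum D Us) (dsum D Vs))"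
      "FA realize (Proj1 (Stmat D) Us Vs) \<in> Hom D (Oplus D (dsum D Us) (dsum D Vs)) (dsum D Us)"
      "FA realize (Proj2 (Stmat D) Us Vs) \<in> Hom D (Oplus D (dsum D Us) (dsum D Vs)) (dsum D Vs)"
      using R.FA_Hom[OF sS(2)] R.FA_Hom[OF sS(3)] R.FA_Hom[OF sS(4)] R.FA_Hom[OF sS(5)] FO
      unfolding Stmat_simps(6) by simp_all
    show I1: "FA realize (Inj1 (Stmat D) Us Vs) = Inj1 D (FO realize Us) (FO realize Vs)"
      unfolding FO by (rule dinj_eqI[OF U(1) H(1) s(2)]) (simp only: dinj_realize_Inj(1)[OF U(1,2)] dinj_append(1)[OF U(1,2)])
    show I2: "FA realize (Inj2 (Stmat D) Us Vs) = Inj2 D (FO realize Us) (FO realize Vs)"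
      unfolding FO by (rule dinj_eqI[OF U(2) H(2) s(3)]) (simp only: dinj_realize_Inj(2)[OF U(1,2)] dinj_append(2)[OF U(1,2)])
    \<comment> \<open>An arrow out of the sum is determined by its composites with the injections.
      These follow by functoriality from the equations between injections and projections, which
      hold in both categories.\<close>
    show "FA realize (Proj1 (Stmat D) Us Vs) = Proj1 D (FO realize Us) (FO realize Vs)"
      unfolding FO
    proof (rule copair_eqI[OF O H(3) s(4)])
      show "Seq D (Inj1 D (dsum D Us) (dsum D Vs)) (FA realize (Proj1 (Stmat D) Us Vs)) = Seq D (Inj1 D (dsum D Us) (dsum D Vs)) (Proj1 D (dsum D Us) (dsum D Vs))"
        using R.FA_Seq[OF sS(2,4)] S.inj1_proj1[OF UVs] R.FA_Idn[OF UVs(1)] I1 inj1_proj1[OF O] FO by simp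
      show "Seq D (Inj2 D (dsum D Us) (dsum D Vs)) (FA realize (Proj1 (Stmat D) Us Vs)) = Seq D (Inj2 D (dsum D Us) (dsum D Vs)) (Proj1 D (dsum D Us) (dsum D Vs))"
        using R.FA_Seq[OF sS(3,4)] S.inj2_proj1[OF UVs] R.FA_Star[OF UVs(2,1)] I2 inj2_proj1[OF O] FO by simp
    qed
    show "FA realize (Proj2 (Stmat D) Us Vs) = Proj2 D (FO realize Us) (FO realize Vs)"
      unfolding FO
    proof (rule copair_eqI[OF O H(4) s(5)])
      show "Seq D (Inj1 D (dsum D Us) (dsum D Vs)) (FA realize (Proj2 (Stmat D) Us Vs)) = Seq D (Inj1 D (dsum D Us) (dsum D Vs)) (Proj2 D (dsum D Us) (dsum D Vs))"
        using R.FA_Seq[OF sS(2,5)] S.inj1_proj2[OF UVs] R.FA_Star[OF UVs] I1 inj1_proj2[OF O] FO by simp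
      show "Seq D (Inj2 D (dsum D Us) (dsum D Vs)) (FA realize (Proj2 (Stmat D) Us Vs)) = Seq D (Inj2 D (dsum D Us) (dsum D Vs)) (Proj2 D (dsum D Us) (dsum D Vs))"
        using R.FA_Seq[OF sS(3,5)] S.inj2_proj2[OF UVs] R.FA_Idn[OF UVs(2)] I2 inj2_proj2[OF O] FO by simp
    qed
  qed
qed

end


section \<open>The adjunction\<close>

locale cb_functor = C: convex_biproduct_category C + D: convex_biproduct_category D
  for C :: "('o, 'a, 'y) cb_cat_scheme" and D :: "('p, 'b, 'z) cb_cat_scheme" +
  fixes H :: "('o, 'a, 'p, 'b) funct"
  assumes H: "H \<in> cb_hom C D"
begin

sublocale pca_functor C D H
  using H by (intro pca_functorI C.pca_category_axioms D.pca_category_axioms) (simp add: cb_hom_def)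

lemma initial: "is_initial C Z \<Longrightarrow> is_initial D (FO H Z)"
  and coproduct: "is_coproduct C X1 X2 P i1 i2 \<Longrightarrow> is_coproduct D (FO H X1) (FO H X2) (FO H P) (FA H i1) (FA H i2)"
  using H by (auto simp: cb_hom_def preserves_finite_coproducts_def)

end

section \<open>Extension of functors: existence and uniqueness\<close>

lemma cb_hom_comp:
  assumes "F \<in> cb_hom C D" "G \<in> cb_hom D E" "pca_category C" "pca_category D" "pca_category E"
  shows "funct_comp C F G \<in> cb_hom C E"
proof -
  have F: "pca_functor C D F" "preserves_finite_coproducts C D F"
    and G: "pca_functor D E G" "preserves_finite_coproducts D E G"
    using assms by (auto simp: cb_hom_def intro!: pca_functorI)
  have "preserves_finite_coproducts C E (funct_comp C F G)"
    unfolding preserves_finite_coproducts_def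
  proof (intro conjI allI impI)
    fix Z assume Z: "is_initial C Z"
    then have "is_initial E (FO G (FO F Z))" using F(2) G(2) by (simp add: preserves_finite_coproducts_def)
    then show "is_initial E (FO (funct_comp C F G) Z)" using Z by (simp add: is_initial_def FO_funct_comp)
  next
    fix X Y P i j assume P: "is_coproduct C X Y P i j"
    then have "is_coproduct E (FO G (FO F X)) (FO G (FO F Y)) (FO G (FO F P)) (FA G (FA F i)) (FA G (FA F j))"
      using F(2) G(2) by (simp add: preserves_finite_coproducts_def)
    moreover have "X \<in> Ob C" "Y \<in> Ob C" "P \<in> Ob C" "i \<in> Ar C" "j \<in> Ar C"
      using P by (auto simp: is_coproduct_def Hom_def)
    ultimately show "is_coproduct E (FO (funct_comp C F G) X) (FO (funct_comp C F G) Y) (FO (funct_comp C F G) P)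
        (FA (funct_comp C F G) i) (FA (funct_comp C F G) j)"
      by (simp add: FO_funct_comp FA_funct_comp)
  qed
  then show ?thesis using funct_comp_pca_hom[OF F(1) G(1)] by (simp add: cb_hom_def)
qed

lemma strict_cb_hom_comp:
  assumes F: "F \<in> strict_cb_hom C D" and G: "G \<in> strict_cb_hom D E"
    and C: "convex_biproduct_category C" and "pca_category D" "pca_category E"
  shows "funct_comp C F G \<in> strict_cb_hom C E"
proof -
  interpret C: convex_biproduct_category C by fact
  have FG: "F \<in> cb_hom C D" "G \<in> cb_hom D E" using F G by (auto simp: strict_cb_hom_def)
  have f: "pca_functor C D F" using FG assms C.pca_category_axioms by (auto simp: cb_hom_def intro!: pca_functorI)
  have Z: "Zero C \<in> Ob C" using C.zero_initial by (simp add: is_initial_def)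
  show ?thesis
    using F G Z pca_functor.FO_Ob[OF f] C.structure_Hom cb_hom_comp[OF FG C.pca_category_axioms assms(4,5)]
      Hom_Ar[OF C.structure_Hom(2)] Hom_Ar[OF C.structure_Hom(3)] Hom_Ar[OF C.structure_Hom(4)] Hom_Ar[OF C.structure_Hom(5)]
    by (simp add: strict_cb_hom_def FO_funct_comp FA_funct_comp)
qed

text \<open>Naturality of the unit rewrites the unit followed by the extension as \<open>F\<close>
  followed by the unit and the counit of \<open>D\<close>; these two cancel by
  \<open>eta_realize\<close>.\<close>

lemma transpose_surj:
  assumes C: "pca_category C" and D: "convex_biproduct_category D" and F: "F \<in> pca_hom C D"
  defines "H \<equiv> funct_comp (Stmat C) (Stmat_fun C D F) (convex_biproduct_category.realize D)"
  shows "H \<in> cb_hom (Stmat C) D" "transpose_fun C H = F"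
    "strict_convex_biproduct_category D \<Longrightarrow> H \<in> strict_cb_hom (Stmat C) D"
proof -
  interpret D: convex_biproduct_category D by fact
  interpret F: pca_functor C D F using C D.pca_category_axioms F by (rule pca_functorI)
  interpret S: pca_functor "Stmat C" "Stmat D" "Stmat_fun C D F"
    by (intro pca_functorI F.C.Stmat_category D.Stmat_category F.Stmat_fun_pca_hom)
  interpret I: pca_functor D D "funct_id D" by (rule funct_id_functor[OF D.pca_category_axioms])
  have s: "Stmat_fun C D F \<in> strict_cb_hom (Stmat C) (Stmat D)" by (rule Stmat_fun_strict[OF F.pca_functor_axioms])
  then have "Stmat_fun C D F \<in> cb_hom (Stmat C) (Stmat D)" by (simp add: strict_cb_hom_def)
  then show "H \<in> cb_hom (Stmat C) D"
    unfolding H_def by (rule cb_hom_comp[OF _ D.realize_cb_hom F.C.Stmat_category D.Stmat_category D.pca_category_axioms])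
  have "transpose_fun C H = funct_comp C (funct_comp C (eta C) (Stmat_fun C D F)) D.realize"
    unfolding transpose_fun_def H_def by (rule funct_comp_assoc[OF F.C.eta_functor S.pca_functor_axioms D.realize_functor, symmetric])
  also have "\<dots> = funct_comp C F (funct_comp D (eta D) D.realize)"
    unfolding eta_natural[OF F.pca_functor_axioms] by (rule funct_comp_assoc[OF F.pca_functor_axioms D.eta_functor D.realize_functor])
  also have "\<dots> = F"
    unfolding D.eta_realize
    by (rule funct_eqI[OF funct_comp_pca_hom[OF F.pca_functor_axioms I.pca_functor_axioms] F])
      (simp_all add: FO_funct_comp FA_funct_comp funct_id_def F.FO_Ob Hom_Ar[OF F.FA_Hom[OF HomI]])
  finally show "transpose_fun C H = F" .
  show "H \<in> strict_cb_hom (Stmat C) D" if "strict_convex_biproduct_category D"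
  proof -
    interpret D: strict_convex_biproduct_category D by fact
    show ?thesis unfolding H_def
      by (rule strict_cb_hom_comp[OF s D.realize_strict F.C.Stmat_convex_biproduct D.Stmat_category D.pca_category_axioms])
  qed
qed

text \<open>Two inductions on words: the target is split by the projections while the source is a
  single letter, then the source is split by the injections. What remains are arrows between
  letters, which \<open>Stmat_single_arrow\<close> reduces to arrows of \<open>C\<close>.\<close>

lemma strict_hom_eqI:
  assumes C: "pca_category C" and D: "convex_biproduct_category D"
    and H: "H \<in> strict_cb_hom (Stmat C) D" and H': "H' \<in> strict_cb_hom (Stmat C) D"
    and eq: "transpose_fun C H = transpose_fun C H'"
  shows "H = H'"
proof -
  interpret C: pca_category C by fact
  interpret S: convex_biproduct_category "Stmat C" by (rule C.Stmat_convex_biproduct)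
  interpret D: convex_biproduct_category D by fact
  interpret E: pca_functor C "Stmat C" "eta C" by (rule C.eta_functor)
  interpret H: cb_functor "Stmat C" D H
    by (unfold_locales) (use H in \<open>simp add: strict_cb_hom_def\<close>)
  interpret H': cb_functor "Stmat C" D H'
    by (unfold_locales) (use H' in \<open>simp add: strict_cb_hom_def\<close>)
  have eqO: "FO H [X] = FO H' [X]" if "X \<in> Ob C" for X
    using arg_cong[OF eq, of "\<lambda>F. FO F X"] that by (simp add: transpose_fun_def FO_funct_comp C.FO_eta)
  have eqA: "FA H (FA (eta C) f) = FA H' (FA (eta C) f)" if "f \<in> Hom C X Y" for f X Y
    using arg_cong[OF eq, of "\<lambda>F. FA F f"] that by (simp add: transpose_fun_def FA_funct_comp Hom_Ar)
  have st: "FO H [] = Zero D" "FO H' [] = Zero D"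
    using H H' by (auto simp: strict_cb_hom_def)
  have st1: "FO H (U # Us) = Oplus D (FO H [U]) (FO H Us)" "FO H' (U # Us) = Oplus D (FO H' [U]) (FO H' Us)"
    "FA H (Inj1 (Stmat C) [U] Us) = Inj1 D (FO H [U]) (FO H Us)" "FA H' (Inj1 (Stmat C) [U] Us) = Inj1 D (FO H' [U]) (FO H' Us)"
    "FA H (Inj2 (Stmat C) [U] Us) = Inj2 D (FO H [U]) (FO H Us)" "FA H' (Inj2 (Stmat C) [U] Us) = Inj2 D (FO H' [U]) (FO H' Us)"
    "FA H (Proj1 (Stmat C) [U] Us) = Proj1 D (FO H [U]) (FO H Us)" "FA H' (Proj1 (Stmat C) [U] Us) = Proj1 D (FO H' [U]) (FO H' Us)"
    "FA H (Proj2 (Stmat C) [U] Us) = Proj2 D (FO H [U]) (FO H Us)" "FA H' (Proj2 (Stmat C) [U] Us) = Proj2 D (FO H' [U]) (FO H' Us)"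
    if "set (U # Us) \<subseteq> Ob C" for U Us
  proof -
    have U: "[U] \<in> Ob (Stmat C)" "Us \<in> Ob (Stmat C)" using that by (auto simp: in_lists_conv_set)
    have "FO K (Oplus (Stmat C) [U] Us) = Oplus D (FO K [U]) (FO K Us) \<and>
        FA K (Inj1 (Stmat C) [U] Us) = Inj1 D (FO K [U]) (FO K Us) \<and>
        FA K (Inj2 (Stmat C) [U] Us) = Inj2 D (FO K [U]) (FO K Us) \<and>
        FA K (Proj1 (Stmat C) [U] Us) = Proj1 D (FO K [U]) (FO K Us) \<and>
        FA K (Proj2 (Stmat C) [U] Us) = Proj2 D (FO K [U]) (FO K Us)" if "K \<in> strict_cb_hom (Stmat C) D" for K
      using that U unfolding strict_cb_hom_def by blast
    from this[OF H] this[OF H'] show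
      "FO H (U # Us) = Oplus D (FO H [U]) (FO H Us)" "FO H' (U # Us) = Oplus D (FO H' [U]) (FO H' Us)"
      "FA H (Inj1 (Stmat C) [U] Us) = Inj1 D (FO H [U]) (FO H Us)" "FA H' (Inj1 (Stmat C) [U] Us) = Inj1 D (FO H' [U]) (FO H' Us)"
      "FA H (Inj2 (Stmat C) [U] Us) = Inj2 D (FO H [U]) (FO H Us)" "FA H' (Inj2 (Stmat C) [U] Us) = Inj2 D (FO H' [U]) (FO H' Us)"
      "FA H (Proj1 (Stmat C) [U] Us) = Proj1 D (FO H [U]) (FO H Us)" "FA H' (Proj1 (Stmat C) [U] Us) = Proj1 D (FO H' [U]) (FO H' Us)"
      "FA H (Proj2 (Stmat C) [U] Us) = Proj2 D (FO H [U]) (FO H Us)" "FA H' (Proj2 (Stmat C) [U] Us) = Proj2 D (FO H' [U]) (FO H' Us)"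
      unfolding Stmat_simps(6) append_Cons append_Nil by blast+
  qed
  have O: "FO H Us = FO H' Us" if "set Us \<subseteq> Ob C" for Us
    using that
  proof (induction Us)
    case (Cons U Us)
    then show ?case using st1(1,2)[OF Cons.prems] eqO[of U] by simp
  qed (simp add: st)
  have A1: "FA H A = FA H' A" if "U \<in> Ob C" "set Vs \<subseteq> Ob C" "A \<in> Hom (Stmat C) [U] Vs" for U Vs A
    using that
  proof (induction Vs arbitrary: A)
    case Nil
    then have "FA H A \<in> Hom D (FO H [U]) (Zero D)" "FA H' A \<in> Hom D (FO H [U]) (Zero D)"
      using H.FA_Hom[OF Nil(3)] H'.FA_Hom[OF Nil(3)] st eqO by auto
    then show ?case using D.zero_terminal D.Hom_Ob unfolding is_terminal_def by blast
  next
    case (Cons V Vs)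
    then have V: "V \<in> Ob C" "set Vs \<subseteq> Ob C" "set (V # Vs) \<subseteq> Ob C" "[V] \<in> Ob (Stmat C)" "Vs \<in> Ob (Stmat C)" "set [V] \<subseteq> Ob C"
      by (auto simp: in_lists_conv_set)
    note s = S.structure_Hom[OF V(4,5), unfolded Stmat_simps(6) append_Cons append_Nil]
    note A = Cons.prems(3)
    have HO: "FO H [V] \<in> Ob D" "FO H Vs \<in> Ob D" using H.FO_Ob V by auto
    have HA: "FA H A \<in> Hom D (FO H [U]) (Oplus D (FO H [V]) (FO H Vs))" "FA H' A \<in> Hom D (FO H [U]) (Oplus D (FO H [V]) (FO H Vs))"
      using H.FA_Hom[OF A] H'.FA_Hom[OF A] st1(1)[OF V(3)] O[OF V(3)] eqO[OF Cons.prems(1)] by auto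
    show ?case
    proof (rule D.pair_eqI[OF HO HA])
      obtain p f where p: "0 \<le> p" "p \<le> 1" and f: "f \<in> Hom C U V" and pf: "Seq (Stmat C) A (Proj1 (Stmat C) [V] Vs) = scale (Stmat C) p (FA (eta C) f)"
        using C.Stmat_single_arrow[OF S.seq_closed[OF A s(4)]] by metis
      have ef: "FA (eta C) f \<in> Hom (Stmat C) [U] [V]" using E.FA_Hom[OF f] C.FO_eta V(1) Cons.prems(1) by simp
      show "Seq D (FA H A) (Proj1 D (FO H [V]) (FO H Vs)) = Seq D (FA H' A) (Proj1 D (FO H [V]) (FO H Vs))"
        using H.FA_Seq[OF A s(4)] H'.FA_Seq[OF A s(4)] pf H.FA_scale[OF ef p] H'.FA_scale[OF ef p] eqA[OF f]
          st1(7,8)[OF V(3)] O[OF V(2)] eqO[OF V(1)] by simp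
      show "Seq D (FA H A) (Proj2 D (FO H [V]) (FO H Vs)) = Seq D (FA H' A) (Proj2 D (FO H [V]) (FO H Vs))"
        using H.FA_Seq[OF A s(5)] H'.FA_Seq[OF A s(5)] Cons.IH[OF Cons.prems(1) V(2) S.seq_closed[OF A s(5)]]
          st1(9,10)[OF V(3)] O[OF V(2)] eqO[OF V(1)] by simp
    qed
  qed
  have A: "FA H A = FA H' A" if "set Us \<subseteq> Ob C" "set Vs \<subseteq> Ob C" "A \<in> Hom (Stmat C) Us Vs" for Us Vs A
    using that
  proof (induction Us arbitrary: A)
    case Nil
    then have "FA H A \<in> Hom D (Zero D) (FO H Vs)" "FA H' A \<in> Hom D (Zero D) (FO H Vs)"
      using H.FA_Hom[OF Nil(3)] H'.FA_Hom[OF Nil(3)] st O by auto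
    then show ?case using D.zero_initial D.Hom_Ob unfolding is_initial_def by blast
  next
    case (Cons U Us)
    then have U: "U \<in> Ob C" "set Us \<subseteq> Ob C" "set (U # Us) \<subseteq> Ob C" "[U] \<in> Ob (Stmat C)" "Us \<in> Ob (Stmat C)"
      by (auto simp: in_lists_conv_set)
    note s = S.structure_Hom[OF U(4,5), unfolded Stmat_simps(6) append_Cons append_Nil]
    note A = Cons.prems(3)
    have HO: "FO H [U] \<in> Ob D" "FO H Us \<in> Ob D" using H.FO_Ob U by auto
    have HA: "FA H A \<in> Hom D (Oplus D (FO H [U]) (FO H Us)) (FO H Vs)" "FA H' A \<in> Hom D (Oplus D (FO H [U]) (FO H Us)) (FO H Vs)"
      using H.FA_Hom[OF A] H'.FA_Hom[OF A] st1(1)[OF U(3)] O[OF U(3)] O[OF Cons.prems(2)] by auto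
    show ?case
    proof (rule D.copair_eqI[OF HO HA])
      show "Seq D (Inj1 D (FO H [U]) (FO H Us)) (FA H A) = Seq D (Inj1 D (FO H [U]) (FO H Us)) (FA H' A)"
        using H.FA_Seq[OF s(2) A] H'.FA_Seq[OF s(2) A] A1[OF U(1) Cons.prems(2) S.seq_closed[OF s(2) A]]
          st1(3,4)[OF U(3)] O[OF U(2)] eqO[OF U(1)] by simp
      show "Seq D (Inj2 D (FO H [U]) (FO H Us)) (FA H A) = Seq D (Inj2 D (FO H [U]) (FO H Us)) (FA H' A)"
        using H.FA_Seq[OF s(3) A] H'.FA_Seq[OF s(3) A] Cons.IH[OF U(2) Cons.prems(2) S.seq_closed[OF s(3) A]]
          st1(5,6)[OF U(3)] O[OF U(2)] eqO[OF U(1)] by simp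
    qed
  qed
  show ?thesis
  proof (rule funct_eqI[OF H.F H'.F])
    show "FO H Us = FO H' Us" if "Us \<in> Ob (Stmat C)" for Us using that O by auto
    show "FA H B = FA H' B" if B: "B \<in> Ar (Stmat C)" for B
    proof -
      from B obtain M where M: "M \<in> smats C" "B = smat_class C M" by auto
      then show ?thesis using A[OF smatsD(1,2)[OF M(1)] C.Stmat_HomI[OF M(1) refl refl]] by simp
    qed
  qed
qed

section \<open>Extension of natural transformations\<close>

context pca_category
begin

definition word_inj :: "'o list \<Rightarrow> nat \<Rightarrow> ('o, 'a) smat set" where
  "word_inj Us i = smat_class C (smat_unit C [Us ! i] Us (\<lambda>j k. j = i))"

lemma word_inj_smats: "\<lbrakk>set Us \<subseteq> Ob C; i < length Us\<rbrakk> \<Longrightarrow> smat_unit C [Us ! i] Us (\<lambda>j k. j = i) \<in> smats C"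
  by (intro smat_unit_closed) auto

lemma word_inj_Hom: "\<lbrakk>set Us \<subseteq> Ob C; i < length Us\<rbrakk> \<Longrightarrow> word_inj Us i \<in> Hom (Stmat C) [Us ! i] Us"
  unfolding word_inj_def by (intro Stmat_HomI word_inj_smats) simp_all

lemma word_inj_single: "X \<in> Ob C \<Longrightarrow> word_inj [X] 0 = Idn (Stmat C) [X]"
proof -
  assume X: "X \<in> Ob C"
  have "smat_class C (smat_unit C [X] [X] (\<lambda>j k. j = 0)) = smat_class C (smat_unit C [X] [X] (\<lambda>j i. j = i))"
    using X word_inj_smats[of "[X]" 0] Idn_smats[of "[X]"] by (intro smat_class_unit_eq) auto
  then show ?thesis by (simp add: word_inj_def)
qed

lemma transpose_nat_apply: "X \<in> Ob C \<Longrightarrow> transpose_nat C t X = t [X]"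
  by (simp add: transpose_nat_def compose_def FO_eta)

lemma word_inj_Cons:
  assumes "set (U # Us) \<subseteq> Ob C"
  shows "word_inj (U # Us) 0 = Inj1 (Stmat C) [U] Us"
    "i < length Us \<Longrightarrow> word_inj (U # Us) (Suc i) = Seq (Stmat C) (word_inj Us i) (Inj2 (Stmat C) [U] Us)"
proof -
  have U: "set [U] \<subseteq> Ob C" "set Us \<subseteq> Ob C" using assms by auto
  show "word_inj (U # Us) 0 = Inj1 (Stmat C) [U] Us"
    unfolding word_inj_def Stmat_simps append_Cons append_Nil nth_Cons_0
    by (rule smat_class_unit_eq) (use word_inj_smats[OF assms, of 0] Inj1_smats[OF U] in auto)
  show "word_inj (U # Us) (Suc i) = Seq (Stmat C) (word_inj Us i) (Inj2 (Stmat C) [U] Us)" if i: "i < length Us"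
    unfolding word_inj_def Stmat_simps append_Cons append_Nil nth_Cons_Suc
    by (rule smat_class_unit_unit[OF word_inj_smats[OF U(2) i] Inj2_smats[OF U, unfolded append_Cons append_Nil] word_inj_smats[OF assms, of "Suc i", unfolded nth_Cons_Suc], where \<phi> = "\<lambda>k. i", symmetric])
      (use i in auto)
qed

end

context convex_biproduct_category
begin

text \<open>The identity of \<open>X \<oplus> Y\<close> is no convex combination of the \<open>\<pi>\<^sub>i ; \<iota>\<^sub>i\<close>, as the weights \<open>1\<close> and \<open>1\<close> add up to \<open>2\<close>,
  but its half is.\<close>

lemma half_decomp:
  assumes XY: "X \<in> Ob D" "Y \<in> Ob D" and B: "B \<in> Hom D A (Oplus D X Y)"
  shows "scale D (1/2) B = cplus D (1/2) (Seq D (Seq D B (Proj1 D X Y)) (Inj1 D X Y)) (Seq D (Seq D B (Proj2 D X Y)) (Inj2 D X Y))"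
    (is "_ = cplus D _ ?f ?g")
proof -
  note s = structure_Hom[OF XY]
  note b = seq_closed[OF B s(4)] seq_closed[OF B s(5)]
  note f = seq_closed[OF b(1) s(2)] and g = seq_closed[OF b(2) s(3)]
  have sB: "scale D (1/2) B \<in> Hom D A (Oplus D X Y)" using scale_closed[OF B] by simp
  have fg: "cplus D (1/2) ?f ?g \<in> Hom D A (Oplus D X Y)" using cplus_closed[OF f g] by simp
  have A: "A \<in> Ob D" using Hom_Ob[OF B] by simp
  have 1: "Seq D ?f (Proj1 D X Y) = Seq D B (Proj1 D X Y)" "Seq D ?g (Proj1 D X Y) = Star D A X"
    "Seq D ?f (Proj2 D X Y) = Star D A Y" "Seq D ?g (Proj2 D X Y) = Seq D B (Proj2 D X Y)"
    using seq_assoc[OF b(1) s(2) s(4)] seq_assoc[OF b(2) s(3) s(4)] seq_assoc[OF b(1) s(2) s(5)] seq_assoc[OF b(2) s(3) s(5)]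
      inj1_proj1[OF XY] inj1_proj2[OF XY] inj2_proj1[OF XY] inj2_proj2[OF XY]
      seq_idn_right[OF b(1)] seq_idn_right[OF b(2)] seq_star_right[OF b(1) XY(2)] seq_star_right[OF b(2) XY(1)] by simp_all
  show ?thesis
  proof (rule pair_eqI[OF XY sB fg])
    show "Seq D (scale D (1/2) B) (Proj1 D X Y) = Seq D (cplus D (1/2) ?f ?g) (Proj1 D X Y)"
      using seq_scale(1)[OF B s(4), of "1/2"] seq_cplus_left[OF _ _ f g s(4), of "1/2"] 1 by (simp add: scale_Hom[OF b(1)])
    show "Seq D (scale D (1/2) B) (Proj2 D X Y) = Seq D (cplus D (1/2) ?f ?g) (Proj2 D X Y)"
      using seq_scale(1)[OF B s(5), of "1/2"] seq_cplus_left[OF _ _ f g s(5), of "1/2"] 1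
        cplus_commute[OF Star_closed[OF A XY(2)] b(2), of "1/2"] by (simp add: scale_Hom[OF b(2)])
  qed
qed

end

text \<open>The functor is not assumed to preserve the chosen coproducts, so its value at a word is
  known only as some coproduct of its values at the letters. This is the form in which the
  components of a transformation are extended to words.\<close>

lemma word_inj_ncoproduct:
  assumes C: "pca_category C" and D: "convex_biproduct_category D" and H: "H \<in> cb_hom (Stmat C) D" and Us: "set Us \<subseteq> Ob C"
  shows "is_ncoproduct D (map (\<lambda>U. FO H [U]) Us) (FO H Us) (\<lambda>i. FA H (pca_category.word_inj C Us i))"
proof -
  interpret C: pca_category C by fact
  interpret S: convex_biproduct_category "Stmat C" by (rule C.Stmat_convex_biproduct)
  interpret D: convex_biproduct_category D by fact
  interpret H: cb_functor "Stmat C" D H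
    by (unfold_locales) (rule H)
  show ?thesis
    using Us
  proof (induction Us)
    case Nil
    then show ?case using D.ncoproduct_Nil[OF H.initial[OF C.Stmat_initial]] by simp
  next
    case (Cons U Us)
    then have U: "[U] \<in> Ob (Stmat C)" "Us \<in> Ob (Stmat C)" "set Us \<subseteq> Ob C" by (auto simp: in_lists_conv_set)
    note s = S.structure_Hom[OF U(1,2)]
    have "is_coproduct D (FO H [U]) (FO H Us) (FO H (U # Us)) (FA H (Inj1 (Stmat C) [U] Us)) (FA H (Inj2 (Stmat C) [U] Us))"
      using H.coproduct[OF S.oplus_coproduct[OF U(1,2)]] by simp
    from D.ncoproduct_Cons[OF Cons.IH[OF U(3)] this] show ?case
      using C.word_inj_Cons[OF Cons.prems] H.FA_Seq[OF C.word_inj_Hom[OF U(3)] s(3)] by (simp del: Stmat_simps)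
  qed
qed

text \<open>Naturality at the inclusions of letters forces the component at a word, hence
  injectivity. Conversely, these equations define the components by copairing, and the work lies in
  naturality for arbitrary arrows.\<close>

lemma transpose_nat_bij:
  assumes C: "pca_category C" and D: "convex_biproduct_category D"
    and H: "H \<in> cb_hom (Stmat C) D" and H': "H' \<in> cb_hom (Stmat C) D"
  shows "bij_betw (transpose_nat C) (nat_trans (Stmat C) D H H')
    (nat_trans C D (transpose_fun C H) (transpose_fun C H'))"
proof -
  interpret C: pca_category C by fact
  interpret S: convex_biproduct_category "Stmat C" by (rule C.Stmat_convex_biproduct)
  interpret D: convex_biproduct_category D by fact
  interpret H: cb_functor "Stmat C" D H by (unfold_locales) (rule H)
  interpret H': cb_functor "Stmat C" D H' by (unfold_locales) (rule H')
  interpret E: pca_functor C "Stmat C" "eta C" by (rule C.eta_functor)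
  have FO: "FO (transpose_fun C H) X = FO H [X]" "FO (transpose_fun C H') X = FO H' [X]" if "X \<in> Ob C" for X
    using that by (simp_all add: transpose_fun_def FO_funct_comp C.FO_eta)
  have FA: "FA (transpose_fun C H) f = FA H (FA (eta C) f)" "FA (transpose_fun C H') f = FA H' (FA (eta C) f)" if "f \<in> Hom C X Y" for f X Y
    using that by (simp_all add: transpose_fun_def FA_funct_comp Hom_Ar)
  note tn = C.transpose_nat_apply
  have eta_Hom: "FA (eta C) f \<in> Hom (Stmat C) [X] [Y]" if "f \<in> Hom C X Y" for f X Y
    using E.FA_Hom[OF that] C.FO_eta C.Hom_Ob[OF that] by simp
  have nth_Ob: "Us ! i \<in> Ob C" if "set Us \<subseteq> Ob C" "i < length Us" for Us i
    using that by auto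
  note inj = C.word_inj_Hom
  note nco = word_inj_ncoproduct[OF C D H]
  show ?thesis
  proof (rule bij_betw_imageI)
    show "inj_on (transpose_nat C) (nat_trans (Stmat C) D H H')"
    proof (rule inj_onI)
      fix t t' assume t: "t \<in> nat_trans (Stmat C) D H H'" and t': "t' \<in> nat_trans (Stmat C) D H H'"
        and eq: "transpose_nat C t = transpose_nat C t'"
      have "t Us = t' Us" if "Us \<in> Ob (Stmat C)" for Us
      proof -
        have Us: "set Us \<subseteq> Ob C" using that by auto
        show ?thesis
        proof (rule D.ncoproduct_eqI[OF nco[OF Us]])
          show "t Us \<in> Hom D (FO H Us) (FO H' Us)" "t' Us \<in> Hom D (FO H Us) (FO H' Us)"
            using t t' that by (auto simp: nat_trans_def simp del: Stmat_simps)
          fix i assume "i < length (map (\<lambda>U. FO H [U]) Us)"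
          then have i: "i < length Us" by simp
          have U1: "[Us ! i] \<in> Ob (Stmat C)" using nth_Ob[OF Us i] by simp
          have "Seq D (FA H (C.word_inj Us i)) (u Us) = Seq D (u [Us ! i]) (FA H' (C.word_inj Us i))"
            if "u \<in> nat_trans (Stmat C) D H H'" for u
            using that inj[OF Us i] U1 \<open>Us \<in> Ob (Stmat C)\<close> unfolding nat_trans_def by blast
          from this[OF t] this[OF t'] show "Seq D (FA H (C.word_inj Us i)) (t Us) = Seq D (FA H (C.word_inj Us i)) (t' Us)"
            using arg_cong[OF eq, of "\<lambda>t. t (Us ! i)"] by (simp add: tn[OF nth_Ob[OF Us i]])
        qed
      qed
      then show "t = t'"
        using t t' by (intro extensionalityI[of _ "Ob (Stmat C)"]) (auto simp: nat_trans_def simp del: Stmat_simps)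
    qed
    show "transpose_nat C ` nat_trans (Stmat C) D H H' = nat_trans C D (transpose_fun C H) (transpose_fun C H')"
    proof (intro equalityI subsetI)
      fix s assume "s \<in> transpose_nat C ` nat_trans (Stmat C) D H H'"
      then obtain t where t: "t \<in> nat_trans (Stmat C) D H H'" "s = transpose_nat C t" by blast
      show "s \<in> nat_trans C D (transpose_fun C H) (transpose_fun C H')"
        unfolding nat_trans_def
      proof (intro CollectI conjI ballI)
        show "s \<in> extensional (Ob C)" by (simp add: t transpose_nat_def)
        show "s X \<in> Hom D (FO (transpose_fun C H) X) (FO (transpose_fun C H') X)" if "X \<in> Ob C" for X
        proof -
          have "[X] \<in> Ob (Stmat C)" using that by simp
          then show ?thesis using t(1) by (simp add: t(2) tn FO that nat_trans_def del: Stmat_simps)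
        qed
        fix X Y f assume f: "X \<in> Ob C" "Y \<in> Ob C" "f \<in> Hom C X Y"
        then have "[X] \<in> Ob (Stmat C)" "[Y] \<in> Ob (Stmat C)" by simp_all
        then have "Seq D (FA H (FA (eta C) f)) (t [Y]) = Seq D (t [X]) (FA H' (FA (eta C) f))"
          using t(1) eta_Hom[OF f(3)] unfolding nat_trans_def by blast
        then show "Seq D (FA (transpose_fun C H) f) (s Y) = Seq D (s X) (FA (transpose_fun C H') f)"
          using f by (simp add: t(2) tn FA[OF f(3)])
      qed
    next
      fix s assume s: "s \<in> nat_trans C D (transpose_fun C H) (transpose_fun C H')"
      have sH: "s X \<in> Hom D (FO H [X]) (FO H' [X])" if "X \<in> Ob C" for X
        using s that by (simp add: nat_trans_def FO)
      have snat: "Seq D (FA H (FA (eta C) f)) (s Y) = Seq D (s X) (FA H' (FA (eta C) f))" if "f \<in> Hom C X Y" for f X Y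
      proof -
        have "Seq D (FA (transpose_fun C H) f) (s Y) = Seq D (s X) (FA (transpose_fun C H') f)"
          using s that C.Hom_Ob[OF that] unfolding nat_trans_def by blast
        then show ?thesis using FA[OF that] by simp
      qed
      define Q where "Q = (\<lambda>Us h. h \<in> Hom D (FO H Us) (FO H' Us) \<and>
        (\<forall>i<length Us. Seq D (FA H (C.word_inj Us i)) h = Seq D (s (Us ! i)) (FA H' (C.word_inj Us i))))"
      have ex: "\<exists>h. Q Us h" if Us: "set Us \<subseteq> Ob C" for Us
      proof -
        have "FO H' Us \<in> Ob D" using H'.FO_Ob[of Us] Us by auto
        moreover have "Seq D (s (Us ! i)) (FA H' (C.word_inj Us i)) \<in> Hom D (map (\<lambda>U. FO H [U]) Us ! i) (FO H' Us)"
          if "i < length (map (\<lambda>U. FO H [U]) Us)" for i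
          using that D.seq_closed[OF sH[OF nth_Ob[OF Us]] H'.FA_Hom[OF inj[OF Us]]] by simp
        ultimately obtain h where "h \<in> Hom D (FO H Us) (FO H' Us)"
          "\<And>i. i < length (map (\<lambda>U. FO H [U]) Us) \<Longrightarrow> Seq D (FA H (C.word_inj Us i)) h = Seq D (s (Us ! i)) (FA H' (C.word_inj Us i))"
          using D.ncoproduct_ex[OF nco[OF Us], where f = "\<lambda>i. Seq D (s (Us ! i)) (FA H' (C.word_inj Us i))"] by blast
        then show ?thesis unfolding Q_def by auto
      qed
      \<comment> \<open>The coproduct property makes the solution unique, so \<open>SOME\<close>
        picks the only candidate. Outside the words the value is \<open>undefined\<close>, as
        extensionality demands.\<close>
      define t where "t = restrict (\<lambda>Us. SOME h. Q Us h) (Ob (Stmat C))"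
      have Qt: "Q Us (t Us)" if Us: "set Us \<subseteq> Ob C" for Us
        using someI_ex[OF ex[OF Us]] Us by (auto simp: t_def in_lists_conv_set)
      have tH: "t Us \<in> Hom D (FO H Us) (FO H' Us)" if "set Us \<subseteq> Ob C" for Us
        using Qt[OF that] by (simp add: Q_def)
      have ti: "Seq D (FA H (C.word_inj Us i)) (t Us) = Seq D (s (Us ! i)) (FA H' (C.word_inj Us i))"
        if "set Us \<subseteq> Ob C" "i < length Us" for Us i
        using Qt[OF that(1)] that(2) by (simp add: Q_def)
      have t1: "t [X] = s X" if X: "X \<in> Ob C" for X
      proof -
        have U: "set [X] \<subseteq> Ob C" "[X] \<in> Ob (Stmat C)" using X by simp_all
        show ?thesis
          using ti[OF U(1), of 0] C.word_inj_single[OF X] H.FA_Idn[OF U(2)] H'.FA_Idn[OF U(2)]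
            D.seq_idn_left[OF tH[OF U(1)]] D.seq_idn_right[OF sH[OF X]] by (simp del: Stmat_simps)
      qed
      \<comment> \<open>Naturality at the two injections of a word split into first letter and rest,
        which is what the induction for \<open>nat1\<close> uses. For the second injection it is
        tested on the inclusions of the letters.\<close>
      have tI: "Seq D (FA H (Inj1 (Stmat C) [V] Vs)) (t (V # Vs)) = Seq D (s V) (FA H' (Inj1 (Stmat C) [V] Vs))"
        "Seq D (FA H (Inj2 (Stmat C) [V] Vs)) (t (V # Vs)) = Seq D (t Vs) (FA H' (Inj2 (Stmat C) [V] Vs))"
        if V: "set (V # Vs) \<subseteq> Ob C" for V Vs
      proof -
        show "Seq D (FA H (Inj1 (Stmat C) [V] Vs)) (t (V # Vs)) = Seq D (s V) (FA H' (Inj1 (Stmat C) [V] Vs))"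
          using ti[OF V, of 0] C.word_inj_Cons(1)[OF V] by (simp del: Stmat_simps)
        have V': "set Vs \<subseteq> Ob C" "[V] \<in> Ob (Stmat C)" "Vs \<in> Ob (Stmat C)" using V by (auto simp: in_lists_conv_set)
        note st = S.structure_Hom[OF V'(2,3), unfolded Stmat_simps(6) append_Cons append_Nil]
        note HI = H.FA_Hom[OF st(3)] and HI' = H'.FA_Hom[OF st(3)]
        show "Seq D (FA H (Inj2 (Stmat C) [V] Vs)) (t (V # Vs)) = Seq D (t Vs) (FA H' (Inj2 (Stmat C) [V] Vs))"
        proof (rule D.ncoproduct_eqI[OF nco[OF V'(1)] D.seq_closed[OF HI tH[OF V]] D.seq_closed[OF tH[OF V'(1)] HI']])
          fix i assume "i < length (map (\<lambda>U. FO H [U]) Vs)"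
          then have i: "i < length Vs" by simp
          note w = inj[OF V'(1) i]
          note Hw = H.FA_Hom[OF w] and Hw' = H'.FA_Hom[OF w]
          have "Seq D (FA H (C.word_inj Vs i)) (Seq D (FA H (Inj2 (Stmat C) [V] Vs)) (t (V # Vs)))
              = Seq D (FA H (C.word_inj (V # Vs) (Suc i))) (t (V # Vs))"
            using D.seq_assoc[OF Hw HI tH[OF V]] H.FA_Seq[OF w st(3)] C.word_inj_Cons(2)[OF V i] by (simp del: Stmat_simps)
          also have "\<dots> = Seq D (s (Vs ! i)) (FA H' (C.word_inj (V # Vs) (Suc i)))"
            using ti[OF V, of "Suc i"] i by simp
          also have "\<dots> = Seq D (Seq D (s (Vs ! i)) (FA H' (C.word_inj Vs i))) (FA H' (Inj2 (Stmat C) [V] Vs))"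
            using D.seq_assoc[OF sH[OF nth_Ob[OF V'(1) i]] Hw' HI'] H'.FA_Seq[OF w st(3)] C.word_inj_Cons(2)[OF V i] by (simp del: Stmat_simps)
          also have "\<dots> = Seq D (FA H (C.word_inj Vs i)) (Seq D (t Vs) (FA H' (Inj2 (Stmat C) [V] Vs)))"
            using D.seq_assoc[OF Hw tH[OF V'(1)] HI'] ti[OF V'(1) i] by (simp del: Stmat_simps)
          finally show "Seq D (FA H (C.word_inj Vs i)) (Seq D (FA H (Inj2 (Stmat C) [V] Vs)) (t (V # Vs)))
            = Seq D (FA H (C.word_inj Vs i)) (Seq D (t Vs) (FA H' (Inj2 (Stmat C) [V] Vs)))" .
        qed
      qed
      \<comment> \<open>Induction on the target word for a one-letter source. The functors need not
        send the projections to the chosen ones of \<open>D\<close>, so joint monicity in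
        \<open>D\<close> is not directly available. Instead, \<open>half_decomp\<close> in
        \<open>Stmat C\<close> writes half of the arrow as a midpoint of arrows through the first
        letter and through the rest. Functors preserve this, and \<open>half_cancel\<close> in
        \<open>D\<close> removes the half.\<close>
      have nat1: "Seq D (FA H B) (t Vs) = Seq D (s U) (FA H' B)"
        if "U \<in> Ob C" "set Vs \<subseteq> Ob C" "B \<in> Hom (Stmat C) [U] Vs" for U Vs B
        using that
      proof (induction Vs arbitrary: B)
        case Nil
        have U: "[U] \<in> Ob (Stmat C)" "[] \<in> Ob (Stmat C)" using Nil by simp_all
        \<comment> \<open>Terminality is used in the source, since the functors are assumed to
          preserve initial objects only. The unique arrow is a star, and stars are
          preserved.\<close>
        have "\<exists>!f. f \<in> Hom (Stmat C) [U] []" using C.Stmat_terminal U(1) unfolding is_terminal_def by blast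
        then have "B = Star (Stmat C) [U] []" using Nil(3) S.Star_closed[OF U] by blast
        then show ?case
          using H.FA_Star[OF U] H'.FA_Star[OF U] D.seq_star_left[OF H.FO_Ob[OF U(1)] tH[of "[]"]]
            D.seq_star_right[OF sH[OF Nil(1)] H'.FO_Ob[OF U(2)]] by (simp del: Stmat_simps)
      next
        case (Cons V Vs)
        then have V: "V \<in> Ob C" "set Vs \<subseteq> Ob C" "[V] \<in> Ob (Stmat C)" "Vs \<in> Ob (Stmat C)" by (auto simp: in_lists_conv_set)
        note U = Cons.prems(1) and VV = Cons.prems(2) and B = Cons.prems(3)
        have B': "B \<in> Hom (Stmat C) [U] (Oplus (Stmat C) [V] Vs)" using B by simp
        note st = S.structure_Hom[OF V(3,4), unfolded Stmat_simps(6) append_Cons append_Nil]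
        let ?I1 = "Inj1 (Stmat C) [V] Vs" and ?I2 = "Inj2 (Stmat C) [V] Vs"
        let ?B1 = "Seq (Stmat C) B (Proj1 (Stmat C) [V] Vs)" and ?B2 = "Seq (Stmat C) B (Proj2 (Stmat C) [V] Vs)"
        note B1 = S.seq_closed[OF B st(4)] and B2 = S.seq_closed[OF B st(5)]
        note c1 = S.seq_closed[OF B1 st(2)] and c2 = S.seq_closed[OF B2 st(3)]
        have dec: "scale D (1/2) (FA K B) = cplus D (1/2) (Seq D (FA K ?B1) (FA K ?I1)) (Seq D (FA K ?B2) (FA K ?I2))"
          if "cb_functor (Stmat C) D K" for K
        proof -
          interpret K: cb_functor "Stmat C" D K by fact
          show ?thesis
            using arg_cong[OF S.half_decomp[OF V(3,4) B'], of "FA K"] K.FA_scale[OF B, of "1/2"] K.FA_cplus[OF c1 c2, of "1/2"]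
              K.FA_Seq[OF B1 st(2)] K.FA_Seq[OF B2 st(3)] by (simp del: Stmat_simps)
        qed
        note dH = dec[OF H.cb_functor_axioms] and dH' = dec[OF H'.cb_functor_axioms]
        note tV = tH[OF VV] and sU = sH[OF U]
        note h1 = D.seq_closed[OF H.FA_Hom[OF B1] H.FA_Hom[OF st(2)]] and h2 = D.seq_closed[OF H.FA_Hom[OF B2] H.FA_Hom[OF st(3)]]
        note h1' = D.seq_closed[OF H'.FA_Hom[OF B1] H'.FA_Hom[OF st(2)]] and h2' = D.seq_closed[OF H'.FA_Hom[OF B2] H'.FA_Hom[OF st(3)]]
        \<comment> \<open>An arrow between letters is a scalar multiple of an arrow of
          \<open>C\<close>, and there the naturality of \<open>s\<close> is given.\<close>
        have n1: "Seq D (FA H ?B1) (s V) = Seq D (s U) (FA H' ?B1)"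
        proof -
          obtain p f where p: "0 \<le> p" "p \<le> 1" and f: "f \<in> Hom C U V" and pf: "?B1 = scale (Stmat C) p (FA (eta C) f)"
            using C.Stmat_single_arrow[OF B1] by metis
          note ef = eta_Hom[OF f]
          show ?thesis unfolding pf H.FA_scale[OF ef p] H'.FA_scale[OF ef p]
            using D.seq_scale(1)[OF H.FA_Hom[OF ef] sH[OF V(1)] p] D.seq_scale(2)[OF sU H'.FA_Hom[OF ef] p] snat[OF f] by simp
        qed
        have e1: "Seq D (Seq D (FA H ?B1) (FA H ?I1)) (t (V # Vs)) = Seq D (s U) (Seq D (FA H' ?B1) (FA H' ?I1))"
          using D.seq_assoc[OF H.FA_Hom[OF B1] H.FA_Hom[OF st(2)] tV] tI(1)[OF VV]
            D.seq_assoc[OF H.FA_Hom[OF B1] sH[OF V(1)] H'.FA_Hom[OF st(2)]] n1 D.seq_assoc[OF sU H'.FA_Hom[OF B1] H'.FA_Hom[OF st(2)]]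
          by (simp del: Stmat_simps)
        have e2: "Seq D (Seq D (FA H ?B2) (FA H ?I2)) (t (V # Vs)) = Seq D (s U) (Seq D (FA H' ?B2) (FA H' ?I2))"
          using D.seq_assoc[OF H.FA_Hom[OF B2] H.FA_Hom[OF st(3)] tV] tI(2)[OF VV]
            D.seq_assoc[OF H.FA_Hom[OF B2] tH[OF V(2)] H'.FA_Hom[OF st(3)]] Cons.IH[OF U V(2) B2] D.seq_assoc[OF sU H'.FA_Hom[OF B2] H'.FA_Hom[OF st(3)]]
          by (simp del: Stmat_simps)
        have l: "Seq D (FA H B) (t (V # Vs)) \<in> Hom D (FO H [U]) (FO H' (V # Vs))" using D.seq_closed[OF H.FA_Hom[OF B] tV] .
        have r: "Seq D (s U) (FA H' B) \<in> Hom D (FO H [U]) (FO H' (V # Vs))" using D.seq_closed[OF sU H'.FA_Hom[OF B]] .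
        show ?case
        proof (rule D.half_cancel[OF l r])
          have "scale D (1/2) (Seq D (FA H B) (t (V # Vs))) = Seq D (scale D (1/2) (FA H B)) (t (V # Vs))"
            by (rule D.seq_scale(1)[OF H.FA_Hom[OF B] tV, symmetric]) auto
          also have "\<dots> = cplus D (1/2) (Seq D (s U) (Seq D (FA H' ?B1) (FA H' ?I1))) (Seq D (s U) (Seq D (FA H' ?B2) (FA H' ?I2)))"
            unfolding dH e1[symmetric] e2[symmetric] by (rule D.seq_cplus_left[OF _ _ h1 h2 tV]) auto
          also have "\<dots> = Seq D (s U) (scale D (1/2) (FA H' B))"
            unfolding dH' by (rule D.seq_cplus_right[OF _ _ sU h1' h2', symmetric]) auto
          also have "\<dots> = scale D (1/2) (Seq D (s U) (FA H' B))"
            by (rule D.seq_scale(2)[OF sU H'.FA_Hom[OF B]]) auto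
          finally show "scale D (1/2) (Seq D (FA H B) (t (V # Vs))) = scale D (1/2) (Seq D (s U) (FA H' B))" .
        qed
      qed
      have "t \<in> nat_trans (Stmat C) D H H'"
        unfolding nat_trans_def
      proof (intro CollectI conjI ballI)
        show "t \<in> extensional (Ob (Stmat C))" by (simp add: t_def)
        show "t Us \<in> Hom D (FO H Us) (FO H' Us)" if "Us \<in> Ob (Stmat C)" for Us using that tH by auto
        fix Us Vs A assume "Us \<in> Ob (Stmat C)" "Vs \<in> Ob (Stmat C)" and A: "A \<in> Hom (Stmat C) Us Vs"
        then have U: "set Us \<subseteq> Ob C" "set Vs \<subseteq> Ob C" by auto
        note HA = H.FA_Hom[OF A] and HA' = H'.FA_Hom[OF A]
        show "Seq D (FA H A) (t Vs) = Seq D (t Us) (FA H' A)"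
        \<comment> \<open>Testing on the inclusions of letters reduces the source to a single
          letter, the case settled by \<open>nat1\<close>.\<close>
        proof (rule D.ncoproduct_eqI[OF nco[OF U(1)] D.seq_closed[OF HA tH[OF U(2)]] D.seq_closed[OF tH[OF U(1)] HA']])
          fix i assume "i < length (map (\<lambda>U. FO H [U]) Us)"
          then have i: "i < length Us" by simp
          note w = inj[OF U(1) i] and Ui = nth_Ob[OF U(1) i]
          note Hw = H.FA_Hom[OF w] and Hw' = H'.FA_Hom[OF w]
          show "Seq D (FA H (C.word_inj Us i)) (Seq D (FA H A) (t Vs)) = Seq D (FA H (C.word_inj Us i)) (Seq D (t Us) (FA H' A))"
            using D.seq_assoc[OF Hw HA tH[OF U(2)]] H.FA_Seq[OF w A] nat1[OF Ui U(2) S.seq_closed[OF w A]] H'.FA_Seq[OF w A]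
              D.seq_assoc[OF sH[OF Ui] Hw' HA'] ti[OF U(1) i] D.seq_assoc[OF Hw tH[OF U(1)] HA'] by (simp del: Stmat_simps)
        qed
      qed
      moreover have "s = transpose_nat C t"
      proof (rule extensionalityI[of _ "Ob C"])
        show "s \<in> extensional (Ob C)" using s by (simp add: nat_trans_def)
        show "transpose_nat C t \<in> extensional (Ob C)" by (simp add: transpose_nat_def)
        show "s X = transpose_nat C t X" if "X \<in> Ob C" for X using that by (simp add: tn t1)
      qed
      ultimately show "s \<in> transpose_nat C ` nat_trans (Stmat C) D H H'" by blast
    qed
  qed
qed

text \<open>Coproducts are preserved only up to isomorphism, so a functor on words is not determined
  on the nose by its transpose. This is why the universal property has two forms: a literal
  bijection for strict functors into a strict \<open>D\<close>, and in general surjectivity together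
  with a bijection on natural transformations, by which functors with equal transposes are
  isomorphic.\<close>

theorem theorem2:
  fixes C :: "('o, 'a) pca_cat" and C' :: "('o1, 'a1) pca_cat" and C'' :: "('o2, 'a2) pca_cat"
    and D :: "('p, 'b) cb_cat" and D' :: "('p1, 'b1) cb_cat"
  assumes "pca_category C" and "pca_category C'" and "pca_category C''"
    and "convex_biproduct_category D" and "convex_biproduct_category D'"
  shows
    "\<comment> \<open>Stmat is a functor\<close>
     strict_convex_biproduct_category (Stmat C) \<and>
     (\<forall>F\<in>pca_hom C C'. Stmat_fun C C' F \<in> strict_cb_hom (Stmat C) (Stmat C')) \<and>
     Stmat_fun C C (funct_id C) = funct_id (Stmat C) \<and>
     (\<forall>F\<in>pca_hom C C'. \<forall>G\<in>pca_hom C' C''.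
        Stmat_fun C C'' (funct_comp C F G) = funct_comp (Stmat C) (Stmat_fun C C' F) (Stmat_fun C' C'' G)) \<and>

     \<comment> \<open>transposition is well defined, and natural in the source and in the target\<close>
     (\<forall>H\<in>cb_hom (Stmat C) D. transpose_fun C H \<in> pca_hom C (forget D)) \<and>
     (\<forall>K\<in>pca_hom C' C. \<forall>H\<in>cb_hom (Stmat C) D.
        transpose_fun C' (funct_comp (Stmat C') (Stmat_fun C' C K) H) = funct_comp C' K (transpose_fun C H)) \<and>
     (\<forall>H\<in>cb_hom (Stmat C) D. \<forall>L\<in>cb_hom D D'.
        transpose_fun C (funct_comp (Stmat C) H L) = funct_comp C (transpose_fun C H) L) \<and>

     \<comment> \<open>with strictly associative and strictly preserved coproducts, it is a bijection\<close>
     (strict_convex_biproduct_category D \<longrightarrow>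
        bij_betw (transpose_fun C) (strict_cb_hom (Stmat C) D) (pca_hom C (forget D))) \<and>

     \<comment> \<open>in general, it is surjective, and bijective on natural transformations\<close>
     transpose_fun C ` cb_hom (Stmat C) D = pca_hom C (forget D) \<and>
     (\<forall>H\<in>cb_hom (Stmat C) D. \<forall>H'\<in>cb_hom (Stmat C) D.
        bij_betw (transpose_nat C) (nat_trans (Stmat C) D H H')
          (nat_trans C (forget D) (transpose_fun C H) (transpose_fun C H')))"
proof -
  note C = assms(1) and C' = assms(2) and C'' = assms(3)
  interpret D: convex_biproduct_category D by fact
  interpret D': convex_biproduct_category D' by fact
  note S = pca_category.Stmat_category[OF C] and S' = pca_category.Stmat_category[OF C']
  note pf = pca_functorI[OF C C'] pca_functorI[OF C' C''] pca_functorI[OF C' C] pca_functorI[OF D.pca_category_axioms D'.pca_category_axioms]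
  have cbH: "pca_functor (Stmat C) D H" if "H \<in> cb_hom (Stmat C) D" for H
    using that by (intro pca_functorI S D.pca_category_axioms) (simp add: cb_hom_def)
  have cbL: "pca_functor D D' L" if "L \<in> cb_hom D D'" for L
    using that by (intro pf) (simp add: cb_hom_def)
  have tr: "transpose_fun C H \<in> pca_hom C D" if "H \<in> cb_hom (Stmat C) D" for H
    using pca_functor.F[OF transpose_fun_functor[OF cbH[OF that] C]] .
  have nat_src: "transpose_fun C' (funct_comp (Stmat C') (Stmat_fun C' C K) H) = funct_comp C' K (transpose_fun C H)"
    if K: "K \<in> pca_hom C' C" and H: "H \<in> cb_hom (Stmat C) D" for K H
  proof -
    note Kf = pf(3)[OF K]
    have SK: "pca_functor (Stmat C') (Stmat C) (Stmat_fun C' C K)"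
      by (intro pca_functorI S S' pca_functor.Stmat_fun_pca_hom[OF Kf])
    show ?thesis
      unfolding transpose_fun_def
      using funct_comp_assoc[OF pca_category.eta_functor[OF C'] SK cbH[OF H]]
        funct_comp_assoc[OF Kf pca_category.eta_functor[OF C] cbH[OF H]] eta_natural[OF Kf] by simp
  qed
  have nat_tgt: "transpose_fun C (funct_comp (Stmat C) H L) = funct_comp C (transpose_fun C H) L"
    if H: "H \<in> cb_hom (Stmat C) D" and L: "L \<in> cb_hom D D'" for H L
    unfolding transpose_fun_def
    by (rule funct_comp_assoc[OF pca_category.eta_functor[OF C] cbH[OF H] cbL[OF L], symmetric])
  have bij: "bij_betw (transpose_fun C) (strict_cb_hom (Stmat C) D) (pca_hom C D)"
    if "strict_convex_biproduct_category D"
  proof (rule bij_betw_imageI)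
    show "inj_on (transpose_fun C) (strict_cb_hom (Stmat C) D)"
      using strict_hom_eqI[OF C assms(4)] by (rule inj_onI)
    show "transpose_fun C ` strict_cb_hom (Stmat C) D = pca_hom C D"
    proof (intro equalityI subsetI)
      fix F assume F: "F \<in> pca_hom C D"
      show "F \<in> transpose_fun C ` strict_cb_hom (Stmat C) D"
        using transpose_surj(2)[OF C assms(4) F] transpose_surj(3)[OF C assms(4) F that] by (metis imageI)
    qed (auto simp: strict_cb_hom_def intro: tr)
  qed
  have surj: "transpose_fun C ` cb_hom (Stmat C) D = pca_hom C D"
  proof (intro equalityI subsetI)
    fix F assume F: "F \<in> pca_hom C D"
    show "F \<in> transpose_fun C ` cb_hom (Stmat C) D"
      using transpose_surj(1,2)[OF C assms(4) F] by (metis imageI)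
  qed (auto intro: tr)
  show ?thesis
    unfolding pca_hom_forget_right nat_trans_forget
    using pca_category.Stmat_strict[OF C] Stmat_fun_strict[OF pf(1)] Stmat_fun_id[OF C] Stmat_fun_comp[OF pf(1) pf(2)]
      tr nat_src nat_tgt bij surj transpose_nat_bij[OF C assms(4)]
    by (intro conjI ballI impI)
qed

end
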